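(* The functors $\mathrm{Gl}$ and $\mathrm{Prim}$ preserve the Moore complex and its length: for a simplicial cocommutative Hopf algebra $\mathcal H$ over $\kappa$, applying $\mathrm{Gl}$ (resp. $\mathrm{Prim}$) degreewise gives a simplicial group (resp. simplicial Lie algebra) whose Moore complex is obtained by applying $\mathrm{Gl}$ (resp. $\mathrm{Prim}$) to the Moore complex of $\mathcal H$, and if $\mathcal H$ has Moore complex of length $n$ then so does the resulting simplicial group (resp. simplicial Lie algebra). Therefore, for each $n$, there are functors $$\{\mathrm{SimpLie}_{\le n}\}\xleftarrow{\ \mathrm{Prim}\ }\{\mathrm{SimpHopf}^{cc}_{\le n}\}\xrightarrow{\ \mathrm{Gl}\ }\{\mathrm{SimpGrp}_{\le n}\}$$ between the categories of simplicial Lie algebras, simplicial cocommutative Hopf algebras, and simplicial groups with Moore complex of length $n$, respectively.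
   Context: All Hopf algebras are cocommutative over an arbitrary field $\kappa$, with coproduct $\delta(x)=\sum_{(x)}x'\otimes x''$ and counit $\epsilon$. The zero object is $\kappa$. For a Hopf algebra map $f\colon A\to B$, $\mathrm{HKer}(f)=\{x\in A:\sum_{(x)}x'\otimes f(x'')=x\otimes 1_B\}$. $\mathrm{Prim}(H)=\{x\in H:\delta(x)=x\otimes1_H+1_H\otimes x\}$ is a Lie algebra under $[x,y]=xy-yx$; $\mathrm{Gl}(H)=\{x\in H:\delta(x)=x\otimes x,\ \epsilon(x)=1\}$ is a group under the product of $H$. For a simplicial cocommutative Hopf algebra $\mathcal H=(H_n,d_i,s_j)$ the Moore complex is $NH_0=H_0$, $NH_n=\bigcap_{i=0}^{n-1}\mathrm{HKer}(d_i\colon H_n\to H_{n-1})$ for $n\ge1$, with $\partial_n\colon NH_n\to NH_{n-1}$ the restriction of $d_n$. For simplicial groups and simplicial Lie algebras the Moore complex is defined in the same way with the ordinary kernels $\ker(d_i)$. In each case the Moore complex has length $n$ if its $i$-th term is the zero object (i.e. $\kappa$, the trivial group, the zero Lie algebra, respectively) for all $i>n$. *)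

theory Defs
  imports "HOL-Algebra.AbelCoset" "HOL-Algebra.Module"
begin

section \<open>Tensor products over a commutative ring\<close>

text \<open>
  The tensor product of two modules is the free module on the set of pairs modulo the submodule
  generated by the bilinearity relations.  As usual for module records, the fields mult and one
  have no meaning when only the module structure is used.
\<close>

definition free_pairs ::
  "('k, 'z) ring_scheme \<Rightarrow> 'a set \<Rightarrow> 'b set \<Rightarrow> ('k, 'a \<times> 'b \<Rightarrow> 'k) module" where
  "free_pairs K A B =
    \<lparr>carrier = {f. (\<forall>p. f p \<in> carrier K) \<and> (\<forall>p. p \<notin> A \<times> B \<longrightarrow> f p = \<zero>\<^bsub>K\<^esub>) \<and>
                   finite {p. f p \<noteq> \<zero>\<^bsub>K\<^esub>}},
     mult = undefined, one = undefined,
     zero = (\<lambda>p. \<zero>\<^bsub>K\<^esub>),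
     add = (\<lambda>f g p. f p \<oplus>\<^bsub>K\<^esub> g p),
     smult = (\<lambda>c f p. c \<otimes>\<^bsub>K\<^esub> f p)\<rparr>"

definition single_pair :: "('k, 'z) ring_scheme \<Rightarrow> 'a \<Rightarrow> 'b \<Rightarrow> ('a \<times> 'b \<Rightarrow> 'k)" where
  "single_pair K a b = (\<lambda>p. if p = (a, b) then \<one>\<^bsub>K\<^esub> else \<zero>\<^bsub>K\<^esub>)"

definition bilinear_rels ::
  "('k, 'z) ring_scheme \<Rightarrow> ('k, 'a, 'm) module_scheme \<Rightarrow> ('k, 'b, 'n) module_scheme \<Rightarrow>
    ('a \<times> 'b \<Rightarrow> 'k) set" where
  "bilinear_rels K M N = (let F = free_pairs K (carrier M) (carrier N); e = single_pair K in
     {e (a \<oplus>\<^bsub>M\<^esub> a') b \<ominus>\<^bsub>F\<^esub> (e a b \<oplus>\<^bsub>F\<^esub> e a' b) | a a' b.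
        a \<in> carrier M \<and> a' \<in> carrier M \<and> b \<in> carrier N} \<union>
     {e a (b \<oplus>\<^bsub>N\<^esub> b') \<ominus>\<^bsub>F\<^esub> (e a b \<oplus>\<^bsub>F\<^esub> e a b') | a b b'.
        a \<in> carrier M \<and> b \<in> carrier N \<and> b' \<in> carrier N} \<union>
     {e (c \<odot>\<^bsub>M\<^esub> a) b \<ominus>\<^bsub>F\<^esub> c \<odot>\<^bsub>F\<^esub> e a b | c a b.
        c \<in> carrier K \<and> a \<in> carrier M \<and> b \<in> carrier N} \<union>
     {e a (c \<odot>\<^bsub>N\<^esub> b) \<ominus>\<^bsub>F\<^esub> c \<odot>\<^bsub>F\<^esub> e a b | c a b.
        c \<in> carrier K \<and> a \<in> carrier M \<and> b \<in> carrier N})"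

definition tensor_kernel ::
  "('k, 'z) ring_scheme \<Rightarrow> ('k, 'a, 'm) module_scheme \<Rightarrow> ('k, 'b, 'n) module_scheme \<Rightarrow>
    ('a \<times> 'b \<Rightarrow> 'k) set" where
  "tensor_kernel K M N =
     \<Inter>{S. submodule S K (free_pairs K (carrier M) (carrier N)) \<and> bilinear_rels K M N \<subseteq> S}"

definition tensor_module ::
  "('k, 'z) ring_scheme \<Rightarrow> ('k, 'a, 'm) module_scheme \<Rightarrow> ('k, 'b, 'n) module_scheme \<Rightarrow>
    ('k, ('a \<times> 'b \<Rightarrow> 'k) set) module" where
  "tensor_module K M N = (let F = free_pairs K (carrier M) (carrier N); R = tensor_kernel K M N in
    \<lparr>carrier = a_rcosets\<^bsub>F\<^esub> R,
     mult = undefined, one = undefined,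
     zero = R,
     add = (\<lambda>X Y. X <+>\<^bsub>F\<^esub> Y),
     smult = (\<lambda>c X. \<Union>f\<in>X. R +>\<^bsub>F\<^esub> (c \<odot>\<^bsub>F\<^esub> f))\<rparr>)"

definition pure_tensor ::
  "('k, 'z) ring_scheme \<Rightarrow> ('k, 'a, 'm) module_scheme \<Rightarrow> ('k, 'b, 'n) module_scheme \<Rightarrow>
    'a \<Rightarrow> 'b \<Rightarrow> ('a \<times> 'b \<Rightarrow> 'k) set" where
  "pure_tensor K M N a b =
     tensor_kernel K M N +>\<^bsub>free_pairs K (carrier M) (carrier N)\<^esub> single_pair K a b"

text \<open>
  The linear map out of a tensor product induced by a bilinear map \<open>\<beta>\<close> into \<open>P\<close>: evaluate the
  linear extension of \<open>\<beta>\<close> at a representative.  For bilinear \<open>\<beta>\<close> the choice of the representative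
  is immaterial.
\<close>

definition tensor_lift ::
  "('k, 'z) ring_scheme \<Rightarrow> ('k, 'c, 'p) module_scheme \<Rightarrow> ('a \<Rightarrow> 'b \<Rightarrow> 'c) \<Rightarrow>
    ('a \<times> 'b \<Rightarrow> 'k) set \<Rightarrow> 'c" where
  "tensor_lift K P \<beta> X = (let f = (SOME f. f \<in> X) in
     \<Oplus>\<^bsub>P\<^esub>p\<in>{p. f p \<noteq> \<zero>\<^bsub>K\<^esub>}. f p \<odot>\<^bsub>P\<^esub> \<beta> (fst p) (snd p))"

text \<open>The tensor product of two algebras, with \<open>(a \<otimes> b)(c \<otimes> d) = ac \<otimes> bd\<close>.\<close>

definition tensor_algebra ::
  "('k, 'z) ring_scheme \<Rightarrow> ('k, 'a, 'm) module_scheme \<Rightarrow> ('k, 'b, 'n) module_scheme \<Rightarrow>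
    ('k, ('a \<times> 'b \<Rightarrow> 'k) set) module" where
  "tensor_algebra K A B = (let T = tensor_module K A B in
    T\<lparr>mult := (\<lambda>X Y. tensor_lift K T (\<lambda>a b. tensor_lift K T
                (\<lambda>c d. pure_tensor K A B (a \<otimes>\<^bsub>A\<^esub> c) (b \<otimes>\<^bsub>B\<^esub> d)) Y) X),
      one := pure_tensor K A B \<one>\<^bsub>A\<^esub> \<one>\<^bsub>B\<^esub>\<rparr>)"

text \<open>\<open>f \<otimes> g\<close> with codomain \<open>M \<otimes> N\<close>; its domain is not needed to write it down.\<close>

definition tensor_map ::
  "('k, 'z) ring_scheme \<Rightarrow> ('k, 'c, 'm) module_scheme \<Rightarrow> ('k, 'd, 'n) module_scheme \<Rightarrow>
    ('a \<Rightarrow> 'c) \<Rightarrow> ('b \<Rightarrow> 'd) \<Rightarrow> ('a \<times> 'b \<Rightarrow> 'k) set \<Rightarrow> ('c \<times> 'd \<Rightarrow> 'k) set" where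
  "tensor_map K M N f g =
     tensor_lift K (tensor_module K M N) (\<lambda>a b. pure_tensor K M N (f a) (g b))"

text \<open>The canonical maps \<open>M \<otimes> M \<rightarrow> M \<otimes> M\<close> and \<open>(M \<otimes> M) \<otimes> M \<rightarrow> M \<otimes> (M \<otimes> M)\<close>.\<close>

definition tensor_swap ::
  "('k, 'z) ring_scheme \<Rightarrow> ('k, 'a, 'm) module_scheme \<Rightarrow>
    ('a \<times> 'a \<Rightarrow> 'k) set \<Rightarrow> ('a \<times> 'a \<Rightarrow> 'k) set" where
  "tensor_swap K M = tensor_lift K (tensor_module K M M) (\<lambda>a b. pure_tensor K M M b a)"

definition tensor_assoc ::
  "('k, 'z) ring_scheme \<Rightarrow> ('k, 'a, 'm) module_scheme \<Rightarrow>
    (('a \<times> 'a \<Rightarrow> 'k) set \<times> 'a \<Rightarrow> 'k) set \<Rightarrow> ('a \<times> ('a \<times> 'a \<Rightarrow> 'k) set \<Rightarrow> 'k) set" where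
  "tensor_assoc K M =
     (let MM = tensor_module K M M; T = tensor_module K M MM in
       tensor_lift K T (\<lambda>t c. tensor_lift K T
         (\<lambda>a b. pure_tensor K M MM a (pure_tensor K M M b c)) t))"


section \<open>Cocommutative Hopf algebras\<close>

record ('k, 'a) hopf = "('k, 'a) module" +
  comult :: "'a \<Rightarrow> ('a \<times> 'a \<Rightarrow> 'k) set"
  counit :: "'a \<Rightarrow> 'k"
  antipode :: "'a \<Rightarrow> 'a"

locale cocomm_hopf = K?: field K + H?: module K H + H?: ring H
  for K :: "('k, 'z) ring_scheme" (structure) and H :: "('k, 'a) hopf" (structure) +
  assumes smult_mult_left: "\<lbrakk>c \<in> carrier K; x \<in> carrier H; y \<in> carrier H\<rbrakk> \<Longrightarrow>
        (c \<odot>\<^bsub>H\<^esub> x) \<otimes>\<^bsub>H\<^esub> y = c \<odot>\<^bsub>H\<^esub> (x \<otimes>\<^bsub>H\<^esub> y)"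
    and smult_mult_right: "\<lbrakk>c \<in> carrier K; x \<in> carrier H; y \<in> carrier H\<rbrakk> \<Longrightarrow>
        x \<otimes>\<^bsub>H\<^esub> (c \<odot>\<^bsub>H\<^esub> y) = c \<odot>\<^bsub>H\<^esub> (x \<otimes>\<^bsub>H\<^esub> y)"
    and comult_hom: "comult H \<in> ring_hom H (tensor_algebra K H H)"
    and comult_smult: "\<lbrakk>c \<in> carrier K; x \<in> carrier H\<rbrakk> \<Longrightarrow>
        comult H (c \<odot>\<^bsub>H\<^esub> x) = c \<odot>\<^bsub>tensor_algebra K H H\<^esub> comult H x"
    and counit_hom: "counit H \<in> ring_hom H K"
    and counit_smult: "\<lbrakk>c \<in> carrier K; x \<in> carrier H\<rbrakk> \<Longrightarrow>
        counit H (c \<odot>\<^bsub>H\<^esub> x) = c \<otimes>\<^bsub>K\<^esub> counit H x"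
    and coassoc: "x \<in> carrier H \<Longrightarrow>
        tensor_assoc K H (tensor_map K (tensor_module K H H) H (comult H) id (comult H x)) =
        tensor_map K H (tensor_module K H H) id (comult H) (comult H x)"
    and counit_left: "x \<in> carrier H \<Longrightarrow>
        tensor_lift K H (\<lambda>a b. counit H a \<odot>\<^bsub>H\<^esub> b) (comult H x) = x"
    and counit_right: "x \<in> carrier H \<Longrightarrow>
        tensor_lift K H (\<lambda>a b. counit H b \<odot>\<^bsub>H\<^esub> a) (comult H x) = x"
    and cocommutative: "x \<in> carrier H \<Longrightarrow> tensor_swap K H (comult H x) = comult H x"
    and antipode_closed: "x \<in> carrier H \<Longrightarrow> antipode H x \<in> carrier H"
    and antipode_add: "\<lbrakk>x \<in> carrier H; y \<in> carrier H\<rbrakk> \<Longrightarrow>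
        antipode H (x \<oplus>\<^bsub>H\<^esub> y) = antipode H x \<oplus>\<^bsub>H\<^esub> antipode H y"
    and antipode_smult: "\<lbrakk>c \<in> carrier K; x \<in> carrier H\<rbrakk> \<Longrightarrow>
        antipode H (c \<odot>\<^bsub>H\<^esub> x) = c \<odot>\<^bsub>H\<^esub> antipode H x"
    and antipode_left: "x \<in> carrier H \<Longrightarrow>
        tensor_lift K H (\<lambda>a b. antipode H a \<otimes>\<^bsub>H\<^esub> b) (comult H x) = counit H x \<odot>\<^bsub>H\<^esub> \<one>\<^bsub>H\<^esub>"
    and antipode_right: "x \<in> carrier H \<Longrightarrow>
        tensor_lift K H (\<lambda>a b. a \<otimes>\<^bsub>H\<^esub> antipode H b) (comult H x) = counit H x \<odot>\<^bsub>H\<^esub> \<one>\<^bsub>H\<^esub>"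

text \<open>
  Morphisms are bialgebra maps (compatibility with the antipodes is automatic), made extensional
  so that they form honest hom-sets.
\<close>

definition hopf_hom ::
  "('k, 'z) ring_scheme \<Rightarrow> ('k, 'a) hopf \<Rightarrow> ('k, 'b) hopf \<Rightarrow> ('a \<Rightarrow> 'b) set" where
  "hopf_hom K A B = {f \<in> ring_hom A B \<inter> extensional (carrier A).
     (\<forall>c\<in>carrier K. \<forall>x\<in>carrier A. f (c \<odot>\<^bsub>A\<^esub> x) = c \<odot>\<^bsub>B\<^esub> f x) \<and>
     (\<forall>x\<in>carrier A. comult B (f x) = tensor_map K B B f f (comult A x)) \<and>
     (\<forall>x\<in>carrier A. counit B (f x) = counit A x)}"

definition ground_module :: "('k, 'z) ring_scheme \<Rightarrow> ('k, 'k) module" where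
  "ground_module K = \<lparr>carrier = carrier K, mult = mult K, one = \<one>\<^bsub>K\<^esub>,
     zero = \<zero>\<^bsub>K\<^esub>, add = add K, smult = mult K\<rparr>"

definition ground_hopf :: "('k, 'z) ring_scheme \<Rightarrow> ('k, 'k) hopf" where
  "ground_hopf K = \<lparr>carrier = carrier K, mult = mult K, one = \<one>\<^bsub>K\<^esub>,
     zero = \<zero>\<^bsub>K\<^esub>, add = add K, smult = mult K,
     comult = (\<lambda>c. pure_tensor K (ground_module K) (ground_module K) c \<one>\<^bsub>K\<^esub>),
     counit = (\<lambda>c. c), antipode = (\<lambda>c. c)\<rparr>"

definition zero_hopf :: "('k, 'z) ring_scheme \<Rightarrow> ('k, 'a) hopf \<Rightarrow> bool" where
  "zero_hopf K A \<longleftrightarrow> (\<exists>h \<in> hopf_hom K (ground_hopf K) A. bij_betw h (carrier K) (carrier A))"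

definition HKer ::
  "('k, 'z) ring_scheme \<Rightarrow> ('k, 'a) hopf \<Rightarrow> ('k, 'b) hopf \<Rightarrow> ('a \<Rightarrow> 'b) \<Rightarrow> 'a set" where
  "HKer K A B f =
     {x \<in> carrier A. tensor_map K A B id f (comult A x) = pure_tensor K A B x \<one>\<^bsub>B\<^esub>}"

text \<open>
  The Hopf algebra structure on a Hopf subalgebra \<open>A\<close> of \<open>H\<close>.  Over a field the inclusion induces
  an injection \<open>A \<otimes> A \<rightarrow> H \<otimes> H\<close>, and the coproduct of \<open>A\<close> is the corestriction of that of \<open>H\<close>
  along it.
\<close>

definition hopf_sub :: "('k, 'z) ring_scheme \<Rightarrow> ('k, 'a) hopf \<Rightarrow> 'a set \<Rightarrow> ('k, 'a) hopf" where
  "hopf_sub K H A = (let S = H\<lparr>carrier := A\<rparr> in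
     S\<lparr>comult := (\<lambda>x. inv_into (carrier (tensor_module K S S)) (tensor_map K H H id id)
                        (comult H x))\<rparr>)"


section \<open>Lie algebras, group-like and primitive elements\<close>

record ('k, 'a) lie = "('k, 'a) module" +
  bracket :: "'a \<Rightarrow> 'a \<Rightarrow> 'a"

locale lie_algebra = K?: field K + L?: module K L
  for K :: "('k, 'z) ring_scheme" (structure) and L :: "('k, 'a) lie" (structure) +
  assumes bracket_closed: "\<lbrakk>x \<in> carrier L; y \<in> carrier L\<rbrakk> \<Longrightarrow> bracket L x y \<in> carrier L"
    and bracket_add_left: "\<lbrakk>x \<in> carrier L; y \<in> carrier L; z \<in> carrier L\<rbrakk> \<Longrightarrow>
        bracket L (x \<oplus>\<^bsub>L\<^esub> y) z = bracket L x z \<oplus>\<^bsub>L\<^esub> bracket L y z"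
    and bracket_add_right: "\<lbrakk>x \<in> carrier L; y \<in> carrier L; z \<in> carrier L\<rbrakk> \<Longrightarrow>
        bracket L x (y \<oplus>\<^bsub>L\<^esub> z) = bracket L x y \<oplus>\<^bsub>L\<^esub> bracket L x z"
    and bracket_smult_left: "\<lbrakk>c \<in> carrier K; x \<in> carrier L; y \<in> carrier L\<rbrakk> \<Longrightarrow>
        bracket L (c \<odot>\<^bsub>L\<^esub> x) y = c \<odot>\<^bsub>L\<^esub> bracket L x y"
    and bracket_smult_right: "\<lbrakk>c \<in> carrier K; x \<in> carrier L; y \<in> carrier L\<rbrakk> \<Longrightarrow>
        bracket L x (c \<odot>\<^bsub>L\<^esub> y) = c \<odot>\<^bsub>L\<^esub> bracket L x y"
    and bracket_self: "x \<in> carrier L \<Longrightarrow> bracket L x x = \<zero>\<^bsub>L\<^esub>"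
    and jacobi: "\<lbrakk>x \<in> carrier L; y \<in> carrier L; z \<in> carrier L\<rbrakk> \<Longrightarrow>
        bracket L x (bracket L y z) \<oplus>\<^bsub>L\<^esub> bracket L y (bracket L z x) \<oplus>\<^bsub>L\<^esub>
        bracket L z (bracket L x y) = \<zero>\<^bsub>L\<^esub>"

definition lie_hom ::
  "('k, 'z) ring_scheme \<Rightarrow> ('k, 'a) lie \<Rightarrow> ('k, 'b) lie \<Rightarrow> ('a \<Rightarrow> 'b) set" where
  "lie_hom K L M = {f \<in> carrier L \<rightarrow>\<^sub>E carrier M.
     (\<forall>x\<in>carrier L. \<forall>y\<in>carrier L. f (x \<oplus>\<^bsub>L\<^esub> y) = f x \<oplus>\<^bsub>M\<^esub> f y) \<and>
     (\<forall>c\<in>carrier K. \<forall>x\<in>carrier L. f (c \<odot>\<^bsub>L\<^esub> x) = c \<odot>\<^bsub>M\<^esub> f x) \<and>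
     (\<forall>x\<in>carrier L. \<forall>y\<in>carrier L. f (bracket L x y) = bracket M (f x) (f y))}"

definition Gl :: "('k, 'z) ring_scheme \<Rightarrow> ('k, 'a) hopf \<Rightarrow> 'a monoid" where
  "Gl K H =
    \<lparr>carrier = {x \<in> carrier H. comult H x = pure_tensor K H H x x \<and> counit H x = \<one>\<^bsub>K\<^esub>},
     mult = mult H, one = \<one>\<^bsub>H\<^esub>\<rparr>"

text \<open>
  The bracket \<open>xy - yx\<close> is written \<open>xy + (-1)yx\<close>, because the library operation \<open>\<ominus>\<^bsub>H\<^esub>\<close> depends
  on the carrier of \<open>H\<close>; so \<open>Prim\<close> of a Hopf subalgebra and of \<open>H\<close> have the same bracket.
  The fields mult and one of a Lie algebra have no meaning.
\<close>

definition Prim :: "('k, 'z) ring_scheme \<Rightarrow> ('k, 'a) hopf \<Rightarrow> ('k, 'a) lie" where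
  "Prim K H =
    \<lparr>carrier = {x \<in> carrier H. comult H x =
       pure_tensor K H H x \<one>\<^bsub>H\<^esub> \<oplus>\<^bsub>tensor_module K H H\<^esub> pure_tensor K H H \<one>\<^bsub>H\<^esub> x},
     mult = undefined, one = undefined,
     zero = \<zero>\<^bsub>H\<^esub>, add = add H, smult = smult H,
     bracket = (\<lambda>x y. (x \<otimes>\<^bsub>H\<^esub> y) \<oplus>\<^bsub>H\<^esub> ((\<ominus>\<^bsub>K\<^esub> \<one>\<^bsub>K\<^esub>) \<odot>\<^bsub>H\<^esub> (y \<otimes>\<^bsub>H\<^esub> x)))\<rparr>"

definition Gl_mor ::
  "('k, 'z) ring_scheme \<Rightarrow> ('k, 'a) hopf \<Rightarrow> ('k, 'b) hopf \<Rightarrow> ('a \<Rightarrow> 'b) \<Rightarrow> ('a \<Rightarrow> 'b)" where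
  "Gl_mor K A B f = restrict f (carrier (Gl K A))"

definition Prim_mor ::
  "('k, 'z) ring_scheme \<Rightarrow> ('k, 'a) hopf \<Rightarrow> ('k, 'b) hopf \<Rightarrow> ('a \<Rightarrow> 'b) \<Rightarrow> ('a \<Rightarrow> 'b)" where
  "Prim_mor K A B f = restrict f (carrier (Prim K A))"


section \<open>Categories and simplicial objects\<close>

text \<open>\<open>cmp C A B D g f\<close> is the composite of \<open>f : A \<rightarrow> B\<close> and \<open>g : B \<rightarrow> D\<close>.\<close>

record ('o, 'm) cat =
  ob :: "'o set"
  hm :: "'o \<Rightarrow> 'o \<Rightarrow> 'm set"
  idt :: "'o \<Rightarrow> 'm"
  cmp :: "'o \<Rightarrow> 'o \<Rightarrow> 'o \<Rightarrow> 'm \<Rightarrow> 'm \<Rightarrow> 'm"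

definition is_category :: "('o, 'm) cat \<Rightarrow> bool" where
  "is_category C \<longleftrightarrow>
    (\<forall>A\<in>ob C. idt C A \<in> hm C A A) \<and>
    (\<forall>A\<in>ob C. \<forall>B\<in>ob C. \<forall>D\<in>ob C. \<forall>f\<in>hm C A B. \<forall>g\<in>hm C B D. cmp C A B D g f \<in> hm C A D) \<and>
    (\<forall>A\<in>ob C. \<forall>B\<in>ob C. \<forall>f\<in>hm C A B.
       cmp C A A B f (idt C A) = f \<and> cmp C A B B (idt C B) f = f) \<and>
    (\<forall>A\<in>ob C. \<forall>B\<in>ob C. \<forall>D\<in>ob C. \<forall>E\<in>ob C. \<forall>f\<in>hm C A B. \<forall>g\<in>hm C B D. \<forall>h\<in>hm C D E.
       cmp C A D E h (cmp C A B D g f) = cmp C A B E (cmp C B D E h g) f)"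

definition is_functor ::
  "('o, 'm) cat \<Rightarrow> ('p, 'q) cat \<Rightarrow> ('o \<Rightarrow> 'p) \<Rightarrow> ('o \<Rightarrow> 'o \<Rightarrow> 'm \<Rightarrow> 'q) \<Rightarrow> bool" where
  "is_functor C D F Fm \<longleftrightarrow> is_category C \<and> is_category D \<and>
    (\<forall>A\<in>ob C. F A \<in> ob D) \<and>
    (\<forall>A\<in>ob C. \<forall>B\<in>ob C. \<forall>f\<in>hm C A B. Fm A B f \<in> hm D (F A) (F B)) \<and>
    (\<forall>A\<in>ob C. Fm A A (idt C A) = idt D (F A)) \<and>
    (\<forall>A\<in>ob C. \<forall>B\<in>ob C. \<forall>E\<in>ob C. \<forall>f\<in>hm C A B. \<forall>g\<in>hm C B E.
       Fm A E (cmp C A B E g f) = cmp D (F A) (F B) (F E) (Fm B E g) (Fm A B f))"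

definition full_subcat :: "('o, 'm) cat \<Rightarrow> ('o \<Rightarrow> bool) \<Rightarrow> ('o, 'm) cat" where
  "full_subcat C P = C\<lparr>ob := {A \<in> ob C. P A}\<rparr>"

definition hopf_cat :: "('k, 'z) ring_scheme \<Rightarrow> (('k, 'a) hopf, 'a \<Rightarrow> 'a) cat" where
  "hopf_cat K = \<lparr>ob = {H. cocomm_hopf K H}, hm = hopf_hom K,
     idt = (\<lambda>A. restrict id (carrier A)), cmp = (\<lambda>A B D g f. compose (carrier A) g f)\<rparr>"

definition lie_cat :: "('k, 'z) ring_scheme \<Rightarrow> (('k, 'a) lie, 'a \<Rightarrow> 'a) cat" where
  "lie_cat K = \<lparr>ob = {L. lie_algebra K L}, hm = lie_hom K,
     idt = (\<lambda>A. restrict id (carrier A)), cmp = (\<lambda>A B D g f. compose (carrier A) g f)\<rparr>"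

definition grp_cat :: "('a monoid, 'a \<Rightarrow> 'a) cat" where
  "grp_cat = \<lparr>ob = {G. group G}, hm = (\<lambda>G H. hom G H \<inter> extensional (carrier G)),
     idt = (\<lambda>A. restrict id (carrier A)), cmp = (\<lambda>A B D g f. compose (carrier A) g f)\<rparr>"

text \<open>
  \<open>face X n i : X\<^sub>n\<^sub>+\<^sub>1 \<rightarrow> X\<^sub>n\<close> is \<open>d\<^sub>i\<close> for \<open>i \<le> n + 1\<close>, and \<open>degen X n j : X\<^sub>n \<rightarrow> X\<^sub>n\<^sub>+\<^sub>1\<close> is \<open>s\<^sub>j\<close>
  for \<open>j \<le> n\<close>; values at other indices are irrelevant.
\<close>

record ('o, 'm) simp =
  lvl :: "nat \<Rightarrow> 'o"
  face :: "nat \<Rightarrow> nat \<Rightarrow> 'm"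
  degen :: "nat \<Rightarrow> nat \<Rightarrow> 'm"

definition simplicial_object :: "('o, 'm) cat \<Rightarrow> ('o, 'm) simp \<Rightarrow> bool" where
  "simplicial_object C X \<longleftrightarrow> (let T = lvl X; d = face X; s = degen X in
    (\<forall>n. T n \<in> ob C) \<and>
    (\<forall>n. \<forall>i\<le>Suc n. d n i \<in> hm C (T (Suc n)) (T n)) \<and>
    (\<forall>n. \<forall>j\<le>n. s n j \<in> hm C (T n) (T (Suc n))) \<and>
    (\<forall>n i j. i < j \<and> j \<le> Suc (Suc n) \<longrightarrow>
       cmp C (T (Suc (Suc n))) (T (Suc n)) (T n) (d n i) (d (Suc n) j) =
       cmp C (T (Suc (Suc n))) (T (Suc n)) (T n) (d n (j - 1)) (d (Suc n) i)) \<and>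
    (\<forall>n i j. i \<le> j \<and> j \<le> n \<longrightarrow>
       cmp C (T n) (T (Suc n)) (T (Suc (Suc n))) (s (Suc n) i) (s n j) =
       cmp C (T n) (T (Suc n)) (T (Suc (Suc n))) (s (Suc n) (Suc j)) (s n i)) \<and>
    (\<forall>n i j. i < j \<and> j \<le> Suc n \<longrightarrow>
       cmp C (T (Suc n)) (T (Suc (Suc n))) (T (Suc n)) (d (Suc n) i) (s (Suc n) j) =
       cmp C (T (Suc n)) (T n) (T (Suc n)) (s n (j - 1)) (d n i)) \<and>
    (\<forall>n j. j \<le> n \<longrightarrow>
       cmp C (T n) (T (Suc n)) (T n) (d n j) (s n j) = idt C (T n) \<and>
       cmp C (T n) (T (Suc n)) (T n) (d n (Suc j)) (s n j) = idt C (T n)) \<and>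
    (\<forall>n i j. Suc j < i \<and> i \<le> Suc (Suc n) \<longrightarrow>
       cmp C (T (Suc n)) (T (Suc (Suc n))) (T (Suc n)) (d (Suc n) i) (s (Suc n) j) =
       cmp C (T (Suc n)) (T n) (T (Suc n)) (s n j) (d n (i - 1))))"

definition simplicial_hom ::
  "('o, 'm) cat \<Rightarrow> ('o, 'm) simp \<Rightarrow> ('o, 'm) simp \<Rightarrow> (nat \<Rightarrow> 'm) set" where
  "simplicial_hom C X Y = {f.
    (\<forall>n. f n \<in> hm C (lvl X n) (lvl Y n)) \<and>
    (\<forall>n. \<forall>i\<le>Suc n.
       cmp C (lvl X (Suc n)) (lvl X n) (lvl Y n) (f n) (face X n i) =
       cmp C (lvl X (Suc n)) (lvl Y (Suc n)) (lvl Y n) (face Y n i) (f (Suc n))) \<and>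
    (\<forall>n. \<forall>j\<le>n.
       cmp C (lvl X n) (lvl X (Suc n)) (lvl Y (Suc n)) (f (Suc n)) (degen X n j) =
       cmp C (lvl X n) (lvl Y n) (lvl Y (Suc n)) (degen Y n j) (f n))}"

definition simp_cat :: "('o, 'm) cat \<Rightarrow> (('o, 'm) simp, nat \<Rightarrow> 'm) cat" where
  "simp_cat C = \<lparr>ob = {X. simplicial_object C X}, hm = simplicial_hom C,
     idt = (\<lambda>X n. idt C (lvl X n)),
     cmp = (\<lambda>X Y Z g f n. cmp C (lvl X n) (lvl Y n) (lvl Z n) (g n) (f n))\<rparr>"

text \<open>Degreewise application of a functor given by its object part \<open>F\<close> and morphism part \<open>Fm\<close>.\<close>

definition degreewise ::
  "('o \<Rightarrow> 'p) \<Rightarrow> ('o \<Rightarrow> 'o \<Rightarrow> 'm \<Rightarrow> 'q) \<Rightarrow> ('o, 'm) simp \<Rightarrow> ('p, 'q) simp" where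
  "degreewise F Fm X = \<lparr>lvl = (\<lambda>n. F (lvl X n)),
     face = (\<lambda>n i. Fm (lvl X (Suc n)) (lvl X n) (face X n i)),
     degen = (\<lambda>n j. Fm (lvl X n) (lvl X (Suc n)) (degen X n j))\<rparr>"

definition degreewise_mor ::
  "('o \<Rightarrow> 'o \<Rightarrow> 'm \<Rightarrow> 'q) \<Rightarrow> ('o, 'm) simp \<Rightarrow> ('o, 'm) simp \<Rightarrow> (nat \<Rightarrow> 'm) \<Rightarrow> (nat \<Rightarrow> 'q)" where
  "degreewise_mor Fm X Y f = (\<lambda>n. Fm (lvl X n) (lvl Y n) (f n))"


section \<open>Moore complexes\<close>

fun moore_hopf ::
  "('k, 'z) ring_scheme \<Rightarrow> (('k, 'a) hopf, 'a \<Rightarrow> 'a) simp \<Rightarrow> nat \<Rightarrow> ('k, 'a) hopf" where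
  "moore_hopf K X 0 = lvl X 0"
| "moore_hopf K X (Suc n) = hopf_sub K (lvl X (Suc n))
     (\<Inter>i\<in>{..n}. HKer K (lvl X (Suc n)) (lvl X n) (face X n i))"

fun moore_grp :: "('a monoid, 'a \<Rightarrow> 'a) simp \<Rightarrow> nat \<Rightarrow> 'a monoid" where
  "moore_grp X 0 = lvl X 0"
| "moore_grp X (Suc n) = (lvl X (Suc n))
     \<lparr>carrier := \<Inter>i\<in>{..n}. kernel (lvl X (Suc n)) (lvl X n) (face X n i)\<rparr>"

fun moore_lie :: "(('k, 'a) lie, 'a \<Rightarrow> 'a) simp \<Rightarrow> nat \<Rightarrow> ('k, 'a) lie" where
  "moore_lie X 0 = lvl X 0"
| "moore_lie X (Suc n) = (lvl X (Suc n))
     \<lparr>carrier := \<Inter>i\<in>{..n}. a_kernel (lvl X (Suc n)) (lvl X n) (face X n i)\<rparr>"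

text \<open>Index \<open>n\<close> stands for the boundary map from degree \<open>n + 1\<close> to degree \<open>n\<close>.\<close>

definition bd_hopf ::
  "('k, 'z) ring_scheme \<Rightarrow> (('k, 'a) hopf, 'a \<Rightarrow> 'a) simp \<Rightarrow> nat \<Rightarrow> 'a \<Rightarrow> 'a" where
  "bd_hopf K X n = restrict (face X n (Suc n)) (carrier (moore_hopf K X (Suc n)))"

definition bd_grp :: "('a monoid, 'a \<Rightarrow> 'a) simp \<Rightarrow> nat \<Rightarrow> 'a \<Rightarrow> 'a" where
  "bd_grp X n = restrict (face X n (Suc n)) (carrier (moore_grp X (Suc n)))"

definition bd_lie :: "(('k, 'a) lie, 'a \<Rightarrow> 'a) simp \<Rightarrow> nat \<Rightarrow> 'a \<Rightarrow> 'a" where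
  "bd_lie X n = restrict (face X n (Suc n)) (carrier (moore_lie X (Suc n)))"

definition hopf_length ::
  "('k, 'z) ring_scheme \<Rightarrow> nat \<Rightarrow> (('k, 'a) hopf, 'a \<Rightarrow> 'a) simp \<Rightarrow> bool" where
  "hopf_length K n X \<longleftrightarrow> (\<forall>i>n. zero_hopf K (moore_hopf K X i))"

definition grp_length :: "nat \<Rightarrow> ('a monoid, 'a \<Rightarrow> 'a) simp \<Rightarrow> bool" where
  "grp_length n X \<longleftrightarrow> (\<forall>i>n. carrier (moore_grp X i) = {\<one>\<^bsub>moore_grp X i\<^esub>})"

definition lie_length :: "nat \<Rightarrow> (('k, 'a) lie, 'a \<Rightarrow> 'a) simp \<Rightarrow> bool" where
  "lie_length n X \<longleftrightarrow> (\<forall>i>n. carrier (moore_lie X i) = {\<zero>\<^bsub>moore_lie X i\<^esub>})"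

end

theory Submission
  imports Defs
begin

text \<open>
  The formal part of the statement is that \<open>Gl\<close> and \<open>Prim\<close> are functors on cocommutative Hopf
  algebras; applied degreewise, a functor sends simplicial objects to simplicial objects and
  simplicial maps to simplicial maps (\<open>degreewise_functor\<close>).  Inverses in \<open>Gl(H)\<close> come from the
  antipode (\<open>Gl_antipode\<close>), and \<open>Prim(H)\<close> is closed under the commutator because the mixed terms
  \<open>x \<otimes> y + y \<otimes> x\<close> of \<open>\<delta>(xy)\<close> and \<open>\<delta>(yx)\<close> cancel (\<open>Prim_comm_closed\<close>).

  The comparison of Moore complexes rests on two facts about a Hopf map \<open>f : A \<rightarrow> B\<close>.  First, a
  group-like \<open>x\<close> lies in \<open>HKer(f)\<close> exactly if \<open>f(x) = 1\<close>, and a primitive \<open>x\<close> exactly if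
  \<open>f(x) = 0\<close>: in the defining equation \<open>\<Sum> x' \<otimes> f(x'') = x \<otimes> 1\<close> one inserts the coproduct of \<open>x\<close>
  and applies \<open>\<epsilon> \<otimes> id\<close> (\<open>grouplike_in_HKer\<close>, \<open>primitive_in_HKer\<close>).  So the ordinary kernels in
  \<open>Gl\<close> and \<open>Prim\<close> are the traces of the Hopf kernels.  Second, an intersection \<open>D\<close> of Hopf
  kernels is a subcoalgebra, so that the coproduct of \<open>D\<close> really is the restriction of \<open>\<delta>\<close> and
  being group-like or primitive means the same in \<open>D\<close> as in \<open>A\<close> (\<open>Gl_sub\<close>, \<open>Prim_sub\<close>).

  The second fact is the substantial one.  \<open>HKer(f)\<close> is the kernel of the linear map
  \<open>\<phi>(x) = \<Sum> x' \<otimes> f(x'') - x \<otimes> 1\<close>, and coassociativity gives \<open>(id \<otimes> \<phi>)(\<delta>(x)) = 0\<close> for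
  \<open>x \<in> HKer(f)\<close> (\<open>ker_map_comult\<close>).  It remains to see that a symmetric tensor \<open>t\<close> with
  \<open>(id \<otimes> \<phi>\<^sub>j)(t) = 0\<close> for all \<open>j\<close> comes from \<open>D \<otimes> D\<close>, where \<open>D = \<Inter> ker \<phi>\<^sub>j\<close>
  (\<open>symmetric_tensor_in_kernel\<close>).  Over a field, a shortest expression \<open>t = \<Sum> a\<^sub>i \<otimes> b\<^sub>i\<close> has
  linearly independent \<open>a\<^sub>i\<close>, hence linear functionals dual to them (\<open>dual_representation\<close>);
  evaluating these shows \<open>\<phi>\<^sub>j(b\<^sub>i) = 0\<close>, so every \<open>b\<^sub>i\<close> lies in \<open>D\<close>.  By symmetry \<open>t\<close> can then be
  written with left factors in \<open>D\<close>, and repeating the argument with a shortest expression in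
  \<open>D \<otimes> A\<close> puts both factors into \<open>D\<close>.  The same device shows that \<open>D \<otimes> D \<rightarrow> A \<otimes> A\<close> is injective
  (\<open>tensor_inclusion_inj\<close>).

  Finally, if a term of the Moore complex is the ground field, each of its elements is
  \<open>\<epsilon>(x)1\<close>; group-likes have counit \<open>1\<close> and primitives have counit \<open>0\<close>, so the corresponding terms
  of the other two complexes are trivial.
\<close>

section \<open>Linear and bilinear maps\<close>

lemma (in abelian_group) minus_eq_zeroD:
  "\<lbrakk>x \<in> carrier G; y \<in> carrier G; x \<ominus> y = \<zero>\<rbrakk> \<Longrightarrow> x = y"
  by (metis a_inv_closed a_minus_def minus_equality minus_minus)

definition linear_map ::
  "('k, 'z) ring_scheme \<Rightarrow> ('k, 'a, 'm) module_scheme \<Rightarrow> ('k, 'b, 'n) module_scheme \<Rightarrow>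
    ('a \<Rightarrow> 'b) \<Rightarrow> bool" where
  "linear_map K M N f \<longleftrightarrow> (\<forall>x\<in>carrier M. f x \<in> carrier N) \<and>
     (\<forall>x\<in>carrier M. \<forall>y\<in>carrier M. f (x \<oplus>\<^bsub>M\<^esub> y) = f x \<oplus>\<^bsub>N\<^esub> f y) \<and>
     (\<forall>c\<in>carrier K. \<forall>x\<in>carrier M. f (c \<odot>\<^bsub>M\<^esub> x) = c \<odot>\<^bsub>N\<^esub> f x)"

definition bilinear_map ::
  "('k, 'z) ring_scheme \<Rightarrow> ('k, 'a, 'm) module_scheme \<Rightarrow> ('k, 'b, 'n) module_scheme \<Rightarrow>
    ('k, 'c, 'p) module_scheme \<Rightarrow> ('a \<Rightarrow> 'b \<Rightarrow> 'c) \<Rightarrow> bool" where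
  "bilinear_map K M N P \<beta> \<longleftrightarrow>
     (\<forall>b\<in>carrier N. linear_map K M P (\<lambda>a. \<beta> a b)) \<and> (\<forall>a\<in>carrier M. linear_map K N P (\<beta> a))"

lemma linear_mapI:
  assumes "\<And>x. x \<in> carrier M \<Longrightarrow> f x \<in> carrier N"
    and "\<And>x y. \<lbrakk>x \<in> carrier M; y \<in> carrier M\<rbrakk> \<Longrightarrow> f (x \<oplus>\<^bsub>M\<^esub> y) = f x \<oplus>\<^bsub>N\<^esub> f y"
    and "\<And>c x. \<lbrakk>c \<in> carrier K; x \<in> carrier M\<rbrakk> \<Longrightarrow> f (c \<odot>\<^bsub>M\<^esub> x) = c \<odot>\<^bsub>N\<^esub> f x"
  shows "linear_map K M N f"
  using assms by (auto simp: linear_map_def)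

lemma linear_map_closed: "linear_map K M N f \<Longrightarrow> x \<in> carrier M \<Longrightarrow> f x \<in> carrier N"
  by (auto simp: linear_map_def)

lemma linear_map_add:
  "linear_map K M N f \<Longrightarrow> x \<in> carrier M \<Longrightarrow> y \<in> carrier M \<Longrightarrow> f (x \<oplus>\<^bsub>M\<^esub> y) = f x \<oplus>\<^bsub>N\<^esub> f y"
  by (auto simp: linear_map_def)

lemma linear_map_smult:
  "linear_map K M N f \<Longrightarrow> c \<in> carrier K \<Longrightarrow> x \<in> carrier M \<Longrightarrow> f (c \<odot>\<^bsub>M\<^esub> x) = c \<odot>\<^bsub>N\<^esub> f x"
  by (auto simp: linear_map_def)

lemma linear_map_zero:
  assumes "linear_map K M N f" "module K M" "module K N"
  shows "f \<zero>\<^bsub>M\<^esub> = \<zero>\<^bsub>N\<^esub>"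
proof -
  interpret M: module K M by fact
  interpret N: module K N by fact
  have "f (\<zero>\<^bsub>K\<^esub> \<odot>\<^bsub>M\<^esub> \<zero>\<^bsub>M\<^esub>) = \<zero>\<^bsub>K\<^esub> \<odot>\<^bsub>N\<^esub> f \<zero>\<^bsub>M\<^esub>"
    using assms(1) by (simp add: linear_map_smult del: M.smult_l_null M.smult_r_null N.smult_l_null N.smult_r_null)
  then show ?thesis using linear_map_closed[OF assms(1), of "\<zero>\<^bsub>M\<^esub>"] by simp
qed

lemma linear_map_neg:
  assumes "linear_map K M N f" "module K M" "module K N" "x \<in> carrier M"
  shows "f (\<ominus>\<^bsub>M\<^esub> x) = \<ominus>\<^bsub>N\<^esub> f x"
proof -
  interpret M: module K M by fact
  interpret N: module K N by fact
  have "f (\<ominus>\<^bsub>M\<^esub> x) \<oplus>\<^bsub>N\<^esub> f x = \<zero>\<^bsub>N\<^esub>"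
    using assms linear_map_add[OF assms(1), of "\<ominus>\<^bsub>M\<^esub> x" x] linear_map_zero[OF assms(1-3)]
    by (simp add: M.l_neg)
  then show ?thesis using linear_map_closed[OF assms(1)] assms(4)
    by (simp add: N.minus_equality)
qed

lemma linear_map_diff:
  assumes "linear_map K M N f" "module K M" "module K N" "x \<in> carrier M" "y \<in> carrier M"
  shows "f (x \<ominus>\<^bsub>M\<^esub> y) = f x \<ominus>\<^bsub>N\<^esub> f y"
proof -
  interpret M: module K M by fact
  interpret N: module K N by fact
  show ?thesis using assms by (simp add: a_minus_def linear_map_add linear_map_neg)
qed

lemma linear_map_finsum:
  assumes f: "linear_map K M N f" and M: "module K M" and N: "module K N"
    and I: "finite I" and g: "g \<in> I \<rightarrow> carrier M"
  shows "f (finsum M g I) = (\<Oplus>\<^bsub>N\<^esub>i\<in>I. f (g i))"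
proof -
  interpret M: module K M by fact
  interpret N: module K N by fact
  show ?thesis using I g
  proof (induction I)
    case empty
    then show ?case using linear_map_zero[OF f M N] by simp
  next
    case (insert i I)
    have "g i \<in> carrier M" "g \<in> I \<rightarrow> carrier M" using insert by auto
    moreover have "f (g i) \<in> carrier N" "(\<lambda>i. f (g i)) \<in> I \<rightarrow> carrier N"
      using linear_map_closed[OF f] insert.prems by auto
    ultimately show ?case using insert
      by (simp add: linear_map_add[OF f] M.finsum_insert N.finsum_insert)
  qed
qed

lemma linear_map_id: "linear_map K M M id" "linear_map K M M (\<lambda>x. x)"
  by (auto intro!: linear_mapI)

lemma linear_map_comp:
  "\<lbrakk>linear_map K M N f; linear_map K N P g\<rbrakk> \<Longrightarrow> linear_map K M P (\<lambda>x. g (f x))"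
  by (auto simp: linear_map_def)

lemma linear_map_cong:
  assumes "linear_map K M N f" "\<And>x. x \<in> carrier M \<Longrightarrow> f x = g x" "module K M"
  shows "linear_map K M N g"
proof -
  interpret M: module K M by fact
  have "\<And>x. x \<in> carrier M \<Longrightarrow> g x = f x" using assms(2) by simp
  then show ?thesis using assms(1) by (auto simp: linear_map_def)
qed

lemma linear_map_sum:
  assumes f: "linear_map K M N f" and g: "linear_map K M N g" and N: "module K N"
  shows "linear_map K M N (\<lambda>x. f x \<oplus>\<^bsub>N\<^esub> g x)"
proof -
  interpret N: module K N by fact
  note c = linear_map_closed[OF f] linear_map_closed[OF g]
  show ?thesis
    by (rule linear_mapI)
      (simp_all add: c linear_map_add[OF f] linear_map_add[OF g] linear_map_smult[OF f]
        linear_map_smult[OF g] N.smult_r_distr N.a_ac)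
qed

lemma linear_map_minus:
  assumes f: "linear_map K M N f" and g: "linear_map K M N g" and N: "module K N"
  shows "linear_map K M N (\<lambda>x. f x \<ominus>\<^bsub>N\<^esub> g x)"
proof -
  interpret N: module K N by fact
  note c = linear_map_closed[OF f] linear_map_closed[OF g]
  show ?thesis
    by (rule linear_mapI)
      (simp_all add: c linear_map_add[OF f] linear_map_add[OF g] linear_map_smult[OF f]
        linear_map_smult[OF g] N.smult_r_distr N.a_ac a_minus_def N.smult_r_minus N.minus_add)
qed

lemma submodule_kernel:
  assumes f: "linear_map K M N f" and M: "module K M" and N: "module K N"
  shows "submodule {x \<in> carrier M. f x = \<zero>\<^bsub>N\<^esub>} K M"
proof -
  interpret M: module K M by fact
  interpret N: module K N by fact
  show ?thesis
    by (rule M.submoduleI)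
      (auto simp: linear_map_add[OF f] linear_map_smult[OF f] linear_map_zero[OF f M N]
        linear_map_neg[OF f M N])
qed

lemma bilinear_mapI:
  assumes "\<And>b. b \<in> carrier N \<Longrightarrow> linear_map K M P (\<lambda>a. \<beta> a b)"
    and "\<And>a. a \<in> carrier M \<Longrightarrow> linear_map K N P (\<beta> a)"
  shows "bilinear_map K M N P \<beta>"
  using assms by (auto simp: bilinear_map_def)

lemma bilinear_map_left: "bilinear_map K M N P \<beta> \<Longrightarrow> b \<in> carrier N \<Longrightarrow> linear_map K M P (\<lambda>a. \<beta> a b)"
  by (auto simp: bilinear_map_def)

lemma bilinear_map_right: "bilinear_map K M N P \<beta> \<Longrightarrow> a \<in> carrier M \<Longrightarrow> linear_map K N P (\<beta> a)"
  by (auto simp: bilinear_map_def)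

lemma bilinear_map_closed:
  "bilinear_map K M N P \<beta> \<Longrightarrow> a \<in> carrier M \<Longrightarrow> b \<in> carrier N \<Longrightarrow> \<beta> a b \<in> carrier P"
  by (auto simp: bilinear_map_def linear_map_def)

lemma bilinear_map_comp:
  assumes "bilinear_map K M N P \<beta>" "linear_map K M' M f" "linear_map K N' N g"
  shows "bilinear_map K M' N' P (\<lambda>a b. \<beta> (f a) (g b))"
  using assms by (auto simp: bilinear_map_def linear_map_def)

section \<open>Tensor products\<close>

lemma free_pairs_module:
  fixes K :: "('k, 'z) ring_scheme" and A :: "'a set" and B :: "'b set"
  assumes "cring K"
  shows "module K (free_pairs K A B)"
proof -
  interpret K: cring K by fact
  let ?F = "free_pairs K A B"
  have F: "f \<in> carrier ?F \<longleftrightarrow> (\<forall>p. f p \<in> carrier K) \<and> (\<forall>p. p \<notin> A \<times> B \<longrightarrow> f p = \<zero>\<^bsub>K\<^esub>) \<and>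
      finite {p. f p \<noteq> \<zero>\<^bsub>K\<^esub>}" for f
    by (simp add: free_pairs_def)
  have ops: "add ?F = (\<lambda>f g p. f p \<oplus>\<^bsub>K\<^esub> g p)" "smult ?F = (\<lambda>c f p. c \<otimes>\<^bsub>K\<^esub> f p)"
    "zero ?F = (\<lambda>p. \<zero>\<^bsub>K\<^esub>)"
    by (simp_all add: free_pairs_def)
  have add: "f \<oplus>\<^bsub>?F\<^esub> g \<in> carrier ?F" if "f \<in> carrier ?F" "g \<in> carrier ?F" for f g
  proof -
    have "finite {p. f p \<oplus>\<^bsub>K\<^esub> g p \<noteq> \<zero>\<^bsub>K\<^esub>}"
      by (rule finite_subset[of _ "{p. f p \<noteq> \<zero>\<^bsub>K\<^esub>} \<union> {p. g p \<noteq> \<zero>\<^bsub>K\<^esub>}"]) (use that F in auto)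
    then show ?thesis using that by (simp add: F ops)
  qed
  have smult: "c \<odot>\<^bsub>?F\<^esub> f \<in> carrier ?F" if "c \<in> carrier K" "f \<in> carrier ?F" for c f
  proof -
    have "finite {p. c \<otimes>\<^bsub>K\<^esub> f p \<noteq> \<zero>\<^bsub>K\<^esub>}"
      by (rule finite_subset[of _ "{p. f p \<noteq> \<zero>\<^bsub>K\<^esub>}"]) (use that F in auto)
    then show ?thesis using that by (simp add: F ops)
  qed
  have val: "f p \<in> carrier K" if "f \<in> carrier ?F" for f p
    using that unfolding F by blast
  show ?thesis
  proof (rule moduleI)
    show "abelian_group ?F"
    proof (rule abelian_groupI)
      fix f assume f: "f \<in> carrier ?F"
      have "(\<ominus>\<^bsub>K\<^esub> \<one>\<^bsub>K\<^esub>) \<odot>\<^bsub>?F\<^esub> f \<oplus>\<^bsub>?F\<^esub> f = \<zero>\<^bsub>?F\<^esub>"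
        using val[OF f] by (simp add: ops K.l_minus K.l_neg)
      then show "\<exists>g\<in>carrier ?F. g \<oplus>\<^bsub>?F\<^esub> f = \<zero>\<^bsub>?F\<^esub>"
        using smult[OF _ f] by (intro bexI[of _ "(\<ominus>\<^bsub>K\<^esub> \<one>\<^bsub>K\<^esub>) \<odot>\<^bsub>?F\<^esub> f"]) simp_all
    next
      show "\<zero>\<^bsub>?F\<^esub> \<in> carrier ?F" by (simp add: F ops)
    qed (simp_all only: add, simp_all add: ops val K.a_ac)
  qed (simp_all only: assms smult, simp_all add: ops val K.l_distr K.r_distr K.m_assoc)
qed

lemma single_pair_in:
  assumes "cring K" "a \<in> A" "b \<in> B"
  shows "single_pair K a b \<in> carrier (free_pairs K A B)"
proof -
  interpret K: cring K by fact
  have "finite {p. single_pair K a b p \<noteq> \<zero>\<^bsub>K\<^esub>}"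
    by (rule finite_subset[of _ "{(a,b)}"]) (auto simp: single_pair_def)
  then show ?thesis using assms by (auto simp: free_pairs_def single_pair_def)
qed

text \<open>
  The linear extension of \<open>\<beta>\<close> to the free module; it is what \<open>tensor_lift\<close> evaluates at a
  representative.
\<close>

definition free_lin ::
  "('k, 'z) ring_scheme \<Rightarrow> ('k, 'c, 'p) module_scheme \<Rightarrow> ('a \<Rightarrow> 'b \<Rightarrow> 'c) \<Rightarrow> ('a \<times> 'b \<Rightarrow> 'k) \<Rightarrow> 'c"
  where "free_lin K P \<beta> f = (\<Oplus>\<^bsub>P\<^esub>p\<in>{p. f p \<noteq> \<zero>\<^bsub>K\<^esub>}. f p \<odot>\<^bsub>P\<^esub> \<beta> (fst p) (snd p))"

text \<open>
  Summing over a common finite superset of two supports is what makes additivity of the linear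
  extension provable term by term.
\<close>

lemma free_lin_superset:
  assumes P: "module K P" and \<beta>: "\<And>a b. a \<in> A \<Longrightarrow> b \<in> B \<Longrightarrow> \<beta> a b \<in> carrier P"
    and f: "f \<in> carrier (free_pairs K A B)"
    and S: "finite S" "{p. f p \<noteq> \<zero>\<^bsub>K\<^esub>} \<subseteq> S" "S \<subseteq> A \<times> B"
  shows "free_lin K P \<beta> f = (\<Oplus>\<^bsub>P\<^esub>p\<in>S. f p \<odot>\<^bsub>P\<^esub> \<beta> (fst p) (snd p))"
proof -
  interpret P: module K P by fact
  have c: "p \<in> S \<Longrightarrow> f p \<in> carrier K \<and> \<beta> (fst p) (snd p) \<in> carrier P" for p
    using f S \<beta> by (auto simp: free_pairs_def)
  show ?thesis unfolding free_lin_def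
    by (rule P.add.finprod_mono_neutral_cong_left) (use S c in auto)
qed

lemma free_lin_linear:
  assumes P: "module K P" and \<beta>: "\<And>a b. a \<in> A \<Longrightarrow> b \<in> B \<Longrightarrow> \<beta> a b \<in> carrier P"
  shows "linear_map K (free_pairs K A B) P (free_lin K P \<beta>)"
proof -
  interpret P: module K P by fact
  interpret F: module K "free_pairs K A B" by (rule free_pairs_module) (rule P.R.is_cring)
  let ?F = "free_pairs K A B"
  let ?s = "\<lambda>f. {p. f p \<noteq> \<zero>\<^bsub>K\<^esub>}"
  have s: "finite (?s f)" "?s f \<subseteq> A \<times> B" if "f \<in> carrier ?F" for f
    using that by (auto simp: free_pairs_def)
  have c: "f p \<in> carrier K" if "f \<in> carrier ?F" for f p
    using that unfolding free_pairs_def by (cases p) simp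
  have cc: "(\<lambda>p. f p \<odot>\<^bsub>P\<^esub> \<beta> (fst p) (snd p)) \<in> S \<rightarrow> carrier P" if "f \<in> carrier ?F" "S \<subseteq> A \<times> B" for f S
    using that \<beta> c by auto
  have ssum: "?s (f \<oplus>\<^bsub>?F\<^esub> g) \<subseteq> ?s f \<union> ?s g" if "f \<in> carrier ?F" "g \<in> carrier ?F" for f g
    by (auto simp: free_pairs_def)
  have ssm: "?s (k \<odot>\<^bsub>?F\<^esub> f) \<subseteq> ?s f" if "f \<in> carrier ?F" "k \<in> carrier K" for f k
    using that by (auto simp: free_pairs_def)
  show ?thesis
  proof (rule linear_mapI)
    fix f assume f: "f \<in> carrier ?F"
    show "free_lin K P \<beta> f \<in> carrier P"
      unfolding free_lin_def by (rule P.finsum_closed) (use cc[OF f s(2)[OF f]] in auto)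
    fix g assume g: "g \<in> carrier ?F"
    let ?S = "?s f \<union> ?s g"
    have S: "finite ?S" "?S \<subseteq> A \<times> B" using s f g by auto
    have "free_lin K P \<beta> (f \<oplus>\<^bsub>?F\<^esub> g) = (\<Oplus>\<^bsub>P\<^esub>p\<in>?S. (f \<oplus>\<^bsub>?F\<^esub> g) p \<odot>\<^bsub>P\<^esub> \<beta> (fst p) (snd p))"
      using f g by (intro free_lin_superset[OF P \<beta>, where A=A and B=B] S ssum) auto
    also have "\<dots> = (\<Oplus>\<^bsub>P\<^esub>p\<in>?S. f p \<odot>\<^bsub>P\<^esub> \<beta> (fst p) (snd p) \<oplus>\<^bsub>P\<^esub> g p \<odot>\<^bsub>P\<^esub> \<beta> (fst p) (snd p))"
    proof (rule P.finsum_cong')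
      fix p assume "p \<in> ?S"
      then have "p \<in> A \<times> B" using S by auto
      then have "\<beta> (fst p) (snd p) \<in> carrier P" using \<beta> by auto
      then show "(f \<oplus>\<^bsub>?F\<^esub> g) p \<odot>\<^bsub>P\<^esub> \<beta> (fst p) (snd p) =
          f p \<odot>\<^bsub>P\<^esub> \<beta> (fst p) (snd p) \<oplus>\<^bsub>P\<^esub> g p \<odot>\<^bsub>P\<^esub> \<beta> (fst p) (snd p)"
        using c f g by (simp add: free_pairs_def P.smult_l_distr)
    qed (use cc[OF f S(2)] cc[OF g S(2)] in auto)
    also have "\<dots> = (\<Oplus>\<^bsub>P\<^esub>p\<in>?S. f p \<odot>\<^bsub>P\<^esub> \<beta> (fst p) (snd p)) \<oplus>\<^bsub>P\<^esub> (\<Oplus>\<^bsub>P\<^esub>p\<in>?S. g p \<odot>\<^bsub>P\<^esub> \<beta> (fst p) (snd p))"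
      by (rule P.finsum_addf) (rule cc[OF f S(2)] cc[OF g S(2)])+
    also have "\<dots> = free_lin K P \<beta> f \<oplus>\<^bsub>P\<^esub> free_lin K P \<beta> g"
      using free_lin_superset[OF P \<beta> f S(1) _ S(2)] free_lin_superset[OF P \<beta> g S(1) _ S(2)] by simp
    finally show "free_lin K P \<beta> (f \<oplus>\<^bsub>?F\<^esub> g) = free_lin K P \<beta> f \<oplus>\<^bsub>P\<^esub> free_lin K P \<beta> g" .
  next
    fix k f assume k: "k \<in> carrier K" and f: "f \<in> carrier ?F"
    have "free_lin K P \<beta> (k \<odot>\<^bsub>?F\<^esub> f) = (\<Oplus>\<^bsub>P\<^esub>p\<in>?s f. (k \<odot>\<^bsub>?F\<^esub> f) p \<odot>\<^bsub>P\<^esub> \<beta> (fst p) (snd p))"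
      using f k s[OF f] by (intro free_lin_superset[OF P \<beta>, where A=A and B=B] ssm) auto
    also have "\<dots> = (\<Oplus>\<^bsub>P\<^esub>p\<in>?s f. k \<odot>\<^bsub>P\<^esub> (f p \<odot>\<^bsub>P\<^esub> \<beta> (fst p) (snd p)))"
    proof (rule P.finsum_cong')
      fix p assume "p \<in> ?s f"
      then have "p \<in> A \<times> B" using s[OF f] by auto
      then have "\<beta> (fst p) (snd p) \<in> carrier P" using \<beta> by auto
      then show "(k \<odot>\<^bsub>?F\<^esub> f) p \<odot>\<^bsub>P\<^esub> \<beta> (fst p) (snd p) = k \<odot>\<^bsub>P\<^esub> (f p \<odot>\<^bsub>P\<^esub> \<beta> (fst p) (snd p))"
        using c f k by (simp add: free_pairs_def P.smult_assoc1)
    qed (use cc[OF f s(2)[OF f]] k in auto)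
    also have "\<dots> = k \<odot>\<^bsub>P\<^esub> free_lin K P \<beta> f" unfolding free_lin_def
      by (rule P.finsum_smult_ldistr[symmetric]) (use cc[OF f s(2)[OF f]] s[OF f] k in auto)
    finally show "free_lin K P \<beta> (k \<odot>\<^bsub>?F\<^esub> f) = k \<odot>\<^bsub>P\<^esub> free_lin K P \<beta> f" .
  qed
qed

lemma free_lin_single:
  assumes P: "module K P" and \<beta>: "\<And>a b. a \<in> A \<Longrightarrow> b \<in> B \<Longrightarrow> \<beta> a b \<in> carrier P"
    and a: "a \<in> A" "b \<in> B"
  shows "free_lin K P \<beta> (single_pair K a b) = \<beta> a b"
proof -
  interpret P: module K P by fact
  have "free_lin K P \<beta> (single_pair K a b) =
      (\<Oplus>\<^bsub>P\<^esub>p\<in>{(a,b)}. single_pair K a b p \<odot>\<^bsub>P\<^esub> \<beta> (fst p) (snd p))"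
    by (rule free_lin_superset[OF P \<beta>, where A=A and B=B])
      (use a in \<open>auto simp: single_pair_def intro: single_pair_in[unfolded single_pair_def] P.R.is_cring split: if_splits\<close>)
  then show ?thesis using \<beta>[OF a] by (simp add: single_pair_def)
qed

lemma free_pairs_induct:
  assumes K: "cring K" and f: "f \<in> carrier (free_pairs K A B)"
    and Q0: "Q \<zero>\<^bsub>free_pairs K A B\<^esub>"
    and Q1: "\<And>c a b. c \<in> carrier K \<Longrightarrow> a \<in> A \<Longrightarrow> b \<in> B \<Longrightarrow>
      Q (c \<odot>\<^bsub>free_pairs K A B\<^esub> single_pair K a b)"
    and Q2: "\<And>g h. g \<in> carrier (free_pairs K A B) \<Longrightarrow> h \<in> carrier (free_pairs K A B) \<Longrightarrow>
      Q g \<Longrightarrow> Q h \<Longrightarrow> Q (g \<oplus>\<^bsub>free_pairs K A B\<^esub> h)"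
  shows "Q f"
proof -
  interpret K: cring K by fact
  interpret F: module K "free_pairs K A B" by (rule free_pairs_module) fact
  let ?F = "free_pairs K A B"
  have "\<forall>f\<in>carrier ?F. {p. f p \<noteq> \<zero>\<^bsub>K\<^esub>} \<subseteq> S \<longrightarrow> Q f" if "finite S" for S
    using that
  proof (induction S)
    case empty
    then show ?case using Q0 by (auto simp: free_pairs_def elim!: back_subst[of Q])
  next
    case (insert p S)
    show ?case
    proof (intro ballI impI)
      fix f assume f: "f \<in> carrier ?F" and s: "{p. f p \<noteq> \<zero>\<^bsub>K\<^esub>} \<subseteq> insert p S"
      show "Q f"
      proof (cases "f p = \<zero>\<^bsub>K\<^esub>")
        case True
        then show ?thesis using insert f s by blast
      next
        case False
        define g where "g = f(p := \<zero>\<^bsub>K\<^esub>)"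
        obtain a b where p: "p = (a, b)" by (cases p)
        have ab: "a \<in> A" "b \<in> B" "f p \<in> carrier K" using f False p by (auto simp: free_pairs_def)
        have "finite {q. g q \<noteq> \<zero>\<^bsub>K\<^esub>}"
          by (rule finite_subset[of _ "{q. f q \<noteq> \<zero>\<^bsub>K\<^esub>}"]) (use f in \<open>auto simp: g_def free_pairs_def\<close>)
        then have g: "g \<in> carrier ?F" using f by (auto simp: g_def free_pairs_def)
        have "{q. g q \<noteq> \<zero>\<^bsub>K\<^esub>} \<subseteq> S" using s by (auto simp: g_def)
        then have "Q g" using insert.IH g by blast
        moreover have "f = g \<oplus>\<^bsub>?F\<^esub> f p \<odot>\<^bsub>?F\<^esub> single_pair K a b"
          using f ab by (auto simp: g_def free_pairs_def single_pair_def p intro!: ext)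
        moreover have "f p \<odot>\<^bsub>?F\<^esub> single_pair K a b \<in> carrier ?F"
          using ab K by (simp add: single_pair_in)
        ultimately show ?thesis using Q2 g Q1 ab by metis
      qed
    qed
  qed
  moreover have "finite {p. f p \<noteq> \<zero>\<^bsub>K\<^esub>}" using f by (simp add: free_pairs_def)
  ultimately show ?thesis using f by blast
qed

text \<open>
  All properties of a tensor product used later follow from four facts: it is a module
  (\<open>T_module\<close>), pure tensors are bilinear (\<open>tens_bilinear\<close>), they generate additively
  (\<open>tens_induct\<close>), and bilinear maps lift (\<open>lift_tens\<close>, \<open>lift_linear\<close>).
\<close>

locale tensor_pair = M: module K M + N: module K N
  for K :: "('k, 'z) ring_scheme" and M :: "('k, 'a, 'm) module_scheme"
    and N :: "('k, 'b, 'n) module_scheme"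
begin

abbreviation "F \<equiv> free_pairs K (carrier M) (carrier N)"
abbreviation "R \<equiv> tensor_kernel K M N"
abbreviation "T \<equiv> tensor_module K M N"
abbreviation tens where "tens \<equiv> pure_tensor K M N"
abbreviation cls where "cls f \<equiv> R +>\<^bsub>F\<^esub> f"

sublocale F: module K F by (rule free_pairs_module) (rule M.R.is_cring)

lemma single_in [simp]: "a \<in> carrier M \<Longrightarrow> b \<in> carrier N \<Longrightarrow> single_pair K a b \<in> carrier F"
  by (rule single_pair_in) (rule M.R.is_cring)

lemma rels_in: "bilinear_rels K M N \<subseteq> carrier F"
  by (auto simp: bilinear_rels_def Let_def intro!: F.minus_closed F.a_closed F.smult_closed single_in)

lemma kernel_submodule: "submodule R K F"
proof (rule F.submoduleI)
  have c: "carrier F \<in> {S. submodule S K F \<and> bilinear_rels K M N \<subseteq> S}"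
    using F.carrier_is_submodule rels_in by auto
  show "R \<subseteq> carrier F" unfolding tensor_kernel_def using c by (auto simp del: mem_Collect_eq)
  show "\<zero>\<^bsub>F\<^esub> \<in> R" unfolding tensor_kernel_def
    by (auto dest!: submodule.axioms(1) subgroup.one_closed)
qed (auto simp: tensor_kernel_def intro: F.submoduleE)

sublocale R: abelian_subgroup R F
  using kernel_submodule
  by (intro abelian_subgroupI3 additive_subgroupI) (auto simp: submodule_def intro: F.abelian_group_axioms)

lemma rels_kernel: "bilinear_rels K M N \<subseteq> R"
  by (auto simp: tensor_kernel_def)

lemma cls_eq: "f \<in> carrier F \<Longrightarrow> g \<in> carrier F \<Longrightarrow> cls f = cls g \<longleftrightarrow> f \<ominus>\<^bsub>F\<^esub> g \<in> R"
  unfolding a_minus_def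
  by (metis R.a_rcos_module R.a_rcos_self R.a_repr_independence')

lemma T_simps: "carrier T = a_rcosets\<^bsub>F\<^esub> R" "zero T = R" "add T = (\<lambda>X Y. X <+>\<^bsub>F\<^esub> Y)"
  "smult T = (\<lambda>c X. \<Union>f\<in>X. R +>\<^bsub>F\<^esub> (c \<odot>\<^bsub>F\<^esub> f))"
  by (simp_all add: tensor_module_def Let_def)

lemma T_carrier: "X \<in> carrier T \<longleftrightarrow> (\<exists>f\<in>carrier F. X = cls f)"
  by (auto simp: T_simps A_RCOSETS_def')

lemma cls_in [simp]: "f \<in> carrier F \<Longrightarrow> cls f \<in> carrier T"
  by (auto simp: T_carrier)

lemma cls_add: "f \<in> carrier F \<Longrightarrow> g \<in> carrier F \<Longrightarrow> cls f \<oplus>\<^bsub>T\<^esub> cls g = cls (f \<oplus>\<^bsub>F\<^esub> g)"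
  by (simp add: T_simps R.a_rcos_sum)

lemma cls_smult:
  assumes c: "c \<in> carrier K" and f: "f \<in> carrier F" shows "c \<odot>\<^bsub>T\<^esub> cls f = cls (c \<odot>\<^bsub>F\<^esub> f)"
proof -
  \<comment> \<open>The union in the definition of the scalar multiplication runs over equal cosets.\<close>
  have "cls (c \<odot>\<^bsub>F\<^esub> g) = cls (c \<odot>\<^bsub>F\<^esub> f)" if g: "g \<in> cls f" for g
  proof -
    have gF: "g \<in> carrier F" using R.a_elemrcos_carrier g f by blast
    have "cls g = cls f" using R.a_repr_independence'[OF g f] by simp
    then have "g \<ominus>\<^bsub>F\<^esub> f \<in> R" using cls_eq gF f by simp
    then have "c \<odot>\<^bsub>F\<^esub> (g \<ominus>\<^bsub>F\<^esub> f) \<in> R" using submodule.smult_closed[OF kernel_submodule c] by simp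
    then show ?thesis using gF f c by (simp add: cls_eq a_minus_def F.smult_r_distr F.smult_r_minus)
  qed
  moreover have "cls f \<noteq> {}" using R.a_rcos_self[OF f] by auto
  ultimately show ?thesis by (simp add: T_simps)
qed

lemma cls_zero: "cls \<zero>\<^bsub>F\<^esub> = \<zero>\<^bsub>T\<^esub>"
  by (simp add: T_simps R.a_rcos_const)

lemma T_module: "module K T"
proof (rule moduleI)
  show "abelian_group T"
  proof (rule abelian_groupI)
    fix x assume "x \<in> carrier T"
    then obtain f where f: "f \<in> carrier F" "x = cls f" by (auto simp: T_carrier)
    then show "\<exists>y\<in>carrier T. y \<oplus>\<^bsub>T\<^esub> x = \<zero>\<^bsub>T\<^esub>"
      by (intro bexI[of _ "cls (\<ominus>\<^bsub>F\<^esub> f)"]) (auto simp: cls_add cls_zero F.l_neg)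
  qed (auto simp: T_carrier cls_add cls_zero[symmetric] F.a_ac intro!: bexI)
qed (auto simp: T_carrier cls_add cls_smult F.smult_l_distr F.smult_r_distr F.smult_assoc1 M.R.is_cring
     intro!: bexI)

sublocale T: module K T by (rule T_module)

lemma tens_closed [simp, intro]: "a \<in> carrier M \<Longrightarrow> b \<in> carrier N \<Longrightarrow> tens a b \<in> carrier T"
  by (simp add: pure_tensor_def)

lemma tens_bilinear: "bilinear_map K M N T tens"
proof -
  have eq: "cls f = cls g" if "f \<ominus>\<^bsub>F\<^esub> g \<in> bilinear_rels K M N" "f \<in> carrier F" "g \<in> carrier F" for f g
    using that rels_kernel cls_eq by blast
  have rels:
    "\<And>a a' b. a \<in> carrier M \<Longrightarrow> a' \<in> carrier M \<Longrightarrow> b \<in> carrier N \<Longrightarrow>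
       single_pair K (a \<oplus>\<^bsub>M\<^esub> a') b \<ominus>\<^bsub>F\<^esub> (single_pair K a b \<oplus>\<^bsub>F\<^esub> single_pair K a' b) \<in> bilinear_rels K M N"
    "\<And>a b b'. a \<in> carrier M \<Longrightarrow> b \<in> carrier N \<Longrightarrow> b' \<in> carrier N \<Longrightarrow>
       single_pair K a (b \<oplus>\<^bsub>N\<^esub> b') \<ominus>\<^bsub>F\<^esub> (single_pair K a b \<oplus>\<^bsub>F\<^esub> single_pair K a b') \<in> bilinear_rels K M N"
    "\<And>c a b. c \<in> carrier K \<Longrightarrow> a \<in> carrier M \<Longrightarrow> b \<in> carrier N \<Longrightarrow>
       single_pair K (c \<odot>\<^bsub>M\<^esub> a) b \<ominus>\<^bsub>F\<^esub> c \<odot>\<^bsub>F\<^esub> single_pair K a b \<in> bilinear_rels K M N"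
    "\<And>c a b. c \<in> carrier K \<Longrightarrow> a \<in> carrier M \<Longrightarrow> b \<in> carrier N \<Longrightarrow>
       single_pair K a (c \<odot>\<^bsub>N\<^esub> b) \<ominus>\<^bsub>F\<^esub> c \<odot>\<^bsub>F\<^esub> single_pair K a b \<in> bilinear_rels K M N"
    unfolding bilinear_rels_def Let_def by blast+
  show ?thesis
  proof (rule bilinear_mapI)
    fix b assume b: "b \<in> carrier N"
    show "linear_map K M T (\<lambda>a. tens a b)"
    proof (rule linear_mapI)
      fix x y assume "x \<in> carrier M" "y \<in> carrier M"
      then show "tens (x \<oplus>\<^bsub>M\<^esub> y) b = tens x b \<oplus>\<^bsub>T\<^esub> tens y b"
        unfolding pure_tensor_def using b
        by (simp add: cls_add, intro eq) (simp_all, rule rels(1))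
    next
      fix c x assume "c \<in> carrier K" "x \<in> carrier M"
      then show "tens (c \<odot>\<^bsub>M\<^esub> x) b = c \<odot>\<^bsub>T\<^esub> tens x b"
        unfolding pure_tensor_def using b
        by (simp add: cls_smult, intro eq) (simp_all, rule rels(3))
    qed (simp add: b)
  next
    fix a assume a: "a \<in> carrier M"
    show "linear_map K N T (tens a)"
    proof (rule linear_mapI)
      fix x y assume "x \<in> carrier N" "y \<in> carrier N"
      then show "tens a (x \<oplus>\<^bsub>N\<^esub> y) = tens a x \<oplus>\<^bsub>T\<^esub> tens a y"
        unfolding pure_tensor_def using a
        by (simp add: cls_add, intro eq) (simp_all, rule rels(2))
    next
      fix c x assume "c \<in> carrier K" "x \<in> carrier N"
      then show "tens a (c \<odot>\<^bsub>N\<^esub> x) = c \<odot>\<^bsub>T\<^esub> tens a x"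
        unfolding pure_tensor_def using a
        by (simp add: cls_smult, intro eq) (simp_all, rule rels(4))
    qed (simp add: a)
  qed
qed

text \<open>
  Scalars and zero need no cases of their own: \<open>c(a \<otimes> b) = (ca) \<otimes> b\<close> and \<open>0 = 0 \<otimes> 0\<close> are pure.
\<close>

lemma tens_induct [consumes 1, case_names add tens]:
  assumes t: "t \<in> carrier T"
    and add: "\<And>s t. s \<in> carrier T \<Longrightarrow> t \<in> carrier T \<Longrightarrow> Q s \<Longrightarrow> Q t \<Longrightarrow> Q (s \<oplus>\<^bsub>T\<^esub> t)"
    and tens: "\<And>a b. a \<in> carrier M \<Longrightarrow> b \<in> carrier N \<Longrightarrow> Q (tens a b)"
  shows "Q t"
proof -
  obtain f where f: "f \<in> carrier F" "t = cls f" using t by (auto simp: T_carrier)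
  have s: "Q (cls (c \<odot>\<^bsub>F\<^esub> single_pair K a b))"
    if "c \<in> carrier K" "a \<in> carrier M" "b \<in> carrier N" for c a b
  proof -
    have "cls (c \<odot>\<^bsub>F\<^esub> single_pair K a b) = tens (c \<odot>\<^bsub>M\<^esub> a) b"
      using that linear_map_smult[OF bilinear_map_left[OF tens_bilinear]]
      by (simp add: cls_smult[symmetric] pure_tensor_def[symmetric])
    then show ?thesis using tens that by simp
  qed
  have "Q (cls f)"
  proof (rule free_pairs_induct[OF M.R.is_cring f(1)])
    show "Q (cls \<zero>\<^bsub>F\<^esub>)" using s[of "\<zero>\<^bsub>K\<^esub>" "\<zero>\<^bsub>M\<^esub>" "\<zero>\<^bsub>N\<^esub>"] by simp
    show "Q (cls (g \<oplus>\<^bsub>F\<^esub> h))" if "g \<in> carrier F" "h \<in> carrier F" "Q (cls g)" "Q (cls h)" for g h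
      using that add[of "cls g" "cls h"] by (simp add: cls_add)
  qed (rule s)
  then show ?thesis using f by simp
qed

lemma linear_map_unique:
  assumes f: "linear_map K T P f" and g: "linear_map K T P g" and t: "t \<in> carrier T"
    and eq: "\<And>a b. a \<in> carrier M \<Longrightarrow> b \<in> carrier N \<Longrightarrow> f (tens a b) = g (tens a b)"
  shows "f t = g t"
  using t by (induction rule: tens_induct) (auto simp: linear_map_add[OF f] linear_map_add[OF g] eq)

text \<open>
  Independence of the representative: the linear extension of \<open>\<beta>\<close> kills the bilinearity relations,
  hence the submodule generated by them.
\<close>

lemma lift_cls:
  assumes P: "module K P" and \<beta>: "bilinear_map K M N P \<beta>" and f: "f \<in> carrier F"
  shows "tensor_lift K P \<beta> (cls f) = free_lin K P \<beta> f"
proof -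
  interpret P: module K P by fact
  note \<beta>c = bilinear_map_closed[OF \<beta>]
  have lin: "linear_map K F P (free_lin K P \<beta>)" by (rule free_lin_linear[OF P]) (rule \<beta>c)
  note diff = linear_map_diff[OF lin F.module_axioms P]
  have single: "free_lin K P \<beta> (single_pair K a b) = \<beta> a b" if "a \<in> carrier M" "b \<in> carrier N" for a b
    by (rule free_lin_single[OF P \<beta>c that])
  let ?Z = "{f \<in> carrier F. free_lin K P \<beta> f = \<zero>\<^bsub>P\<^esub>}"
  note bi = linear_map_add[OF bilinear_map_left[OF \<beta>]] linear_map_add[OF bilinear_map_right[OF \<beta>]]
    linear_map_smult[OF bilinear_map_left[OF \<beta>]] linear_map_smult[OF bilinear_map_right[OF \<beta>]]
  have "submodule ?Z K F" by (rule submodule_kernel[OF lin F.module_axioms P])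
  moreover have "bilinear_rels K M N \<subseteq> ?Z"
  proof
    fix x assume x: "x \<in> bilinear_rels K M N"
    then have "free_lin K P \<beta> x = \<zero>\<^bsub>P\<^esub>"
      unfolding bilinear_rels_def Let_def
      by (elim UnE CollectE exE conjE)
        (simp_all add: diff single linear_map_add[OF lin] linear_map_smult[OF lin] bi \<beta>c P.r_neg a_minus_def[of P])
    then show "x \<in> ?Z" using rels_in x by auto
  qed
  ultimately have R0: "R \<subseteq> ?Z" unfolding tensor_kernel_def by (intro Inter_lower) simp
  define g where "g = (SOME g. g \<in> cls f)"
  have "g \<in> cls f" unfolding g_def by (rule someI[of _ f]) (rule R.a_rcos_self[OF f])
  then have g: "g \<in> carrier F" "cls f = cls g"
    using R.a_elemrcos_carrier[OF f] R.a_repr_independence'[OF _ f] by simp_all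
  then have "f \<ominus>\<^bsub>F\<^esub> g \<in> R" using cls_eq[OF f g(1)] by simp
  then have "f \<ominus>\<^bsub>F\<^esub> g \<in> ?Z" by (rule subsetD[OF R0])
  then have "free_lin K P \<beta> f \<ominus>\<^bsub>P\<^esub> free_lin K P \<beta> g = \<zero>\<^bsub>P\<^esub>" using diff[OF f g(1)] by simp
  then have "free_lin K P \<beta> f = free_lin K P \<beta> g"
    using linear_map_closed[OF lin f] linear_map_closed[OF lin g(1)]
    by (metis P.minus_eq_zeroD)
  then show ?thesis by (simp add: tensor_lift_def g_def Let_def free_lin_def)
qed

lemma lift_tens:
  assumes "module K P" "bilinear_map K M N P \<beta>" "a \<in> carrier M" "b \<in> carrier N"
  shows "tensor_lift K P \<beta> (tens a b) = \<beta> a b"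
  unfolding pure_tensor_def
  by (simp add: lift_cls[OF assms(1,2)] assms(3,4))
    (rule free_lin_single[OF assms(1) _ assms(3,4)], rule bilinear_map_closed[OF assms(2)])

lemma lift_linear:
  assumes P: "module K P" and \<beta>: "bilinear_map K M N P \<beta>"
  shows "linear_map K T P (tensor_lift K P \<beta>)"
proof -
  have lin: "linear_map K F P (free_lin K P \<beta>)"
    by (rule free_lin_linear[OF P]) (rule bilinear_map_closed[OF \<beta>])
  show ?thesis
    by (rule linear_mapI)
      (auto simp: T_carrier lift_cls[OF P \<beta>] cls_add cls_smult linear_map_add[OF lin]
        linear_map_smult[OF lin] intro: linear_map_closed[OF lin])
qed

lemma lift_cong:
  assumes P: "module K P" and \<beta>: "bilinear_map K M N P \<beta>" and t: "t \<in> carrier T"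
    and eq: "\<And>a b. a \<in> carrier M \<Longrightarrow> b \<in> carrier N \<Longrightarrow> \<beta> a b = \<gamma> a b"
  shows "tensor_lift K P \<beta> t = tensor_lift K P \<gamma> t"
proof -
  have \<gamma>: "bilinear_map K M N P \<gamma>"
  proof (rule bilinear_mapI)
    fix b assume b: "b \<in> carrier N"
    show "linear_map K M P (\<lambda>a. \<gamma> a b)"
      by (rule linear_map_cong[OF bilinear_map_left[OF \<beta> b] _ M.module_axioms]) (rule eq[OF _ b])
  next
    fix a assume a: "a \<in> carrier M"
    show "linear_map K N P (\<gamma> a)"
      by (rule linear_map_cong[OF bilinear_map_right[OF \<beta> a] _ N.module_axioms]) (rule eq[OF a])
  qed
  show ?thesis
    by (rule linear_map_unique[OF lift_linear[OF P \<beta>] lift_linear[OF P \<gamma>] t])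
      (simp add: lift_tens[OF P \<beta>] lift_tens[OF P \<gamma>] eq)
qed

text \<open>
  Linear dependence on a parameter passes from the bilinear map to the induced map.  This yields
  bilinearity of maps built by nested lifts, such as the product of \<open>H \<otimes> H\<close>.
\<close>

lemma lift_param:
  assumes P: "module K P" and A: "module K A"
    and \<beta>: "\<And>x. x \<in> carrier A \<Longrightarrow> bilinear_map K M N P (\<beta> x)"
    and lin: "\<And>a b. a \<in> carrier M \<Longrightarrow> b \<in> carrier N \<Longrightarrow> linear_map K A P (\<lambda>x. \<beta> x a b)"
    and t: "t \<in> carrier T"
  shows "linear_map K A P (\<lambda>x. tensor_lift K P (\<beta> x) t)"
proof -
  interpret A: module K A by fact
  show ?thesis using t
  proof (induction rule: tens_induct)
    case (add s t)
    have "tensor_lift K P (\<beta> x) s \<oplus>\<^bsub>P\<^esub> tensor_lift K P (\<beta> x) t = tensor_lift K P (\<beta> x) (s \<oplus>\<^bsub>T\<^esub> t)"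
      if "x \<in> carrier A" for x
      using linear_map_add[OF lift_linear[OF P \<beta>[OF that]] add(1,2)] by simp
    then show ?case by (rule linear_map_cong[OF linear_map_sum[OF add(3,4) P] _ A])
  next
    case (tens a b)
    show ?case by (rule linear_map_cong[OF lin[OF tens] _ A]) (simp add: lift_tens[OF P \<beta> tens])
  qed
qed

end

lemma tensor_pair_intro: "module K M \<Longrightarrow> module K N \<Longrightarrow> tensor_pair K M N"
  by (simp add: tensor_pair_def)

lemma tensor_map_bilinear:
  assumes "module K M" "module K N" "linear_map K M' M f" "linear_map K N' N g"
  shows "bilinear_map K M' N' (tensor_module K M N) (\<lambda>a b. pure_tensor K M N (f a) (g b))"
  using tensor_pair.tens_bilinear[OF tensor_pair_intro[OF assms(1,2)]] assms(3,4)
  by (rule bilinear_map_comp)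

lemma tensor_map_linear:
  assumes "module K M" "module K N" "module K M'" "module K N'"
    "linear_map K M' M f" "linear_map K N' N g"
  shows "linear_map K (tensor_module K M' N') (tensor_module K M N) (tensor_map K M N f g)"
  unfolding tensor_map_def
  by (intro tensor_pair.lift_linear tensor_pair_intro tensor_pair.T_module tensor_map_bilinear assms)

lemma tensor_map_pure:
  assumes "module K M" "module K N" "module K M'" "module K N'"
    "linear_map K M' M f" "linear_map K N' N g" "a \<in> carrier M'" "b \<in> carrier N'"
  shows "tensor_map K M N f g (pure_tensor K M' N' a b) = pure_tensor K M N (f a) (g b)"
  unfolding tensor_map_def
  by (intro tensor_pair.lift_tens[where M=M' and N=N'] tensor_pair_intro tensor_pair.T_module
      tensor_map_bilinear assms)

lemma tensor_map_cong:
  assumes "module K M" "module K N" "module K M'" "module K N'"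
    "linear_map K M' M f" "linear_map K N' N g" "t \<in> carrier (tensor_module K M' N')"
    "\<And>a. a \<in> carrier M' \<Longrightarrow> f a = f' a" "\<And>b. b \<in> carrier N' \<Longrightarrow> g b = g' b"
  shows "tensor_map K M N f g t = tensor_map K M N f' g' t"
  unfolding tensor_map_def
  by (rule tensor_pair.lift_cong[OF tensor_pair_intro[OF assms(3,4)] 
        tensor_pair.T_module[OF tensor_pair_intro[OF assms(1,2)]] tensor_map_bilinear[OF assms(1,2,5,6)] assms(7)])
    (simp add: assms(8,9))

lemma tensor_map_comp:
  assumes M: "module K M" "module K N" "module K M'" "module K N'" "module K M''" "module K N''"
    and f: "linear_map K M'' M' f" "linear_map K N'' N' g" "linear_map K M' M f'" "linear_map K N' N g'"
    and t: "t \<in> carrier (tensor_module K M'' N'')"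
  shows "tensor_map K M N f' g' (tensor_map K M' N' f g t) = tensor_map K M N (\<lambda>x. f' (f x)) (\<lambda>x. g' (g x)) t"
proof (rule tensor_pair.linear_map_unique[OF tensor_pair_intro[OF M(5,6)] _ _ t])
  show "linear_map K (tensor_module K M'' N'') (tensor_module K M N)
      (\<lambda>t. tensor_map K M N f' g' (tensor_map K M' N' f g t))"
    by (intro linear_map_comp[OF tensor_map_linear tensor_map_linear] M f)
  show "linear_map K (tensor_module K M'' N'') (tensor_module K M N)
      (tensor_map K M N (\<lambda>x. f' (f x)) (\<lambda>x. g' (g x)))"
    by (intro tensor_map_linear M linear_map_comp[OF f(1,3)] linear_map_comp[OF f(2,4)])
next
  fix a b assume ab: "a \<in> carrier M''" "b \<in> carrier N''"
  show "tensor_map K M N f' g' (tensor_map K M' N' f g (pure_tensor K M'' N'' a b)) =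
      tensor_map K M N (\<lambda>x. f' (f x)) (\<lambda>x. g' (g x)) (pure_tensor K M'' N'' a b)"
    by (simp add: tensor_map_pure[OF M(3-6) f(1,2) ab]
        tensor_map_pure[OF M(1-4) f(3,4) linear_map_closed[OF f(1) ab(1)] linear_map_closed[OF f(2) ab(2)]]
        tensor_map_pure[OF M(1,2,5,6) linear_map_comp[OF f(1,3)] linear_map_comp[OF f(2,4)] ab])
qed

lemma ground_module_module: "cring K \<Longrightarrow> module K (ground_module K)"
proof -
  assume "cring K"
  then interpret K: cring K .
  show ?thesis
    by (rule moduleI; (rule abelian_groupI)?)
      (auto simp: ground_module_def K.a_ac K.m_ac K.l_distr K.r_distr K.l_neg K.is_cring
        intro!: bexI[of _ "\<ominus>\<^bsub>K\<^esub> _"])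
qed

lemma submodule_zero: "submodule W K M \<Longrightarrow> \<zero>\<^bsub>M\<^esub> \<in> W"
  using subgroup.one_closed[OF submodule.axioms(1)] by fastforce

lemma functional_bilinear:
  assumes l: "linear_map K M (ground_module K) l" and P: "module K P"
  shows "bilinear_map K M P P (\<lambda>a b. l a \<odot>\<^bsub>P\<^esub> b)"
proof -
  interpret P: module K P by fact
  have l': "\<And>x. x \<in> carrier M \<Longrightarrow> l x \<in> carrier K"
    "\<And>x y. x \<in> carrier M \<Longrightarrow> y \<in> carrier M \<Longrightarrow> l (x \<oplus>\<^bsub>M\<^esub> y) = l x \<oplus>\<^bsub>K\<^esub> l y"
    "\<And>c x. c \<in> carrier K \<Longrightarrow> x \<in> carrier M \<Longrightarrow> l (c \<odot>\<^bsub>M\<^esub> x) = c \<otimes>\<^bsub>K\<^esub> l x"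
    using l by (auto simp: linear_map_def ground_module_def)
  show ?thesis
    by (intro bilinear_mapI linear_mapI)
      (simp_all add: l' P.smult_l_distr P.smult_r_distr P.smult_assoc1[symmetric] P.R.m_comm)
qed

section \<open>Linear functionals over a field\<close>

lemma submodule_Union_chain:
  assumes M: "module K M" and ne: "\<C> \<noteq> {}" and ch: "subset.chain {U. submodule U K M} \<C>"
  shows "submodule (\<Union>\<C>) K M"
proof -
  interpret M: module K M by fact
  have s: "submodule U K M" if "U \<in> \<C>" for U using ch that by (auto simp: subset.chain_def)
  show ?thesis
  proof (rule M.submoduleI)
    show "\<Union>\<C> \<subseteq> carrier M" using M.submoduleE(1)[OF s] by blast
    show "\<zero>\<^bsub>M\<^esub> \<in> \<Union>\<C>" using ne submodule_zero[OF s] by blast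
    fix x assume "x \<in> \<Union>\<C>" then show "\<ominus>\<^bsub>M\<^esub> x \<in> \<Union>\<C>" using M.submoduleE(3)[OF s] by blast
    fix y assume "x \<in> \<Union>\<C>" "y \<in> \<Union>\<C>"
    then obtain U V where UV: "U \<in> \<C>" "V \<in> \<C>" "x \<in> U" "y \<in> V" by blast
    then have "U \<subseteq> V \<or> V \<subseteq> U" using ch by (auto simp: subset.chain_def)
    then obtain Z where "Z \<in> \<C>" "x \<in> Z" "y \<in> Z" using UV by blast
    then show "x \<oplus>\<^bsub>M\<^esub> y \<in> \<Union>\<C>" using M.submoduleE(5)[OF s] by blast
  next
    fix c x assume "c \<in> carrier K" "x \<in> \<Union>\<C>"
    then show "c \<odot>\<^bsub>M\<^esub> x \<in> \<Union>\<C>" using M.submoduleE(4)[OF s] by blast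
  qed
qed

lemma submodule_add_line:
  assumes M: "module K M" and U: "submodule U K M" and x: "x \<in> carrier M"
  shows "submodule {u \<oplus>\<^bsub>M\<^esub> d \<odot>\<^bsub>M\<^esub> x | u d. u \<in> U \<and> d \<in> carrier K} K M"
proof -
  interpret M: module K M by fact
  note E = M.submoduleE[OF U]
  have Uc: "u \<in> U \<Longrightarrow> u \<in> carrier M" for u using E(1) by blast
  show ?thesis
  proof (rule M.submoduleI)
    show "\<zero>\<^bsub>M\<^esub> \<in> {u \<oplus>\<^bsub>M\<^esub> d \<odot>\<^bsub>M\<^esub> x | u d. u \<in> U \<and> d \<in> carrier K}"
      using submodule_zero[OF U] x by (auto intro!: exI[of _ "\<zero>\<^bsub>M\<^esub>"] exI[of _ "\<zero>\<^bsub>K\<^esub>"])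
  next
    fix z assume "z \<in> {u \<oplus>\<^bsub>M\<^esub> d \<odot>\<^bsub>M\<^esub> x | u d. u \<in> U \<and> d \<in> carrier K}"
    then obtain u d where z: "z = u \<oplus>\<^bsub>M\<^esub> d \<odot>\<^bsub>M\<^esub> x" "u \<in> U" "d \<in> carrier K" by blast
    have "\<ominus>\<^bsub>M\<^esub> z = \<ominus>\<^bsub>M\<^esub> u \<oplus>\<^bsub>M\<^esub> (\<ominus>\<^bsub>K\<^esub> d) \<odot>\<^bsub>M\<^esub> x"
      using z x Uc by (simp add: M.minus_add M.smult_l_minus)
    then show "\<ominus>\<^bsub>M\<^esub> z \<in> {u \<oplus>\<^bsub>M\<^esub> d \<odot>\<^bsub>M\<^esub> x | u d. u \<in> U \<and> d \<in> carrier K}"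
      using z E(3) by blast
    fix z' assume "z' \<in> {u \<oplus>\<^bsub>M\<^esub> d \<odot>\<^bsub>M\<^esub> x | u d. u \<in> U \<and> d \<in> carrier K}"
    then obtain u' d' where z': "z' = u' \<oplus>\<^bsub>M\<^esub> d' \<odot>\<^bsub>M\<^esub> x" "u' \<in> U" "d' \<in> carrier K" by blast
    have "z \<oplus>\<^bsub>M\<^esub> z' = (u \<oplus>\<^bsub>M\<^esub> u') \<oplus>\<^bsub>M\<^esub> (d \<oplus>\<^bsub>K\<^esub> d') \<odot>\<^bsub>M\<^esub> x"
      using z z' x Uc by (simp add: M.smult_l_distr M.a_ac)
    moreover have "u \<oplus>\<^bsub>M\<^esub> u' \<in> U" "d \<oplus>\<^bsub>K\<^esub> d' \<in> carrier K" using z z' E(5) by simp_all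
    ultimately show "z \<oplus>\<^bsub>M\<^esub> z' \<in> {u \<oplus>\<^bsub>M\<^esub> d \<odot>\<^bsub>M\<^esub> x | u d. u \<in> U \<and> d \<in> carrier K}"
      by blast
  next
    fix c z assume c: "c \<in> carrier K" and "z \<in> {u \<oplus>\<^bsub>M\<^esub> d \<odot>\<^bsub>M\<^esub> x | u d. u \<in> U \<and> d \<in> carrier K}"
    then obtain u d where z: "z = u \<oplus>\<^bsub>M\<^esub> d \<odot>\<^bsub>M\<^esub> x" "u \<in> U" "d \<in> carrier K" by blast
    have "c \<odot>\<^bsub>M\<^esub> z = c \<odot>\<^bsub>M\<^esub> u \<oplus>\<^bsub>M\<^esub> (c \<otimes>\<^bsub>K\<^esub> d) \<odot>\<^bsub>M\<^esub> x"
      using z x c Uc by (simp add: M.smult_r_distr M.smult_assoc1)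
    moreover have "c \<odot>\<^bsub>M\<^esub> u \<in> U" "c \<otimes>\<^bsub>K\<^esub> d \<in> carrier K" using z c E(4) by simp_all
    ultimately show "c \<odot>\<^bsub>M\<^esub> z \<in> {u \<oplus>\<^bsub>M\<^esub> d \<odot>\<^bsub>M\<^esub> x | u d. u \<in> U \<and> d \<in> carrier K}"
      by blast
  qed (use x Uc in auto)
qed

text \<open>
  Take \<open>U\<close> maximal among the subspaces that contain \<open>W\<close> but not \<open>v\<close>.  Maximality gives
  \<open>M = U \<oplus> Kv\<close>, and the coefficient of \<open>v\<close> is the functional.
\<close>

lemma separating_functional:
  assumes K: "field K" and M: "module K M" and W: "submodule W K M"
    and v: "v \<in> carrier M" "v \<notin> W"
  obtains l where "linear_map K M (ground_module K) l" "l v = \<one>\<^bsub>K\<^esub>" "\<And>w. w \<in> W \<Longrightarrow> l w = \<zero>\<^bsub>K\<^esub>"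
proof -
  interpret K: field K by fact
  interpret M: module K M by fact
  let ?A = "{U. submodule U K M \<and> W \<subseteq> U \<and> v \<notin> U}"
  have "\<exists>U\<in>?A. \<forall>X\<in>?A. U \<subseteq> X \<longrightarrow> X = U"
  proof (rule subset_Zorn_nonempty)
    show "?A \<noteq> {}" using W v by blast
    fix \<C> assume ne: "\<C> \<noteq> {}" and ch: "subset.chain ?A \<C>"
    have "subset.chain {U. submodule U K M} \<C>" using ch by (auto simp: subset.chain_def)
    then have "submodule (\<Union>\<C>) K M" by (rule submodule_Union_chain[OF M ne])
    moreover have "\<forall>U\<in>\<C>. W \<subseteq> U \<and> v \<notin> U" using ch by (auto simp: subset.chain_def)
    then have "W \<subseteq> \<Union>\<C>" "v \<notin> \<Union>\<C>" using ne by blast+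
    ultimately show "\<Union>\<C> \<in> ?A" by simp
  qed
  then obtain U where U: "submodule U K M" "W \<subseteq> U" "v \<notin> U"
    and max: "\<And>X. submodule X K M \<Longrightarrow> U \<subseteq> X \<Longrightarrow> v \<notin> X \<Longrightarrow> X = U"
    by (auto; blast)
  note E = M.submoduleE[OF U(1)]
  have Uc: "u \<in> U \<Longrightarrow> u \<in> carrier M" for u using E(1) by blast
  \<comment> \<open>Division by c would put v into U.\<close>
  have nz: "c = \<zero>\<^bsub>K\<^esub>" if c: "c \<in> carrier K" "c \<odot>\<^bsub>M\<^esub> v \<in> U" for c
  proof (rule ccontr)
    assume "c \<noteq> \<zero>\<^bsub>K\<^esub>"
    then have c': "c \<in> Units K" using c K.field_Units by simp
    have "inv\<^bsub>K\<^esub> c \<odot>\<^bsub>M\<^esub> (c \<odot>\<^bsub>M\<^esub> v) \<in> U" using c c' E(4) by simp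
    then show False using U(3) c c' v by (simp add: M.smult_assoc1[symmetric])
  qed
  \<comment> \<open>For x outside U the subspace U + Kx contains v, and solving for x uses that its
    coefficient in v is invertible.\<close>
  have ex: "\<exists>c\<in>carrier K. \<exists>u\<in>U. x = u \<oplus>\<^bsub>M\<^esub> c \<odot>\<^bsub>M\<^esub> v" if x: "x \<in> carrier M" for x
  proof (cases "x \<in> U")
    case True
    then show ?thesis using x v by (intro bexI[of _ "\<zero>\<^bsub>K\<^esub>"] bexI[of _ x]) auto
  next
    case False
    let ?V = "{u \<oplus>\<^bsub>M\<^esub> d \<odot>\<^bsub>M\<^esub> x | u d. u \<in> U \<and> d \<in> carrier K}"
    have 1: "u \<in> ?V" if "u \<in> U" for u
      using that x Uc[OF that] by (auto intro!: exI[of _ u] exI[of _ "\<zero>\<^bsub>K\<^esub>"])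
    have 2: "x \<in> ?V"
      using x submodule_zero[OF U(1)] by (auto intro!: exI[of _ "\<zero>\<^bsub>M\<^esub>"] exI[of _ "\<one>\<^bsub>K\<^esub>"])
    have "v \<in> ?V"
    proof (rule ccontr)
      assume "v \<notin> ?V"
      then have "?V = U" using 1 by (intro max submodule_add_line M U x) auto
      then show False using False 2 by blast
    qed
    then obtain u d where d: "v = u \<oplus>\<^bsub>M\<^esub> d \<odot>\<^bsub>M\<^esub> x" "u \<in> U" "d \<in> carrier K" by blast
    have "d \<noteq> \<zero>\<^bsub>K\<^esub>" using d U(3) x Uc by auto
    then have d': "d \<in> Units K" using d K.field_Units by simp
    have i: "inv\<^bsub>K\<^esub> d \<in> carrier K" using d' by simp
    have "inv\<^bsub>K\<^esub> d \<odot>\<^bsub>M\<^esub> v = inv\<^bsub>K\<^esub> d \<odot>\<^bsub>M\<^esub> u \<oplus>\<^bsub>M\<^esub> x"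
      using d d' i x Uc by (simp add: M.smult_r_distr M.smult_assoc1[symmetric])
    then have "x = (\<ominus>\<^bsub>M\<^esub> (inv\<^bsub>K\<^esub> d \<odot>\<^bsub>M\<^esub> u)) \<oplus>\<^bsub>M\<^esub> inv\<^bsub>K\<^esub> d \<odot>\<^bsub>M\<^esub> v"
      using i x d Uc by (simp add: M.r_neg1)
    moreover have "\<ominus>\<^bsub>M\<^esub> (inv\<^bsub>K\<^esub> d \<odot>\<^bsub>M\<^esub> u) \<in> U" using i d E by blast
    ultimately show ?thesis using i by blast
  qed
  have uniq: "c = c'" if "c \<in> carrier K" "c' \<in> carrier K" "u \<in> U" "u' \<in> U"
    "u \<oplus>\<^bsub>M\<^esub> c \<odot>\<^bsub>M\<^esub> v = u' \<oplus>\<^bsub>M\<^esub> c' \<odot>\<^bsub>M\<^esub> v" for c c' u u'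
  proof -
    note cl = that(1,2) v(1) Uc[OF that(3)] Uc[OF that(4)]
    have "(c \<ominus>\<^bsub>K\<^esub> c') \<odot>\<^bsub>M\<^esub> v = (\<ominus>\<^bsub>M\<^esub> u \<oplus>\<^bsub>M\<^esub> (u \<oplus>\<^bsub>M\<^esub> c \<odot>\<^bsub>M\<^esub> v)) \<oplus>\<^bsub>M\<^esub> \<ominus>\<^bsub>M\<^esub> (c' \<odot>\<^bsub>M\<^esub> v)"
      using cl by (simp add: a_minus_def M.smult_l_distr M.smult_l_minus M.r_neg1)
    also have "\<dots> = \<ominus>\<^bsub>M\<^esub> u \<oplus>\<^bsub>M\<^esub> u'"
      unfolding that(5) using cl by (simp add: M.a_assoc M.r_neg)
    also have "\<dots> \<in> U" using that E by blast
    finally have "c \<ominus>\<^bsub>K\<^esub> c' = \<zero>\<^bsub>K\<^esub>" using nz cl by simp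
    then show ?thesis using cl K.minus_eq_zeroD by simp
  qed
  define l where "l x = (THE c. c \<in> carrier K \<and> (\<exists>u\<in>U. x = u \<oplus>\<^bsub>M\<^esub> c \<odot>\<^bsub>M\<^esub> v))" for x
  have leq: "l (u \<oplus>\<^bsub>M\<^esub> c \<odot>\<^bsub>M\<^esub> v) = c" if "u \<in> U" "c \<in> carrier K" for u c
    unfolding l_def by (rule the_equality) (use that uniq in blast)+
  have dec: "\<exists>u\<in>U. x = u \<oplus>\<^bsub>M\<^esub> l x \<odot>\<^bsub>M\<^esub> v" "l x \<in> carrier K" if "x \<in> carrier M" for x
    using ex[OF that] leq by auto
  have lin: "linear_map K M (ground_module K) l"
  proof (rule linear_mapI)
    fix x assume x: "x \<in> carrier M"
    show "l x \<in> carrier (ground_module K)" using dec(2)[OF x] by (simp add: ground_module_def)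
    obtain u where u: "u \<in> U" "x = u \<oplus>\<^bsub>M\<^esub> l x \<odot>\<^bsub>M\<^esub> v" using dec(1)[OF x] by blast
    fix y assume y: "y \<in> carrier M"
    obtain w where w: "w \<in> U" "y = w \<oplus>\<^bsub>M\<^esub> l y \<odot>\<^bsub>M\<^esub> v" using dec(1)[OF y] by blast
    note cl = x y Uc[OF u(1)] Uc[OF w(1)] dec(2)[OF x] dec(2)[OF y] v(1)
    have "x \<oplus>\<^bsub>M\<^esub> y = (u \<oplus>\<^bsub>M\<^esub> l x \<odot>\<^bsub>M\<^esub> v) \<oplus>\<^bsub>M\<^esub> (w \<oplus>\<^bsub>M\<^esub> l y \<odot>\<^bsub>M\<^esub> v)"
      using u(2) w(2) by simp
    also have "\<dots> = (u \<oplus>\<^bsub>M\<^esub> w) \<oplus>\<^bsub>M\<^esub> (l x \<oplus>\<^bsub>K\<^esub> l y) \<odot>\<^bsub>M\<^esub> v"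
      using cl by (simp add: M.smult_l_distr M.a_ac)
    finally have "x \<oplus>\<^bsub>M\<^esub> y = \<dots>" .
    then show "l (x \<oplus>\<^bsub>M\<^esub> y) = l x \<oplus>\<^bsub>ground_module K\<^esub> l y"
      using leq E(5)[OF u(1) w(1)] cl by (simp add: ground_module_def)
  next
    fix c x assume c: "c \<in> carrier K" and x: "x \<in> carrier M"
    obtain u where u: "u \<in> U" "x = u \<oplus>\<^bsub>M\<^esub> l x \<odot>\<^bsub>M\<^esub> v" using dec(1)[OF x] by blast
    note cl = x c Uc[OF u(1)] dec(2)[OF x] v(1)
    have "c \<odot>\<^bsub>M\<^esub> x = c \<odot>\<^bsub>M\<^esub> (u \<oplus>\<^bsub>M\<^esub> l x \<odot>\<^bsub>M\<^esub> v)" using u(2) by simp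
    also have "\<dots> = c \<odot>\<^bsub>M\<^esub> u \<oplus>\<^bsub>M\<^esub> (c \<otimes>\<^bsub>K\<^esub> l x) \<odot>\<^bsub>M\<^esub> v"
      using cl by (simp add: M.smult_r_distr M.smult_assoc1)
    finally have "c \<odot>\<^bsub>M\<^esub> x = \<dots>" .
    then show "l (c \<odot>\<^bsub>M\<^esub> x) = c \<odot>\<^bsub>ground_module K\<^esub> l x"
      using leq E(4)[OF c u(1)] cl by (simp add: ground_module_def)
  qed
  moreover have "l v = \<one>\<^bsub>K\<^esub>"
    using leq[OF submodule_zero[OF U(1)], of "\<one>\<^bsub>K\<^esub>"] v by simp
  moreover have "l w = \<zero>\<^bsub>K\<^esub>" if "w \<in> W" for w
    using leq[of w "\<zero>\<^bsub>K\<^esub>"] that U(2) Uc v by auto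
  ultimately show ?thesis by (rule that)
qed

section \<open>Tensor products of subspaces\<close>

text \<open>
  Indices are taken in \<open>nat\<close> so that a fresh index is always at hand when a pure tensor is added.
\<close>

lemma (in tensor_pair) finite_sum_representation:
  assumes t: "t \<in> carrier T"
  shows "\<exists>I a b. finite (I :: nat set) \<and> a \<in> I \<rightarrow> carrier M \<and> b \<in> I \<rightarrow> carrier N \<and>
      t = (\<Oplus>\<^bsub>T\<^esub>i\<in>I. tens (a i) (b i))"
proof -
  define rep where "rep t \<longleftrightarrow> (\<exists>I a b. finite (I :: nat set) \<and> a \<in> I \<rightarrow> carrier M \<and> b \<in> I \<rightarrow> carrier N \<and>
      t = (\<Oplus>\<^bsub>T\<^esub>i\<in>I. tens (a i) (b i)))" for t
  \<comment> \<open>The claim is strengthened to sums with an arbitrary s, so that in the induction two sums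
    never have to be merged: only one pure tensor is added at a time.\<close>
  have "\<forall>s\<in>carrier T. rep s \<longrightarrow> rep (s \<oplus>\<^bsub>T\<^esub> t)"
    using t
  proof (induction rule: tens_induct)
    case (add t1 t2)
    then show ?case by (simp add: T.a_assoc[symmetric])
  next
    case (tens x y)
    show ?case
    proof (intro ballI impI)
      fix s assume s: "s \<in> carrier T" "rep s"
      then obtain I a b where r: "finite (I :: nat set)" "a \<in> I \<rightarrow> carrier M" "b \<in> I \<rightarrow> carrier N"
        "s = (\<Oplus>\<^bsub>T\<^esub>i\<in>I. tens (a i) (b i))" unfolding rep_def by blast
      obtain k where k: "k \<notin> I" using r(1) ex_new_if_finite[OF infinite_UNIV_nat] by blast
      let ?a = "a(k := x)" and ?b = "b(k := y)"
      have ab: "?a \<in> insert k I \<rightarrow> carrier M" "?b \<in> insert k I \<rightarrow> carrier N"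
        using r(2,3) tens by (auto simp: Pi_iff)
      have old: "(\<Oplus>\<^bsub>T\<^esub>i\<in>I. tens (?a i) (?b i)) = s"
        unfolding r(4) by (rule T.finsum_cong') (use r(2,3) k in \<open>auto simp: Pi_iff\<close>)
      have "(\<Oplus>\<^bsub>T\<^esub>i\<in>insert k I. tens (?a i) (?b i)) =
          tens (?a k) (?b k) \<oplus>\<^bsub>T\<^esub> (\<Oplus>\<^bsub>T\<^esub>i\<in>I. tens (?a i) (?b i))"
        by (rule T.finsum_insert[OF r(1) k]) (use ab in \<open>simp_all add: Pi_iff\<close>)
      also have "\<dots> = s \<oplus>\<^bsub>T\<^esub> tens x y"
        unfolding old using tens s(1) by (simp add: T.a_comm)
      finally have "s \<oplus>\<^bsub>T\<^esub> tens x y = (\<Oplus>\<^bsub>T\<^esub>i\<in>insert k I. tens (?a i) (?b i))" by simp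
      then show "rep (s \<oplus>\<^bsub>T\<^esub> tens x y)" unfolding rep_def
        by (intro exI[of _ "insert k I"] exI[of _ ?a] exI[of _ ?b] conjI ab) (simp_all add: r(1))
    qed
  qed
  moreover have "rep \<zero>\<^bsub>T\<^esub>"
    unfolding rep_def by (intro exI[of _ "{}"] exI conjI) simp_all
  ultimately have "rep (\<zero>\<^bsub>T\<^esub> \<oplus>\<^bsub>T\<^esub> t)" by simp
  then show ?thesis using t by (simp add: rep_def)
qed

context tensor_pair
begin

text \<open>
  The tensors of the form \<open>\<Sum> a\<^sub>j \<otimes> c\<^sub>j\<close> with prescribed left factors \<open>a\<^sub>j\<close>.
\<close>

definition left_factor_span where
  "left_factor_span J a = {t. \<exists>c\<in>J \<rightarrow> carrier N. t = (\<Oplus>\<^bsub>T\<^esub>j\<in>J. tens (a j) (c j))}"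

lemma left_factor_spanI:
  "\<lbrakk>c \<in> J \<rightarrow> carrier N; t = (\<Oplus>\<^bsub>T\<^esub>j\<in>J. tens (a j) (c j))\<rbrakk> \<Longrightarrow> t \<in> left_factor_span J a"
  unfolding left_factor_span_def by (rule CollectI) (rule bexI)

lemma left_factor_spanE:
  assumes "t \<in> left_factor_span J a"
  obtains c where "c \<in> J \<rightarrow> carrier N" "t = (\<Oplus>\<^bsub>T\<^esub>j\<in>J. tens (a j) (c j))"
  using assms unfolding left_factor_span_def by (elim CollectE bexE)

lemma tens_add_left:
  "\<lbrakk>a \<in> carrier M; a' \<in> carrier M; b \<in> carrier N\<rbrakk> \<Longrightarrow> tens (a \<oplus>\<^bsub>M\<^esub> a') b = tens a b \<oplus>\<^bsub>T\<^esub> tens a' b"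
  by (rule linear_map_add[OF bilinear_map_left[OF tens_bilinear]])

lemma tens_add_right:
  "\<lbrakk>a \<in> carrier M; b \<in> carrier N; b' \<in> carrier N\<rbrakk> \<Longrightarrow> tens a (b \<oplus>\<^bsub>N\<^esub> b') = tens a b \<oplus>\<^bsub>T\<^esub> tens a b'"
  by (rule linear_map_add[OF bilinear_map_right[OF tens_bilinear]])

lemma tens_smult_left:
  "\<lbrakk>c \<in> carrier K; a \<in> carrier M; b \<in> carrier N\<rbrakk> \<Longrightarrow> tens (c \<odot>\<^bsub>M\<^esub> a) b = c \<odot>\<^bsub>T\<^esub> tens a b"
  by (rule linear_map_smult[OF bilinear_map_left[OF tens_bilinear]])

lemma tens_smult_right:
  "\<lbrakk>c \<in> carrier K; a \<in> carrier M; b \<in> carrier N\<rbrakk> \<Longrightarrow> tens a (c \<odot>\<^bsub>N\<^esub> b) = c \<odot>\<^bsub>T\<^esub> tens a b"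
  by (rule linear_map_smult[OF bilinear_map_right[OF tens_bilinear]])

lemma tens_zero_left: "b \<in> carrier N \<Longrightarrow> tens \<zero>\<^bsub>M\<^esub> b = \<zero>\<^bsub>T\<^esub>"
  by (rule linear_map_zero[OF bilinear_map_left[OF tens_bilinear] M.module_axioms T_module])

lemma tens_zero_right: "a \<in> carrier M \<Longrightarrow> tens a \<zero>\<^bsub>N\<^esub> = \<zero>\<^bsub>T\<^esub>"
  by (rule linear_map_zero[OF bilinear_map_right[OF tens_bilinear] N.module_axioms T_module])

lemma tens_family:
  "\<lbrakk>a \<in> J \<rightarrow> carrier M; c \<in> J \<rightarrow> carrier N\<rbrakk> \<Longrightarrow> (\<lambda>j. tens (a j) (c j)) \<in> J \<rightarrow> carrier T"
  by (simp add: Pi_iff)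

lemma left_sums_add:
  assumes a: "a \<in> J \<rightarrow> carrier M" and c: "c \<in> J \<rightarrow> carrier N" and d: "d \<in> J \<rightarrow> carrier N"
  shows "(\<Oplus>\<^bsub>T\<^esub>j\<in>J. tens (a j) (c j)) \<oplus>\<^bsub>T\<^esub> (\<Oplus>\<^bsub>T\<^esub>j\<in>J. tens (a j) (d j)) =
      (\<Oplus>\<^bsub>T\<^esub>j\<in>J. tens (a j) (c j \<oplus>\<^bsub>N\<^esub> d j))"
proof -
  have "(\<Oplus>\<^bsub>T\<^esub>j\<in>J. tens (a j) (c j \<oplus>\<^bsub>N\<^esub> d j)) = (\<Oplus>\<^bsub>T\<^esub>j\<in>J. tens (a j) (c j) \<oplus>\<^bsub>T\<^esub> tens (a j) (d j))"
    by (rule T.finsum_cong') (use assms in \<open>simp_all add: Pi_iff tens_add_right\<close>)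
  then show ?thesis
    using T.finsum_addf[OF tens_family[OF a c] tens_family[OF a d]] by simp
qed

text \<open>
  This subspace stands in for the linear span of the \<open>a\<^sub>j\<close> in the minimality argument.  It contains
  every \<open>a\<^sub>j\<close>, and for each of its elements \<open>w\<close> the tensor \<open>w \<otimes> y\<close> can be absorbed into a sum with
  left factors \<open>a\<^sub>j\<close>.
\<close>

lemma left_factor_span_submodule:
  assumes J: "finite J" and a: "a \<in> J \<rightarrow> carrier M"
  shows "submodule {w \<in> carrier M. \<forall>y\<in>carrier N. tens w y \<in> left_factor_span J a} K M"
    (is "submodule ?W K M")
proof -
  have zero: "\<zero>\<^bsub>T\<^esub> \<in> left_factor_span J a"
  proof -
    have "(\<Oplus>\<^bsub>T\<^esub>k\<in>J. tens (a k) \<zero>\<^bsub>N\<^esub>) = (\<Oplus>\<^bsub>T\<^esub>k\<in>J. \<zero>\<^bsub>T\<^esub>)"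
      by (rule T.finsum_cong') (use a in \<open>simp_all add: Pi_iff tens_zero_right\<close>)
    then have "\<zero>\<^bsub>T\<^esub> = (\<Oplus>\<^bsub>T\<^esub>k\<in>J. tens (a k) \<zero>\<^bsub>N\<^esub>)" by simp
    then show ?thesis by (rule left_factor_spanI[rotated]) simp
  qed
  have add: "s \<oplus>\<^bsub>T\<^esub> t \<in> left_factor_span J a" if st: "s \<in> left_factor_span J a" "t \<in> left_factor_span J a" for s t
  proof -
    obtain c where c: "c \<in> J \<rightarrow> carrier N" "s = (\<Oplus>\<^bsub>T\<^esub>j\<in>J. tens (a j) (c j))"
      using st(1) by (rule left_factor_spanE)
    obtain d where d: "d \<in> J \<rightarrow> carrier N" "t = (\<Oplus>\<^bsub>T\<^esub>j\<in>J. tens (a j) (d j))"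
      using st(2) by (rule left_factor_spanE)
    have "(\<lambda>j. c j \<oplus>\<^bsub>N\<^esub> d j) \<in> J \<rightarrow> carrier N" using c(1) d(1) by (simp add: Pi_iff)
    then show ?thesis
      by (rule left_factor_spanI) (simp only: c(2) d(2) left_sums_add[OF a c(1) d(1)])
  qed
  have smult: "c \<odot>\<^bsub>M\<^esub> w \<in> ?W" if c: "c \<in> carrier K" and w: "w \<in> ?W" for c w
  proof -
    have wM: "w \<in> carrier M" and wL: "\<And>y. y \<in> carrier N \<Longrightarrow> tens w y \<in> left_factor_span J a" using w by blast+
    have "tens (c \<odot>\<^bsub>M\<^esub> w) y \<in> left_factor_span J a" if y: "y \<in> carrier N" for y
      using wL[of "c \<odot>\<^bsub>N\<^esub> y"] y c wM by (simp add: tens_smult_left tens_smult_right)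
    then show ?thesis using wM c by simp
  qed
  show ?thesis
  proof (rule M.submoduleI[OF _ _ _ _ smult])
    show "?W \<subseteq> carrier M" by (rule Collect_restrict)
    show "\<zero>\<^bsub>M\<^esub> \<in> ?W" using zero by (simp add: tens_zero_left)
    fix x assume x: "x \<in> ?W"
    show "\<ominus>\<^bsub>M\<^esub> x \<in> ?W" using smult[of "\<ominus>\<^bsub>K\<^esub> \<one>\<^bsub>K\<^esub>" x] x by (simp add: M.smult_l_minus)
    fix y assume y: "y \<in> ?W"
    show "x \<oplus>\<^bsub>M\<^esub> y \<in> ?W" using x y add by (simp add: tens_add_left)
  qed
qed

lemma left_factor_span_generator:
  assumes J: "finite J" and a: "a \<in> J \<rightarrow> carrier M" and j: "j \<in> J" and y: "y \<in> carrier N"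
  shows "tens (a j) y \<in> left_factor_span J a"
proof -
  let ?c = "\<lambda>k. if k = j then y else \<zero>\<^bsub>N\<^esub>"
  have "(\<Oplus>\<^bsub>T\<^esub>k\<in>J. tens (a k) (?c k)) = (\<Oplus>\<^bsub>T\<^esub>k\<in>J. if k = j then tens (a k) y else \<zero>\<^bsub>T\<^esub>)"
    by (rule T.finsum_cong') (use a y in \<open>simp_all add: Pi_iff tens_zero_right\<close>)
  also have "\<dots> = tens (a j) y"
    by (rule T.add.finprod_singleton_swap[OF j J]) (use a y in \<open>simp add: Pi_iff\<close>)
  finally show ?thesis
    using y by (intro left_factor_spanI[of ?c]) (simp_all add: Pi_iff)
qed

end

definition dual_family ::
  "('k, 'z) ring_scheme \<Rightarrow> ('k, 'a, 'm) module_scheme \<Rightarrow> 'i set \<Rightarrow> ('i \<Rightarrow> 'a) \<Rightarrow> ('i \<Rightarrow> 'a \<Rightarrow> 'k) \<Rightarrow> bool"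
  where "dual_family K M I a l \<longleftrightarrow> (\<forall>i\<in>I. linear_map K M (ground_module K) (l i) \<and>
    l i (a i) = \<one>\<^bsub>K\<^esub> \<and> (\<forall>j\<in>I. j \<noteq> i \<longrightarrow> l i (a j) = \<zero>\<^bsub>K\<^esub>))"

text \<open>
  Take an expression \<open>t = \<Sum> a\<^sub>i \<otimes> b\<^sub>i\<close> with the least number of terms.  If \<open>a\<^sub>i\<close> were in the subspace
  of vectors \<open>w\<close> whose tensors \<open>w \<otimes> y\<close> are sums with the remaining left factors, the \<open>i\<close>-th term
  could be absorbed by the others.  So a functional separates \<open>a\<^sub>i\<close> from the other left factors.

  The left factors lie in a subspace \<open>A\<close>, but the functionals are defined on all of \<open>M\<close>, so that
  they can still be applied after the inclusion of \<open>A\<close> into \<open>M\<close>.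
\<close>

lemma dual_representation:
  fixes M :: "('k, 'a, 'm) module_scheme" and N :: "('k, 'b, 'n) module_scheme"
  assumes K: "field K" and M: "module K M" and N: "module K N" and A: "submodule A K M"
    and t: "t \<in> carrier (tensor_module K (M\<lparr>carrier := A\<rparr>) N)"
  obtains I :: "nat set" and a b l where "finite I" "a \<in> I \<rightarrow> A" "b \<in> I \<rightarrow> carrier N"
    "t = (\<Oplus>\<^bsub>tensor_module K (M\<lparr>carrier := A\<rparr>) N\<^esub>i\<in>I. pure_tensor K (M\<lparr>carrier := A\<rparr>) N (a i) (b i))"
    "dual_family K M I a l"
proof -
  define S where "S = M\<lparr>carrier := A\<rparr>"
  have S: "carrier S = A" by (simp add: S_def)
  interpret M: module K M by fact
  have "module K S" unfolding S_def by (rule submodule.submodule_is_module[OF A M])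
  then interpret SN: tensor_pair K S N by (rule tensor_pair_intro[OF _ N])
  define P where "P I a b \<longleftrightarrow> finite (I :: nat set) \<and> a \<in> I \<rightarrow> carrier S \<and> b \<in> I \<rightarrow> carrier N \<and>
      t = (\<Oplus>\<^bsub>SN.T\<^esub>i\<in>I. SN.tens (a i) (b i))" for I a b
  have "\<exists>I a b. P I a b"
    using SN.finite_sum_representation[OF t[folded S_def]] unfolding P_def .
  then have "\<exists>n I. card I = n \<and> (\<exists>a b. P I a b)" by blast
  from exists_least_iff[THEN iffD1, OF this]
  obtain n where n: "\<exists>I. card I = n \<and> (\<exists>a b. P I a b)"
    "\<forall>k. k < n \<longrightarrow> \<not> (\<exists>I. card I = k \<and> (\<exists>a b. P I a b))" by blast
  then obtain I a b where rep: "P I a b" and I: "card I = n" by blast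
  have r: "finite I" "a \<in> I \<rightarrow> carrier S" "b \<in> I \<rightarrow> carrier N"
    "t = (\<Oplus>\<^bsub>SN.T\<^esub>i\<in>I. SN.tens (a i) (b i))" using rep unfolding P_def by blast+
  have "\<exists>l. linear_map K M (ground_module K) l \<and> l (a i) = \<one>\<^bsub>K\<^esub> \<and> (\<forall>j\<in>I. j \<noteq> i \<longrightarrow> l (a j) = \<zero>\<^bsub>K\<^esub>)"
    if i: "i \<in> I" for i
  proof -
    define J where "J = I - {i}"
    have J: "finite J" "i \<notin> J" "I = insert i J" "card J < n"
      using r(1) i I card_Diff1_less[of I i] by (auto simp: J_def)
    have aJ: "a \<in> J \<rightarrow> carrier S" and bJ: "b \<in> J \<rightarrow> carrier N"
      using r(2,3) J(3) by (simp_all add: Pi_iff)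
    have ai: "a i \<in> carrier S" "b i \<in> carrier N" using r(2,3) i by (simp_all add: Pi_iff)
    define W where "W = {w \<in> carrier S. \<forall>y\<in>carrier N. SN.tens w y \<in> SN.left_factor_span J a}"
    have "submodule W K S" unfolding W_def by (rule SN.left_factor_span_submodule[OF J(1) aJ])
    then have "module K (S\<lparr>carrier := W\<rparr>)" by (rule submodule.submodule_is_module[OF _ SN.M.module_axioms])
    moreover have "W \<subseteq> carrier M" using M.submoduleE(1)[OF A] by (auto simp: W_def S)
    ultimately have "submodule W K M" by (intro M.module_incl_imp_submodule) (simp_all add: S_def)
    moreover have "a i \<notin> W"
    proof
      assume "a i \<in> W"
      then have "SN.tens (a i) (b i) \<in> SN.left_factor_span J a" using ai(2) by (simp add: W_def)
      then obtain c where c: "c \<in> J \<rightarrow> carrier N"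
        "SN.tens (a i) (b i) = (\<Oplus>\<^bsub>SN.T\<^esub>j\<in>J. SN.tens (a j) (c j))" by (rule SN.left_factor_spanE)
      have "t = (\<Oplus>\<^bsub>SN.T\<^esub>j\<in>insert i J. SN.tens (a j) (b j))" using r(4) J(3) by simp
      also have "\<dots> = SN.tens (a i) (b i) \<oplus>\<^bsub>SN.T\<^esub> (\<Oplus>\<^bsub>SN.T\<^esub>j\<in>J. SN.tens (a j) (b j))"
        by (rule SN.T.finsum_insert[OF J(1,2) SN.tens_family[OF aJ bJ]]) (simp add: ai)
      also have "\<dots> = (\<Oplus>\<^bsub>SN.T\<^esub>j\<in>J. SN.tens (a j) (c j \<oplus>\<^bsub>N\<^esub> b j))"
        unfolding c(2) by (rule SN.left_sums_add[OF aJ c(1) bJ])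
      finally have "t = \<dots>" .
      moreover have "(\<lambda>j. c j \<oplus>\<^bsub>N\<^esub> b j) \<in> J \<rightarrow> carrier N" using c(1) bJ by (simp add: Pi_iff)
      ultimately have "P J a (\<lambda>j. c j \<oplus>\<^bsub>N\<^esub> b j)" using J(1) aJ unfolding P_def by blast
      then show False using n(2) J(4) by blast
    qed
    moreover have "a i \<in> carrier M" using M.submoduleE(1)[OF A] ai by (auto simp: S)
    ultimately obtain l where l: "linear_map K M (ground_module K) l" "l (a i) = \<one>\<^bsub>K\<^esub>"
      "\<And>w. w \<in> W \<Longrightarrow> l w = \<zero>\<^bsub>K\<^esub>"
      using separating_functional[OF K M] by blast
    moreover have "a j \<in> W" if "j \<in> I" "j \<noteq> i" for j
      using that SN.left_factor_span_generator[OF J(1) aJ, of j] r(2) by (auto simp: W_def J_def)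
    ultimately show ?thesis by blast
  qed
  then have "\<exists>l. dual_family K M I a l" unfolding dual_family_def by (intro bchoice ballI)
  then obtain l where l: "dual_family K M I a l" ..
  show ?thesis by (rule that[OF r(1) r(2)[unfolded S] r(3) r(4)[unfolded S_def] l])
qed

text \<open>
  Apply \<open>l\<^sub>i \<otimes> id\<close>, which maps the sum to \<open>c\<^sub>i\<close>.
\<close>

lemma sum_pure_coefficients_zero:
  fixes M :: "('k, 'a, 'm) module_scheme" and P :: "('k, 'c, 'p) module_scheme"
  assumes M: "module K M" and P: "module K P"
    and I: "finite I" "a \<in> I \<rightarrow> carrier M" "c \<in> I \<rightarrow> carrier P"
    and dual: "dual_family K M I a l"
    and z: "(\<Oplus>\<^bsub>tensor_module K M P\<^esub>i\<in>I. pure_tensor K M P (a i) (c i)) = \<zero>\<^bsub>tensor_module K M P\<^esub>"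
    and i: "i \<in> I"
  shows "c i = \<zero>\<^bsub>P\<^esub>"
proof -
  interpret P: module K P by fact
  interpret MP: tensor_pair K M P by (rule tensor_pair_intro[OF M P])
  have l: "linear_map K M (ground_module K) (l i)" "l i (a i) = \<one>\<^bsub>K\<^esub>"
    "\<And>j. j \<in> I \<Longrightarrow> j \<noteq> i \<Longrightarrow> l i (a j) = \<zero>\<^bsub>K\<^esub>"
    using dual i unfolding dual_family_def by blast+
  let ?L = "tensor_lift K P (\<lambda>x y. l i x \<odot>\<^bsub>P\<^esub> y)"
  note bil = functional_bilinear[OF l(1) P]
  note lin = MP.lift_linear[OF P bil]
  have "\<zero>\<^bsub>P\<^esub> = ?L (\<Oplus>\<^bsub>MP.T\<^esub>j\<in>I. MP.tens (a j) (c j))"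
    unfolding z using linear_map_zero[OF lin MP.T_module P] by simp
  also have "\<dots> = (\<Oplus>\<^bsub>P\<^esub>j\<in>I. ?L (MP.tens (a j) (c j)))"
    by (rule linear_map_finsum[OF lin MP.T_module P I(1) MP.tens_family[OF I(2,3)]])
  also have "\<dots> = (\<Oplus>\<^bsub>P\<^esub>j\<in>I. if j = i then c j else \<zero>\<^bsub>P\<^esub>)"
  proof (rule P.finsum_cong')
    fix j assume j: "j \<in> I"
    have ac: "a j \<in> carrier M" "c j \<in> carrier P" using j I(2,3) by (simp_all add: Pi_iff)
    have "?L (MP.tens (a j) (c j)) = l i (a j) \<odot>\<^bsub>P\<^esub> c j"
      by (rule MP.lift_tens[OF P bil ac])
    then show "?L (MP.tens (a j) (c j)) = (if j = i then c j else \<zero>\<^bsub>P\<^esub>)"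
      using ac(2) l(2) l(3)[OF j] by (cases "j = i") simp_all
  qed (use I(3) in \<open>simp_all add: Pi_iff\<close>)
  also have "\<dots> = c i" by (rule P.add.finprod_singleton_swap[OF i I(1,3)])
  finally show ?thesis by simp
qed

lemma tensor_map_sum:
  fixes M' :: "('k, 'a, 'm) module_scheme" and N' :: "('k, 'b, 'n) module_scheme"
  assumes M: "module K M" "module K N" "module K M'" "module K N'"
    and f: "linear_map K M' M f" "linear_map K N' N g"
    and I: "finite I" "a \<in> I \<rightarrow> carrier M'" "b \<in> I \<rightarrow> carrier N'"
  shows "tensor_map K M N f g (\<Oplus>\<^bsub>tensor_module K M' N'\<^esub>i\<in>I. pure_tensor K M' N' (a i) (b i)) =
    (\<Oplus>\<^bsub>tensor_module K M N\<^esub>i\<in>I. pure_tensor K M N (f (a i)) (g (b i)))"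
proof -
  interpret MN: tensor_pair K M N by (rule tensor_pair_intro[OF M(1,2)])
  interpret MN': tensor_pair K M' N' by (rule tensor_pair_intro[OF M(3,4)])
  have "tensor_map K M N f g (\<Oplus>\<^bsub>MN'.T\<^esub>i\<in>I. MN'.tens (a i) (b i)) =
      (\<Oplus>\<^bsub>MN.T\<^esub>i\<in>I. tensor_map K M N f g (MN'.tens (a i) (b i)))"
    by (rule linear_map_finsum[OF tensor_map_linear[OF M f] MN'.T_module MN.T_module I(1) MN'.tens_family[OF I(2,3)]])
  also have "\<dots> = (\<Oplus>\<^bsub>MN.T\<^esub>i\<in>I. MN.tens (f (a i)) (g (b i)))"
  proof (rule MN.T.finsum_cong'[OF refl])
    show "(\<lambda>i. MN.tens (f (a i)) (g (b i))) \<in> I \<rightarrow> carrier MN.T"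
      using I(2,3) linear_map_closed[OF f(1)] linear_map_closed[OF f(2)] by (simp add: Pi_iff)
    fix i assume "i \<in> I"
    then show "tensor_map K M N f g (MN'.tens (a i) (b i)) = MN.tens (f (a i)) (g (b i))"
      using I(2,3) by (intro tensor_map_pure[OF M f]) (simp_all add: Pi_iff)
  qed
  finally show ?thesis .
qed

lemma submodule_inclusion_linear:
  assumes "module K M" "submodule A K M"
  shows "linear_map K (M\<lparr>carrier := A\<rparr>) M id"
  using module.submoduleE(1)[OF assms] by (auto intro!: linear_mapI)

text \<open>
  An element of the kernel, in an expression with dual functionals for its left factors, has all its
  right factors equal to zero.
\<close>

lemma tensor_inclusion_inj:
  fixes M :: "('k, 'a, 'm) module_scheme"
  assumes K: "field K" and M: "module K M" and A: "submodule A K M"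
  shows "inj_on (tensor_map K M M id id) (carrier (tensor_module K (M\<lparr>carrier := A\<rparr>) (M\<lparr>carrier := A\<rparr>)))"
proof -
  define S where "S = M\<lparr>carrier := A\<rparr>"
  have Sc: "carrier S = A" "zero S = zero M" by (simp_all add: S_def)
  have S: "module K S" unfolding S_def by (rule submodule.submodule_is_module[OF A M])
  have inc: "linear_map K S M id" unfolding S_def by (rule submodule_inclusion_linear[OF M A])
  interpret SS: tensor_pair K S S by (rule tensor_pair_intro[OF S S])
  interpret MM: tensor_pair K M M by (rule tensor_pair_intro[OF M M])
  let ?i = "tensor_map K M M id id"
  note lin = tensor_map_linear[OF M M S S inc inc]
  have Ac: "A \<subseteq> carrier M" by (rule MM.M.submoduleE(1)[OF A])
  have zero: "t = \<zero>\<^bsub>SS.T\<^esub>" if t: "t \<in> carrier SS.T" and z: "?i t = \<zero>\<^bsub>MM.T\<^esub>" for t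
  proof -
    obtain I :: "nat set" and a b l where r: "finite I" "a \<in> I \<rightarrow> A" "b \<in> I \<rightarrow> carrier S"
      "t = (\<Oplus>\<^bsub>SS.T\<^esub>i\<in>I. SS.tens (a i) (b i))"
      and l: "dual_family K M I a l"
      by (rule dual_representation[OF K M S A, folded S_def, OF t])
    have s: "(\<Oplus>\<^bsub>MM.T\<^esub>i\<in>I. MM.tens (a i) (b i)) = \<zero>\<^bsub>MM.T\<^esub>"
      using z tensor_map_sum[OF M M S S inc inc r(1) r(2)[folded Sc(1)] r(3)] unfolding r(4) by simp
    have ab: "a \<in> I \<rightarrow> carrier M" "b \<in> I \<rightarrow> carrier M"
      using r(2,3) Ac unfolding Sc by blast+
    have b0: "b i = \<zero>\<^bsub>S\<^esub>" if "i \<in> I" for i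
      unfolding Sc(2) by (rule sum_pure_coefficients_zero[OF M M r(1) ab l s that])
    have "t = (\<Oplus>\<^bsub>SS.T\<^esub>i\<in>I. \<zero>\<^bsub>SS.T\<^esub>)"
      unfolding r(4)
    proof (rule SS.T.finsum_cong'[OF refl])
      fix i assume i: "i \<in> I"
      then have "a i \<in> carrier S" using r(2) by (simp add: Sc Pi_iff)
      then show "SS.tens (a i) (b i) = \<zero>\<^bsub>SS.T\<^esub>"
        unfolding b0[OF i] by (rule SS.tens_zero_right)
    qed simp
    then show ?thesis by simp
  qed
  show ?thesis unfolding S_def[symmetric]
  proof (rule inj_onI)
    fix s t assume s: "s \<in> carrier SS.T" and t: "t \<in> carrier SS.T" and eq: "?i s = ?i t"
    have "?i (s \<ominus>\<^bsub>SS.T\<^esub> t) = ?i t \<ominus>\<^bsub>MM.T\<^esub> ?i t"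
      using linear_map_diff[OF lin SS.T_module MM.T_module s t] eq by simp
    also have "\<dots> = \<zero>\<^bsub>MM.T\<^esub>"
      unfolding a_minus_def by (rule MM.T.r_neg[OF linear_map_closed[OF lin t]])
    finally have "s \<ominus>\<^bsub>SS.T\<^esub> t = \<zero>\<^bsub>SS.T\<^esub>" by (rule zero[OF SS.T.minus_closed[OF s t]])
    then show "s = t" by (rule SS.T.minus_eq_zeroD[OF s t])
  qed
qed

lemma tensor_swap_sum:
  fixes M :: "('k, 'a, 'm) module_scheme"
  assumes M: "module K M" and I: "finite I" "a \<in> I \<rightarrow> carrier M" "b \<in> I \<rightarrow> carrier M"
  shows "tensor_swap K M (\<Oplus>\<^bsub>tensor_module K M M\<^esub>i\<in>I. pure_tensor K M M (a i) (b i)) =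
    (\<Oplus>\<^bsub>tensor_module K M M\<^esub>i\<in>I. pure_tensor K M M (b i) (a i))"
proof -
  interpret MM: tensor_pair K M M by (rule tensor_pair_intro[OF M M])
  have bil: "bilinear_map K M M MM.T (\<lambda>a b. MM.tens b a)"
    using MM.tens_bilinear unfolding bilinear_map_def by simp
  have "tensor_swap K M (\<Oplus>\<^bsub>MM.T\<^esub>i\<in>I. MM.tens (a i) (b i)) =
      (\<Oplus>\<^bsub>MM.T\<^esub>i\<in>I. tensor_swap K M (MM.tens (a i) (b i)))"
    unfolding tensor_swap_def
    by (rule linear_map_finsum[OF MM.lift_linear[OF MM.T_module bil] MM.T_module MM.T_module I(1)
          MM.tens_family[OF I(2,3)]])
  also have "\<dots> = (\<Oplus>\<^bsub>MM.T\<^esub>i\<in>I. MM.tens (b i) (a i))"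
  proof (rule MM.T.finsum_cong'[OF refl MM.tens_family[OF I(3,2)]])
    fix i assume "i \<in> I"
    then show "tensor_swap K M (MM.tens (a i) (b i)) = MM.tens (b i) (a i)"
      unfolding tensor_swap_def using I(2,3)
      by (intro MM.lift_tens[OF MM.T_module bil]) (simp_all add: Pi_iff)
  qed
  finally show ?thesis .
qed

text \<open>
  Flatness over a field in the form needed here: \<open>ker(id \<otimes> \<phi>) = M \<otimes> ker \<phi>\<close> for all \<open>\<phi>\<^sub>j\<close> at once,
  and \<open>(A \<otimes> M) \<inter> (M \<otimes> A) = A \<otimes> A\<close>.
\<close>

lemma symmetric_tensor_in_kernel:
  fixes M :: "('k, 'a, 'm) module_scheme" and P :: "('k, 'c, 'p) module_scheme"
  assumes K: "field K" and M: "module K M" and P: "module K P"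
    and \<phi>: "\<And>j. j \<in> J \<Longrightarrow> linear_map K M P (\<phi> j)"
    and A: "A = {x \<in> carrier M. \<forall>j\<in>J. \<phi> j x = \<zero>\<^bsub>P\<^esub>}" and sub: "submodule A K M"
    and t: "t \<in> carrier (tensor_module K M M)" and sym: "tensor_swap K M t = t"
    and z: "\<And>j. j \<in> J \<Longrightarrow> tensor_map K M P id (\<phi> j) t = \<zero>\<^bsub>tensor_module K M P\<^esub>"
  shows "\<exists>s\<in>carrier (tensor_module K (M\<lparr>carrier := A\<rparr>) (M\<lparr>carrier := A\<rparr>)). tensor_map K M M id id s = t"
proof -
  define S where "S = M\<lparr>carrier := A\<rparr>"
  have Sc: "carrier S = A" by (simp add: S_def)
  have S: "module K S" unfolding S_def by (rule submodule.submodule_is_module[OF sub M])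
  have inc: "linear_map K S M id" unfolding S_def by (rule submodule_inclusion_linear[OF M sub])
  interpret SS: tensor_pair K S S by (rule tensor_pair_intro[OF S S])
  interpret SM: tensor_pair K S M by (rule tensor_pair_intro[OF S M])
  interpret MM: tensor_pair K M M by (rule tensor_pair_intro[OF M M])
  have Ac: "A \<subseteq> carrier M" unfolding A by blast
  have MM': "M\<lparr>carrier := carrier M\<rparr> = M" by simp
  \<comment> \<open>For left factors with dual functionals, the right factors are annihilated by every
    \<open>\<phi> j\<close>.\<close>
  have right: "b i \<in> A"
    if I: "finite (I :: nat set)" "a \<in> I \<rightarrow> carrier M" "b \<in> I \<rightarrow> carrier M"
      "t = (\<Oplus>\<^bsub>MM.T\<^esub>i\<in>I. MM.tens (a i) (b i))"
      and l: "dual_family K M I a l"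
      and i: "i \<in> I" for I a b l i
  proof -
    have "\<phi> j (b i) = \<zero>\<^bsub>P\<^esub>" if j: "j \<in> J" for j
    proof (rule sum_pure_coefficients_zero[OF M P I(1,2) _ l _ i])
      show "(\<lambda>i. \<phi> j (b i)) \<in> I \<rightarrow> carrier P"
        using linear_map_closed[OF \<phi>[OF j]] I(3) by (simp add: Pi_iff)
      show "(\<Oplus>\<^bsub>tensor_module K M P\<^esub>i\<in>I. pure_tensor K M P (a i) (\<phi> j (b i))) = \<zero>\<^bsub>tensor_module K M P\<^esub>"
        using z[OF j] tensor_map_sum[OF M P M M linear_map_id(1) \<phi>[OF j] I(1-3)] unfolding I(4) by simp
    qed
    moreover have "b i \<in> carrier M" using I(3) i by (simp add: Pi_iff)
    ultimately show ?thesis unfolding A by blast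
  qed
  obtain I :: "nat set" and a b l where r: "finite I" "a \<in> I \<rightarrow> carrier M" "b \<in> I \<rightarrow> carrier M"
      "t = (\<Oplus>\<^bsub>MM.T\<^esub>i\<in>I. MM.tens (a i) (b i))"
      and l: "dual_family K M I a l"
    by (rule dual_representation[OF K M M module.carrier_is_submodule[OF M], unfolded MM', OF t])
  have bS: "b \<in> I \<rightarrow> carrier S" unfolding Sc by (rule Pi_I) (rule right[OF r l])
  \<comment> \<open>By symmetry of t the factors in A may be put on the left.\<close>
  define t2 where "t2 = (\<Oplus>\<^bsub>SM.T\<^esub>i\<in>I. SM.tens (b i) (a i))"
  have t2: "t2 \<in> carrier SM.T"
    unfolding t2_def by (rule SM.T.finsum_closed[OF SM.tens_family[OF bS r(2)]])
  have tt2: "t = tensor_map K M M id id t2"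
    using tensor_swap_sum[OF M r(1-3)] sym
      tensor_map_sum[OF M M S M inc linear_map_id(1) r(1) bS r(2)]
    unfolding t2_def r(4)[symmetric] by simp
  \<comment> \<open>A shortest expression is taken anew in the tensor product of A and M: its left factors
    stay in A, and its dual functionals now force the right factors into A as well.\<close>
  obtain I' :: "nat set" and c d m where r': "finite I'" "c \<in> I' \<rightarrow> A" "d \<in> I' \<rightarrow> carrier M"
      "t2 = (\<Oplus>\<^bsub>SM.T\<^esub>i\<in>I'. SM.tens (c i) (d i))"
      and m: "dual_family K M I' c m"
    by (rule dual_representation[OF K M M sub, folded S_def, OF t2])
  have cS: "c \<in> I' \<rightarrow> carrier S" and cM: "c \<in> I' \<rightarrow> carrier M"
    using r'(2) Ac unfolding Sc by blast+
  have tcd: "t = (\<Oplus>\<^bsub>MM.T\<^esub>i\<in>I'. MM.tens (c i) (d i))"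
    using tensor_map_sum[OF M M S M inc linear_map_id(1) r'(1) cS r'(3)] tt2
    unfolding r'(4)[symmetric] by simp
  have dS: "d \<in> I' \<rightarrow> carrier S" unfolding Sc by (rule Pi_I) (rule right[OF r'(1) cM r'(3) tcd m])
  let ?s = "\<Oplus>\<^bsub>SS.T\<^esub>i\<in>I'. SS.tens (c i) (d i)"
  have "?s \<in> carrier SS.T" by (rule SS.T.finsum_closed[OF SS.tens_family[OF cS dS]])
  moreover have "tensor_map K M M id id ?s = t"
    using tensor_map_sum[OF M M S S inc inc r'(1) cS dS] tcd by simp
  ultimately show ?thesis unfolding S_def[symmetric] by blast
qed

section \<open>The tensor square of a Hopf algebra\<close>

lemma tensor_algebra_simps:
  "carrier (tensor_algebra K A B) = carrier (tensor_module K A B)"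
  "add (tensor_algebra K A B) = add (tensor_module K A B)"
  "zero (tensor_algebra K A B) = zero (tensor_module K A B)"
  "smult (tensor_algebra K A B) = smult (tensor_module K A B)"
  "one (tensor_algebra K A B) = pure_tensor K A B \<one>\<^bsub>A\<^esub> \<one>\<^bsub>B\<^esub>"
  by (simp_all add: tensor_algebra_def Let_def)

lemma cocomm_hopf_module: "cocomm_hopf K H \<Longrightarrow> module K H"
  by (simp add: cocomm_hopf_def)

lemma cocomm_hopf_ring: "cocomm_hopf K H \<Longrightarrow> ring H"
  by (simp add: cocomm_hopf_def)

lemma cocomm_hopf_tensor_pair: "cocomm_hopf K H \<Longrightarrow> tensor_pair K H H"
  by (simp add: cocomm_hopf_def tensor_pair_def)

context cocomm_hopf
begin

interpretation HH: tensor_pair K H H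
  by (rule cocomm_hopf_tensor_pair) (rule cocomm_hopf_axioms)

abbreviation tmult (infixl "\<bullet>" 70) where "X \<bullet> Y \<equiv> X \<otimes>\<^bsub>tensor_algebra K H H\<^esub> Y"

lemma module_H: "module K H" by (rule cocomm_hopf_module) (rule cocomm_hopf_axioms)

lemma comult_linear: "linear_map K H (tensor_module K H H) (comult H)"
  using ring_hom_memE(1,3)[OF comult_hom] comult_smult
  by (intro linear_mapI) (simp_all add: tensor_algebra_simps)

lemma comult_closed: "x \<in> carrier H \<Longrightarrow> comult H x \<in> carrier (tensor_module K H H)"
  by (rule linear_map_closed[OF comult_linear])

lemma counit_closed: "x \<in> carrier H \<Longrightarrow> counit H x \<in> carrier K"
  using ring_hom_memE(1)[OF counit_hom] by simp

lemma counit_linear: "linear_map K H (ground_module K) (counit H)"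
  using ring_hom_memE(1,3)[OF counit_hom] counit_smult
  by (intro linear_mapI) (simp_all add: ground_module_def)

lemma mult_linear_right: "a \<in> carrier H \<Longrightarrow> linear_map K H H (\<lambda>c. a \<otimes>\<^bsub>H\<^esub> c)"
  by (rule linear_mapI) (simp_all add: H.r_distr smult_mult_right)

lemma mult_linear_left: "c \<in> carrier H \<Longrightarrow> linear_map K H H (\<lambda>a. a \<otimes>\<^bsub>H\<^esub> c)"
  by (rule linear_mapI) (simp_all add: H.l_distr smult_mult_left)

text \<open>
  The product with \<open>a \<otimes> b\<close> from the left, that is, the inner lift in the product of \<open>H \<otimes> H\<close>.
\<close>

definition left_mult where
  "left_mult a b = tensor_lift K (tensor_module K H H) (\<lambda>c d. pure_tensor K H H (a \<otimes>\<^bsub>H\<^esub> c) (b \<otimes>\<^bsub>H\<^esub> d))"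

lemma tmult_eq: "X \<bullet> Y = tensor_lift K (tensor_module K H H) (\<lambda>a b. left_mult a b Y) X"
  by (simp add: tensor_algebra_def Let_def left_mult_def)

lemma left_mult_bilinear:
  assumes "a \<in> carrier H" "b \<in> carrier H"
  shows "bilinear_map K H H HH.T (\<lambda>c d. HH.tens (a \<otimes>\<^bsub>H\<^esub> c) (b \<otimes>\<^bsub>H\<^esub> d))"
  by (rule bilinear_map_comp[OF HH.tens_bilinear mult_linear_right mult_linear_right]) (rule assms)+

lemma left_mult_linear:
  "\<lbrakk>a \<in> carrier H; b \<in> carrier H\<rbrakk> \<Longrightarrow> linear_map K HH.T HH.T (left_mult a b)"
  unfolding left_mult_def by (rule HH.lift_linear[OF HH.T_module left_mult_bilinear])

lemma left_mult_pure:
  "\<lbrakk>a \<in> carrier H; b \<in> carrier H; c \<in> carrier H; d \<in> carrier H\<rbrakk> \<Longrightarrow>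
    left_mult a b (HH.tens c d) = HH.tens (a \<otimes>\<^bsub>H\<^esub> c) (b \<otimes>\<^bsub>H\<^esub> d)"
  unfolding left_mult_def by (rule HH.lift_tens[OF HH.T_module left_mult_bilinear])

lemma left_mult_bilinear_params:
  assumes Y: "Y \<in> carrier HH.T"
  shows "bilinear_map K H H HH.T (\<lambda>a b. left_mult a b Y)"
proof (rule bilinear_mapI)
  fix b assume b: "b \<in> carrier H"
  show "linear_map K H HH.T (\<lambda>a. left_mult a b Y)"
    unfolding left_mult_def
  proof (rule HH.lift_param[OF HH.T_module module_H left_mult_bilinear[OF _ b] _ Y])
    fix c d assume c: "c \<in> carrier H" and d: "d \<in> carrier H"
    show "linear_map K H HH.T (\<lambda>a. HH.tens (a \<otimes>\<^bsub>H\<^esub> c) (b \<otimes>\<^bsub>H\<^esub> d))"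
      by (rule linear_map_comp[OF mult_linear_left[OF c] bilinear_map_left[OF HH.tens_bilinear]])
        (simp add: b d)
  qed
next
  fix a assume a: "a \<in> carrier H"
  show "linear_map K H HH.T (\<lambda>b. left_mult a b Y)"
    unfolding left_mult_def
  proof (rule HH.lift_param[OF HH.T_module module_H left_mult_bilinear[OF a] _ Y])
    fix c d assume c: "c \<in> carrier H" and d: "d \<in> carrier H"
    show "linear_map K H HH.T (\<lambda>b. HH.tens (a \<otimes>\<^bsub>H\<^esub> c) (b \<otimes>\<^bsub>H\<^esub> d))"
      by (rule linear_map_comp[OF mult_linear_left[OF d] bilinear_map_right[OF HH.tens_bilinear]])
        (simp add: a c)
  qed
qed

lemma tmult_linear_left: "Y \<in> carrier HH.T \<Longrightarrow> linear_map K HH.T HH.T (\<lambda>X. X \<bullet> Y)"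
  unfolding tmult_eq by (rule HH.lift_linear[OF HH.T_module left_mult_bilinear_params])

lemma tmult_linear_right: "X \<in> carrier HH.T \<Longrightarrow> linear_map K HH.T HH.T (\<lambda>Y. X \<bullet> Y)"
  unfolding tmult_eq
  by (rule HH.lift_param[OF HH.T_module HH.T_module left_mult_bilinear_params left_mult_linear])

lemma tmult_pure:
  "\<lbrakk>a \<in> carrier H; b \<in> carrier H; c \<in> carrier H; d \<in> carrier H\<rbrakk> \<Longrightarrow>
    HH.tens a b \<bullet> HH.tens c d = HH.tens (a \<otimes>\<^bsub>H\<^esub> c) (b \<otimes>\<^bsub>H\<^esub> d)"
  unfolding tmult_eq
  by (simp add: HH.lift_tens[OF HH.T_module left_mult_bilinear_params] left_mult_pure)

lemma tmult_closed: "\<lbrakk>X \<in> carrier HH.T; Y \<in> carrier HH.T\<rbrakk> \<Longrightarrow> X \<bullet> Y \<in> carrier HH.T"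
  by (rule linear_map_closed[OF tmult_linear_left])

lemmas tmult_add_left = linear_map_add[OF tmult_linear_left]
lemmas tmult_add_right = linear_map_add[OF tmult_linear_right]

text \<open>
  Associativity for one general and two pure factors is what the computation of \<open>\<delta>(S(x))\<close> for a
  group-like \<open>x\<close> uses.
\<close>

lemma tmult_assoc_pure:
  assumes X: "X \<in> carrier HH.T" and abcd: "a \<in> carrier H" "b \<in> carrier H" "c \<in> carrier H" "d \<in> carrier H"
  shows "(X \<bullet> HH.tens a b) \<bullet> HH.tens c d = X \<bullet> (HH.tens a b \<bullet> HH.tens c d)"
  using X
proof (induction rule: HH.tens_induct)
  case (add s t)
  then show ?case using abcd by (simp add: tmult_add_left tmult_closed)
next
  case (tens x y)
  then show ?case using abcd by (simp add: tmult_pure H.m_assoc)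
qed

lemma tmult_one_right: "X \<in> carrier HH.T \<Longrightarrow> X \<bullet> HH.tens \<one>\<^bsub>H\<^esub> \<one>\<^bsub>H\<^esub> = X"
proof (induction rule: HH.tens_induct)
  case (add s t)
  then show ?case by (simp add: tmult_add_left)
qed (simp add: tmult_pure)

lemma tmult_one_left: "X \<in> carrier HH.T \<Longrightarrow> HH.tens \<one>\<^bsub>H\<^esub> \<one>\<^bsub>H\<^esub> \<bullet> X = X"
proof (induction rule: HH.tens_induct)
  case (add s t)
  then show ?case by (simp add: tmult_add_right)
qed (simp add: tmult_pure)

lemma comult_mult: "\<lbrakk>x \<in> carrier H; y \<in> carrier H\<rbrakk> \<Longrightarrow> comult H (x \<otimes>\<^bsub>H\<^esub> y) = comult H x \<bullet> comult H y"
  by (rule ring_hom_memE(2)[OF comult_hom])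

lemma comult_one: "comult H \<one>\<^bsub>H\<^esub> = HH.tens \<one>\<^bsub>H\<^esub> \<one>\<^bsub>H\<^esub>"
  using ring_hom_memE(4)[OF comult_hom] by (simp add: tensor_algebra_simps)

section \<open>Group-like elements\<close>

lemma Gl_carrier: "x \<in> carrier (Gl K H) \<longleftrightarrow>
    x \<in> carrier H \<and> comult H x = HH.tens x x \<and> counit H x = \<one>\<^bsub>K\<^esub>"
  by (simp add: Gl_def)

text \<open>
  The antipode equations at \<open>\<delta>(x) = x \<otimes> x\<close> say that \<open>S(x)\<close> is a two-sided inverse of \<open>x\<close>.  Then
  \<open>\<delta>(S(x))\<close> and \<open>S(x) \<otimes> S(x)\<close> are a left and a right inverse of \<open>x \<otimes> x\<close>, hence equal.
\<close>

lemma Gl_antipode: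
  assumes "x \<in> carrier (Gl K H)"
  shows "antipode H x \<in> carrier (Gl K H)" "antipode H x \<otimes>\<^bsub>H\<^esub> x = \<one>\<^bsub>H\<^esub>"
proof -
  have x: "x \<in> carrier H" "comult H x = HH.tens x x" "counit H x = \<one>\<^bsub>K\<^esub>"
    using assms by (simp_all add: Gl_carrier)
  define y where "y = antipode H x"
  have y: "y \<in> carrier H" unfolding y_def by (rule antipode_closed[OF x(1)])
  have S: "linear_map K H H (antipode H)"
    by (rule linear_mapI) (simp_all add: antipode_closed antipode_add antipode_smult)
  have mult: "bilinear_map K H H H (\<otimes>\<^bsub>H\<^esub>)"
    by (rule bilinear_mapI) (simp_all add: mult_linear_left mult_linear_right)
  have yx: "y \<otimes>\<^bsub>H\<^esub> x = \<one>\<^bsub>H\<^esub>"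
  proof -
    have "tensor_lift K H (\<lambda>a b. antipode H a \<otimes>\<^bsub>H\<^esub> b) (HH.tens x x) = antipode H x \<otimes>\<^bsub>H\<^esub> x"
      by (rule HH.lift_tens[OF module_H bilinear_map_comp[OF mult S linear_map_id(2)] x(1) x(1)])
    then show ?thesis using antipode_left[OF x(1)] x by (simp add: y_def)
  qed
  have xy: "x \<otimes>\<^bsub>H\<^esub> y = \<one>\<^bsub>H\<^esub>"
  proof -
    have "tensor_lift K H (\<lambda>a b. a \<otimes>\<^bsub>H\<^esub> antipode H b) (HH.tens x x) = x \<otimes>\<^bsub>H\<^esub> antipode H x"
      by (rule HH.lift_tens[OF module_H bilinear_map_comp[OF mult linear_map_id(2) S] x(1) x(1)])
    then show ?thesis using antipode_right[OF x(1)] x by (simp add: y_def)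
  qed
  have "comult H y \<bullet> HH.tens x x = HH.tens \<one>\<^bsub>H\<^esub> \<one>\<^bsub>H\<^esub>"
    using comult_mult[OF y x(1)] yx x(2) comult_one by simp
  then have "(comult H y \<bullet> HH.tens x x) \<bullet> HH.tens y y = HH.tens y y"
    using y by (simp add: tmult_one_left)
  moreover have "(comult H y \<bullet> HH.tens x x) \<bullet> HH.tens y y = comult H y"
    using x(1) y xy by (simp add: tmult_assoc_pure comult_closed tmult_pure tmult_one_right)
  ultimately have cy: "comult H y = HH.tens y y" by simp
  have "counit H y \<otimes>\<^bsub>K\<^esub> counit H x = \<one>\<^bsub>K\<^esub>"
    using ring_hom_memE(2)[OF counit_hom y x(1)] yx ring_hom_memE(4)[OF counit_hom] by simp
  then have "counit H y = \<one>\<^bsub>K\<^esub>" using x(3) counit_closed[OF y] by simp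
  then show "antipode H x \<in> carrier (Gl K H)" "antipode H x \<otimes>\<^bsub>H\<^esub> x = \<one>\<^bsub>H\<^esub>"
    using y cy yx by (simp_all add: Gl_carrier y_def)
qed

lemma Gl_group: "group (Gl K H)"
proof (rule groupI)
  fix x y assume "x \<in> carrier (Gl K H)" "y \<in> carrier (Gl K H)"
  then show "x \<otimes>\<^bsub>Gl K H\<^esub> y \<in> carrier (Gl K H)"
    by (simp add: Gl_def comult_mult tmult_pure ring_hom_memE(2)[OF counit_hom])
next
  show "\<one>\<^bsub>Gl K H\<^esub> \<in> carrier (Gl K H)"
    by (simp add: Gl_def comult_one ring_hom_memE(4)[OF counit_hom])
next
  fix x assume "x \<in> carrier (Gl K H)"
  then show "\<exists>y\<in>carrier (Gl K H). y \<otimes>\<^bsub>Gl K H\<^esub> x = \<one>\<^bsub>Gl K H\<^esub>"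
    using Gl_antipode[of x] by (intro bexI[of _ "antipode H x"]) (simp_all add: Gl_def)
qed (simp_all add: Gl_def H.m_assoc)

section \<open>Primitive elements\<close>

lemma Prim_carrier: "x \<in> carrier (Prim K H) \<longleftrightarrow> x \<in> carrier H \<and>
    comult H x = HH.tens x \<one>\<^bsub>H\<^esub> \<oplus>\<^bsub>HH.T\<^esub> HH.tens \<one>\<^bsub>H\<^esub> x"
  by (simp add: Prim_def)

lemma primitive_form_linear: "linear_map K H HH.T (\<lambda>x. HH.tens x \<one>\<^bsub>H\<^esub> \<oplus>\<^bsub>HH.T\<^esub> HH.tens \<one>\<^bsub>H\<^esub> x)"
  by (intro linear_map_sum HH.T_module bilinear_map_left[OF HH.tens_bilinear]
      bilinear_map_right[OF HH.tens_bilinear] H.one_closed)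

lemma Prim_submodule: "submodule (carrier (Prim K H)) K H"
proof -
  let ?p = "\<lambda>x. HH.tens x \<one>\<^bsub>H\<^esub> \<oplus>\<^bsub>HH.T\<^esub> HH.tens \<one>\<^bsub>H\<^esub> x"
  have eq: "comult H x = ?p x \<longleftrightarrow> comult H x \<ominus>\<^bsub>HH.T\<^esub> ?p x = \<zero>\<^bsub>HH.T\<^esub>" if x: "x \<in> carrier H" for x
    using HH.T.minus_eq_zeroD[OF comult_closed[OF x] linear_map_closed[OF primitive_form_linear x]]
      HH.T.r_neg[OF linear_map_closed[OF primitive_form_linear x]] by (auto simp: a_minus_def)
  have "carrier (Prim K H) = {x \<in> carrier H. comult H x \<ominus>\<^bsub>HH.T\<^esub> ?p x = \<zero>\<^bsub>HH.T\<^esub>}"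
    using eq by (simp add: set_eq_iff Prim_carrier cong: conj_cong)
  then show ?thesis
    using submodule_kernel[OF linear_map_minus[OF comult_linear primitive_form_linear HH.T_module] module_H HH.T_module]
    by simp
qed

lemma Prim_module: "module K (Prim K H)"
proof -
  let ?S = "H\<lparr>carrier := carrier (Prim K H)\<rparr>"
  interpret S: module K ?S by (rule submodule.submodule_is_module[OF Prim_submodule module_H])
  have eq: "carrier ?S = carrier (Prim K H)" "add ?S = add (Prim K H)" "zero ?S = zero (Prim K H)"
    "smult ?S = smult (Prim K H)"
    by (simp_all add: Prim_def)
  show ?thesis
  proof (rule moduleI)
    show "abelian_group (Prim K H)"
      by (rule abelian_groupI; insert abelian_groupE[OF S.abelian_group_axioms]; simp only: eq)
    show "\<And>a x. a \<in> carrier K \<Longrightarrow> x \<in> carrier (Prim K H) \<Longrightarrow> a \<odot>\<^bsub>Prim K H\<^esub> x \<in> carrier (Prim K H)"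
      using S.smult_closed unfolding eq .
    show "\<And>a b x. a \<in> carrier K \<Longrightarrow> b \<in> carrier K \<Longrightarrow> x \<in> carrier (Prim K H) \<Longrightarrow>
       (a \<oplus>\<^bsub>K\<^esub> b) \<odot>\<^bsub>Prim K H\<^esub> x = a \<odot>\<^bsub>Prim K H\<^esub> x \<oplus>\<^bsub>Prim K H\<^esub> b \<odot>\<^bsub>Prim K H\<^esub> x"
      using S.smult_l_distr unfolding eq .
    show "\<And>a x y. a \<in> carrier K \<Longrightarrow> x \<in> carrier (Prim K H) \<Longrightarrow> y \<in> carrier (Prim K H) \<Longrightarrow>
       a \<odot>\<^bsub>Prim K H\<^esub> (x \<oplus>\<^bsub>Prim K H\<^esub> y) = a \<odot>\<^bsub>Prim K H\<^esub> x \<oplus>\<^bsub>Prim K H\<^esub> a \<odot>\<^bsub>Prim K H\<^esub> y"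
      using S.smult_r_distr unfolding eq .
    show "\<And>a b x. a \<in> carrier K \<Longrightarrow> b \<in> carrier K \<Longrightarrow> x \<in> carrier (Prim K H) \<Longrightarrow>
       a \<otimes>\<^bsub>K\<^esub> b \<odot>\<^bsub>Prim K H\<^esub> x = a \<odot>\<^bsub>Prim K H\<^esub> (b \<odot>\<^bsub>Prim K H\<^esub> x)"
      using S.smult_assoc1 unfolding eq .
    show "\<And>x. x \<in> carrier (Prim K H) \<Longrightarrow> \<one>\<^bsub>K\<^esub> \<odot>\<^bsub>Prim K H\<^esub> x = x"
      using S.smult_one unfolding eq .
  qed (rule K.is_cring)
qed

abbreviation comm where "comm x y \<equiv> x \<otimes>\<^bsub>H\<^esub> y \<oplus>\<^bsub>H\<^esub> (\<ominus>\<^bsub>K\<^esub> \<one>\<^bsub>K\<^esub>) \<odot>\<^bsub>H\<^esub> (y \<otimes>\<^bsub>H\<^esub> x)"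

lemma comm_minus: "\<lbrakk>x \<in> carrier H; y \<in> carrier H\<rbrakk> \<Longrightarrow> comm x y = x \<otimes>\<^bsub>H\<^esub> y \<ominus>\<^bsub>H\<^esub> y \<otimes>\<^bsub>H\<^esub> x"
  by (simp add: H.smult_l_minus a_minus_def)

lemma Prim_comult_mult:
  assumes "x \<in> carrier (Prim K H)" "y \<in> carrier (Prim K H)"
  shows "comult H (x \<otimes>\<^bsub>H\<^esub> y) =
    (HH.tens (x \<otimes>\<^bsub>H\<^esub> y) \<one>\<^bsub>H\<^esub> \<oplus>\<^bsub>HH.T\<^esub> HH.tens \<one>\<^bsub>H\<^esub> (x \<otimes>\<^bsub>H\<^esub> y)) \<oplus>\<^bsub>HH.T\<^esub>
    (HH.tens x y \<oplus>\<^bsub>HH.T\<^esub> HH.tens y x)"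
proof -
  have xy: "x \<in> carrier H" "y \<in> carrier H"
    "comult H x = HH.tens x \<one>\<^bsub>H\<^esub> \<oplus>\<^bsub>HH.T\<^esub> HH.tens \<one>\<^bsub>H\<^esub> x"
    "comult H y = HH.tens y \<one>\<^bsub>H\<^esub> \<oplus>\<^bsub>HH.T\<^esub> HH.tens \<one>\<^bsub>H\<^esub> y"
    using assms by (simp_all add: Prim_carrier)
  show ?thesis unfolding comult_mult[OF xy(1,2)] xy(3,4)
    using xy(1,2)
    by (simp add: tmult_add_left tmult_add_right tmult_closed tmult_pure HH.T.a_ac)
qed

text \<open>
  The mixed part \<open>x \<otimes> y + y \<otimes> x\<close> of the coproduct of \<open>xy\<close> is symmetric in \<open>x\<close> and \<open>y\<close> and drops out
  of the commutator.
\<close>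

lemma Prim_comm_closed:
  assumes xy: "x \<in> carrier (Prim K H)" "y \<in> carrier (Prim K H)"
  shows "comm x y \<in> carrier (Prim K H)"
proof -
  have c: "x \<in> carrier H" "y \<in> carrier H" using xy by (simp_all add: Prim_carrier)
  let ?p = "\<lambda>x. HH.tens x \<one>\<^bsub>H\<^esub> \<oplus>\<^bsub>HH.T\<^esub> HH.tens \<one>\<^bsub>H\<^esub> x"
  let ?s = "HH.tens x y \<oplus>\<^bsub>HH.T\<^esub> HH.tens y x"
  have cl: "?p (x \<otimes>\<^bsub>H\<^esub> y) \<in> carrier HH.T" "?p (y \<otimes>\<^bsub>H\<^esub> x) \<in> carrier HH.T" "?s \<in> carrier HH.T"
    using c by simp_all
  have s: "HH.tens y x \<oplus>\<^bsub>HH.T\<^esub> HH.tens x y = ?s" using c by (simp add: HH.T.a_comm)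
  have "comult H (comm x y) = comult H (x \<otimes>\<^bsub>H\<^esub> y) \<ominus>\<^bsub>HH.T\<^esub> comult H (y \<otimes>\<^bsub>H\<^esub> x)"
    unfolding comm_minus[OF c] using c
    by (intro linear_map_diff[OF comult_linear module_H HH.T_module]) simp_all
  also have "\<dots> = (?p (x \<otimes>\<^bsub>H\<^esub> y) \<oplus>\<^bsub>HH.T\<^esub> ?s) \<ominus>\<^bsub>HH.T\<^esub> (?p (y \<otimes>\<^bsub>H\<^esub> x) \<oplus>\<^bsub>HH.T\<^esub> ?s)"
    unfolding Prim_comult_mult[OF xy] Prim_comult_mult[OF xy(2,1)] s ..
  also have "\<dots> = ?p (x \<otimes>\<^bsub>H\<^esub> y) \<ominus>\<^bsub>HH.T\<^esub> ?p (y \<otimes>\<^bsub>H\<^esub> x)"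
  proof -
    have "(u \<oplus>\<^bsub>HH.T\<^esub> s) \<ominus>\<^bsub>HH.T\<^esub> (v \<oplus>\<^bsub>HH.T\<^esub> s) = u \<ominus>\<^bsub>HH.T\<^esub> v"
      if "u \<in> carrier HH.T" "v \<in> carrier HH.T" "s \<in> carrier HH.T" for u v s
    proof -
      have "(u \<oplus>\<^bsub>HH.T\<^esub> s) \<ominus>\<^bsub>HH.T\<^esub> (v \<oplus>\<^bsub>HH.T\<^esub> s) = (u \<ominus>\<^bsub>HH.T\<^esub> v) \<oplus>\<^bsub>HH.T\<^esub> (s \<oplus>\<^bsub>HH.T\<^esub> \<ominus>\<^bsub>HH.T\<^esub> s)"
        using that by (simp add: a_minus_def HH.T.minus_add HH.T.a_ac del: HH.T.r_neg)
      then show ?thesis using that by (simp add: HH.T.r_neg)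
    qed
    then show ?thesis using cl by blast
  qed
  also have "\<dots> = ?p (comm x y)"
    unfolding comm_minus[OF c] using c
    by (intro linear_map_diff[OF primitive_form_linear module_H HH.T_module, symmetric]) simp_all
  finally show ?thesis using c by (simp add: Prim_carrier)
qed

lemma comm_jacobi:
  assumes c: "x \<in> carrier H" "y \<in> carrier H" "z \<in> carrier H"
  shows "comm x (comm y z) \<oplus>\<^bsub>H\<^esub> comm y (comm z x) \<oplus>\<^bsub>H\<^esub> comm z (comm x y) = \<zero>\<^bsub>H\<^esub>"
proof -
  \<comment> \<open>The letters stand for the six products of x, y and z in the three expanded brackets; each
    occurs once with either sign.\<close>
  have cancel: "(a \<oplus>\<^bsub>H\<^esub> \<ominus>\<^bsub>H\<^esub> b \<oplus>\<^bsub>H\<^esub> (\<ominus>\<^bsub>H\<^esub> c \<oplus>\<^bsub>H\<^esub> f)) \<oplus>\<^bsub>H\<^esub> (c \<oplus>\<^bsub>H\<^esub> \<ominus>\<^bsub>H\<^esub> d \<oplus>\<^bsub>H\<^esub> (\<ominus>\<^bsub>H\<^esub> e \<oplus>\<^bsub>H\<^esub> b)) \<oplus>\<^bsub>H\<^esub>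
      (e \<oplus>\<^bsub>H\<^esub> \<ominus>\<^bsub>H\<^esub> f \<oplus>\<^bsub>H\<^esub> (\<ominus>\<^bsub>H\<^esub> a \<oplus>\<^bsub>H\<^esub> d)) = \<zero>\<^bsub>H\<^esub>"
    if cl: "a \<in> carrier H" "b \<in> carrier H" "c \<in> carrier H" "d \<in> carrier H" "e \<in> carrier H" "f \<in> carrier H"
    for a b c d e f
  proof -
    note cl' = cl cl[THEN H.M.a_inv_closed]
    have "(a \<oplus>\<^bsub>H\<^esub> \<ominus>\<^bsub>H\<^esub> b \<oplus>\<^bsub>H\<^esub> (\<ominus>\<^bsub>H\<^esub> c \<oplus>\<^bsub>H\<^esub> f)) \<oplus>\<^bsub>H\<^esub> (c \<oplus>\<^bsub>H\<^esub> \<ominus>\<^bsub>H\<^esub> d \<oplus>\<^bsub>H\<^esub> (\<ominus>\<^bsub>H\<^esub> e \<oplus>\<^bsub>H\<^esub> b)) \<oplus>\<^bsub>H\<^esub>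
      (e \<oplus>\<^bsub>H\<^esub> \<ominus>\<^bsub>H\<^esub> f \<oplus>\<^bsub>H\<^esub> (\<ominus>\<^bsub>H\<^esub> a \<oplus>\<^bsub>H\<^esub> d)) =
      (a \<oplus>\<^bsub>H\<^esub> \<ominus>\<^bsub>H\<^esub> a) \<oplus>\<^bsub>H\<^esub> (b \<oplus>\<^bsub>H\<^esub> \<ominus>\<^bsub>H\<^esub> b) \<oplus>\<^bsub>H\<^esub> (c \<oplus>\<^bsub>H\<^esub> \<ominus>\<^bsub>H\<^esub> c) \<oplus>\<^bsub>H\<^esub>
      (d \<oplus>\<^bsub>H\<^esub> \<ominus>\<^bsub>H\<^esub> d) \<oplus>\<^bsub>H\<^esub> (e \<oplus>\<^bsub>H\<^esub> \<ominus>\<^bsub>H\<^esub> e) \<oplus>\<^bsub>H\<^esub> (f \<oplus>\<^bsub>H\<^esub> \<ominus>\<^bsub>H\<^esub> f)"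
      by (simp only: cl' H.M.a_ac H.M.a_closed)
    also have "\<dots> = \<zero>\<^bsub>H\<^esub>" using cl by (simp add: H.M.r_neg)
    finally show ?thesis .
  qed
  have expand: "comm x (comm y z) = x \<otimes>\<^bsub>H\<^esub> (y \<otimes>\<^bsub>H\<^esub> z) \<oplus>\<^bsub>H\<^esub> \<ominus>\<^bsub>H\<^esub> (x \<otimes>\<^bsub>H\<^esub> (z \<otimes>\<^bsub>H\<^esub> y)) \<oplus>\<^bsub>H\<^esub>
      (\<ominus>\<^bsub>H\<^esub> (y \<otimes>\<^bsub>H\<^esub> (z \<otimes>\<^bsub>H\<^esub> x)) \<oplus>\<^bsub>H\<^esub> z \<otimes>\<^bsub>H\<^esub> (y \<otimes>\<^bsub>H\<^esub> x))"
    if "x \<in> carrier H" "y \<in> carrier H" "z \<in> carrier H" for x y z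
    using that by (simp add: H.smult_l_minus H.l_distr H.r_distr H.l_minus H.r_minus H.M.minus_add H.m_assoc)
  show ?thesis unfolding expand[OF c] expand[OF c(2,3,1)] expand[OF c(3,1,2)]
    by (rule cancel) (simp_all add: c)
qed

lemma Prim_lie_algebra: "lie_algebra K (Prim K H)"
proof -
  interpret P: module K "Prim K H" by (rule Prim_module)
  have c: "x \<in> carrier (Prim K H) \<Longrightarrow> x \<in> carrier H" for x by (simp add: Prim_carrier)
  have eq: "add (Prim K H) = add H" "zero (Prim K H) = zero H" "smult (Prim K H) = smult H"
    "bracket (Prim K H) = comm"
    by (simp_all add: Prim_def)
  show ?thesis
  proof (unfold_locales, unfold eq)
    fix x y z assume xyz: "x \<in> carrier (Prim K H)" "y \<in> carrier (Prim K H)" "z \<in> carrier (Prim K H)"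
    show "comm x (comm y z) \<oplus>\<^bsub>H\<^esub> comm y (comm z x) \<oplus>\<^bsub>H\<^esub> comm z (comm x y) = \<zero>\<^bsub>H\<^esub>"
      by (rule comm_jacobi[OF xyz[THEN c]])
    show "comm (x \<oplus>\<^bsub>H\<^esub> y) z = comm x z \<oplus>\<^bsub>H\<^esub> comm y z"
      "comm x (y \<oplus>\<^bsub>H\<^esub> z) = comm x y \<oplus>\<^bsub>H\<^esub> comm x z"
      using xyz[THEN c] by (simp_all add: H.l_distr H.r_distr H.smult_r_distr H.M.a_ac)
  next
    fix k x y assume k: "k \<in> carrier K" and "x \<in> carrier (Prim K H)" "y \<in> carrier (Prim K H)"
    then have xy: "x \<in> carrier H" "y \<in> carrier H" by (simp_all add: c)
    show "comm (k \<odot>\<^bsub>H\<^esub> x) y = k \<odot>\<^bsub>H\<^esub> comm x y" "comm x (k \<odot>\<^bsub>H\<^esub> y) = k \<odot>\<^bsub>H\<^esub> comm x y"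
      using k xy by (simp_all add: smult_mult_left smult_mult_right H.smult_r_distr H.smult_l_minus H.smult_r_minus)
  next
    fix x assume "x \<in> carrier (Prim K H)"
    then show "comm x x = \<zero>\<^bsub>H\<^esub>" using c by (simp add: H.smult_l_minus H.M.r_neg)
  qed (rule Prim_comm_closed)
qed

text \<open>
  Applying \<open>\<epsilon> \<otimes> id\<close> to \<open>\<delta>(x) = x \<otimes> 1 + 1 \<otimes> x\<close> gives \<open>x = \<epsilon>(x)1 + x\<close>.
\<close>

lemma counit_prim:
  assumes "x \<in> carrier (Prim K H)" shows "counit H x = \<zero>\<^bsub>K\<^esub>"
proof -
  have x: "x \<in> carrier H" "comult H x = HH.tens x \<one>\<^bsub>H\<^esub> \<oplus>\<^bsub>HH.T\<^esub> HH.tens \<one>\<^bsub>H\<^esub> x"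
    using assms by (simp_all add: Prim_carrier)
  note bil = functional_bilinear[OF counit_linear module_H]
  note one = ring_hom_memE(4)[OF counit_hom]
  have e: "counit H x \<in> carrier K" by (rule counit_closed[OF x(1)])
  have "x = counit H x \<odot>\<^bsub>H\<^esub> \<one>\<^bsub>H\<^esub> \<oplus>\<^bsub>H\<^esub> x"
    using counit_left[OF x(1)] x one
    by (simp add: linear_map_add[OF HH.lift_linear[OF module_H bil]] HH.lift_tens[OF module_H bil])
  then have "counit H x \<odot>\<^bsub>H\<^esub> \<one>\<^bsub>H\<^esub> = \<zero>\<^bsub>H\<^esub>"
    using x(1) e by (metis H.M.add.r_cancel_one' H.smult_closed H.one_closed)
  then have "counit H (counit H x \<odot>\<^bsub>H\<^esub> \<one>\<^bsub>H\<^esub>) = \<zero>\<^bsub>K\<^esub>"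
    using linear_map_zero[OF counit_linear module_H ground_module_module[OF K.is_cring]]
    by (simp add: ground_module_def)
  then show ?thesis using counit_smult[OF e, of "\<one>\<^bsub>H\<^esub>"] one e by simp
qed

end

section \<open>Hopf kernels\<close>

lemma hopf_hom_linear:
  assumes "f \<in> hopf_hom K A B" shows "linear_map K A B f"
  using assms ring_hom_memE(1,3)[of f A B] by (auto simp: hopf_hom_def intro!: linear_mapI)

lemma hopf_hom_one: "f \<in> hopf_hom K A B \<Longrightarrow> f \<one>\<^bsub>A\<^esub> = \<one>\<^bsub>B\<^esub>"
  using ring_hom_memE(4)[of f A B] by (simp add: hopf_hom_def)

lemma tensor_map_minus_right:
  assumes M: "module K M" "module K N" "module K M'" "module K N'"
    and f: "linear_map K M' M f" and g: "linear_map K N' N g" and h: "linear_map K N' N h"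
    and t: "t \<in> carrier (tensor_module K M' N')"
  shows "tensor_map K M N f (\<lambda>x. g x \<ominus>\<^bsub>N\<^esub> h x) t =
    tensor_map K M N f g t \<ominus>\<^bsub>tensor_module K M N\<^esub> tensor_map K M N f h t"
proof -
  interpret MN: tensor_pair K M N by (rule tensor_pair_intro[OF M(1,2)])
  interpret MN': tensor_pair K M' N' by (rule tensor_pair_intro[OF M(3,4)])
  note gh = linear_map_minus[OF g h M(2)]
  show ?thesis
  proof (rule MN'.linear_map_unique[OF tensor_map_linear[OF M f gh]
        linear_map_minus[OF tensor_map_linear[OF M f g] tensor_map_linear[OF M f h] MN.T_module] t])
    fix a b assume ab: "a \<in> carrier M'" "b \<in> carrier N'"
    have "MN.tens (f a) (g b \<ominus>\<^bsub>N\<^esub> h b) = MN.tens (f a) (g b) \<ominus>\<^bsub>MN.T\<^esub> MN.tens (f a) (h b)"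
      by (rule linear_map_diff[OF bilinear_map_right[OF MN.tens_bilinear linear_map_closed[OF f ab(1)]]
            M(2) MN.T_module linear_map_closed[OF g ab(2)] linear_map_closed[OF h ab(2)]])
    then show "tensor_map K M N f (\<lambda>x. g x \<ominus>\<^bsub>N\<^esub> h x) (MN'.tens a b) =
        tensor_map K M N f g (MN'.tens a b) \<ominus>\<^bsub>MN.T\<^esub> tensor_map K M N f h (MN'.tens a b)"
      by (simp add: tensor_map_pure[OF M f gh ab] tensor_map_pure[OF M f g ab] tensor_map_pure[OF M f h ab])
  qed
qed

text \<open>
  The map \<open>u \<otimes> v \<mapsto> u \<otimes> (v \<otimes> c)\<close>.  It is the associator with its last argument \<open>c\<close> fixed, and here
  \<open>c\<close> may lie in another module, since it is also needed after \<open>f\<close> has been applied to the last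
  factor.
\<close>

definition append_right where
  "append_right K A B c = tensor_lift K (tensor_module K A (tensor_module K A B))
    (\<lambda>u v. pure_tensor K A (tensor_module K A B) u (pure_tensor K A B v c))"

lemma append_right_bilinear:
  assumes A: "module K A" and B: "module K B" and c: "c \<in> carrier B"
  shows "bilinear_map K A A (tensor_module K A (tensor_module K A B))
    (\<lambda>u v. pure_tensor K A (tensor_module K A B) u (pure_tensor K A B v c))"
proof -
  interpret AB: tensor_pair K A B by (rule tensor_pair_intro[OF A B])
  interpret AP: tensor_pair K A AB.T by (rule tensor_pair_intro[OF A AB.T_module])
  show ?thesis
    by (rule bilinear_map_comp[OF AP.tens_bilinear linear_map_id(2) bilinear_map_left[OF AB.tens_bilinear c]])
qed

lemma append_right_linear:
  assumes A: "module K A" and B: "module K B" and c: "c \<in> carrier B"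
  shows "linear_map K (tensor_module K A A) (tensor_module K A (tensor_module K A B)) (append_right K A B c)"
proof -
  interpret AA: tensor_pair K A A by (rule tensor_pair_intro[OF A A])
  interpret AB: tensor_pair K A B by (rule tensor_pair_intro[OF A B])
  interpret AP: tensor_pair K A AB.T by (rule tensor_pair_intro[OF A AB.T_module])
  show ?thesis unfolding append_right_def
    by (rule AA.lift_linear[OF AP.T_module append_right_bilinear[OF A B c]])
qed

lemma append_right_pure:
  assumes A: "module K A" and B: "module K B" and c: "c \<in> carrier B"
    and uv: "u \<in> carrier A" "v \<in> carrier A"
  shows "append_right K A B c (pure_tensor K A A u v) =
    pure_tensor K A (tensor_module K A B) u (pure_tensor K A B v c)"
proof -
  interpret AA: tensor_pair K A A by (rule tensor_pair_intro[OF A A])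
  interpret AB: tensor_pair K A B by (rule tensor_pair_intro[OF A B])
  interpret AP: tensor_pair K A AB.T by (rule tensor_pair_intro[OF A AB.T_module])
  show ?thesis unfolding append_right_def
    by (rule AA.lift_tens[OF AP.T_module append_right_bilinear[OF A B c] uv])
qed

lemma append_right_linear_param:
  assumes A: "module K A" and B: "module K B" and s: "s \<in> carrier (tensor_module K A A)"
  shows "linear_map K B (tensor_module K A (tensor_module K A B)) (\<lambda>c. append_right K A B c s)"
proof -
  interpret AA: tensor_pair K A A by (rule tensor_pair_intro[OF A A])
  interpret AB: tensor_pair K A B by (rule tensor_pair_intro[OF A B])
  interpret AP: tensor_pair K A AB.T by (rule tensor_pair_intro[OF A AB.T_module])
  show ?thesis unfolding append_right_def
  proof (rule AA.lift_param[OF AP.T_module B append_right_bilinear[OF A B] _ s])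
    fix u v assume u: "u \<in> carrier A" and v: "v \<in> carrier A"
    show "linear_map K B AP.T (\<lambda>c. AP.tens u (AB.tens v c))"
      by (rule linear_map_comp[OF bilinear_map_right[OF AB.tens_bilinear v] bilinear_map_right[OF AP.tens_bilinear u]])
  qed
qed

lemma tensor_assoc_eq: "tensor_assoc K A = tensor_lift K (tensor_module K A (tensor_module K A A))
    (\<lambda>t c. append_right K A A c t)"
  by (simp add: tensor_assoc_def append_right_def Let_def)

text \<open>
  Naturality of the associator in the last factor.
\<close>

lemma append_right_natural:
  assumes A: "module K A" and B: "module K B" and f: "linear_map K A B f"
    and c: "c \<in> carrier A" and s: "s \<in> carrier (tensor_module K A A)"
  shows "tensor_map K A (tensor_module K A B) id (tensor_map K A B id f) (append_right K A A c s) =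
    append_right K A B (f c) s"
proof -
  interpret AA: tensor_pair K A A by (rule tensor_pair_intro[OF A A])
  interpret AB: tensor_pair K A B by (rule tensor_pair_intro[OF A B])
  interpret AAA: tensor_pair K A AA.T by (rule tensor_pair_intro[OF A AA.T_module])
  interpret AP: tensor_pair K A AB.T by (rule tensor_pair_intro[OF A AB.T_module])
  note idf = tensor_map_linear[OF A B A A linear_map_id(1) f]
  note mods = A AB.T_module A AA.T_module
  note fc = linear_map_closed[OF f c]
  show ?thesis
  proof (rule AA.linear_map_unique[OF linear_map_comp[OF append_right_linear[OF A A c]
          tensor_map_linear[OF mods linear_map_id(1) idf]] append_right_linear[OF A B fc] s])
    fix u v assume uv: "u \<in> carrier A" "v \<in> carrier A"
    show "tensor_map K A AB.T id (tensor_map K A B id f) (append_right K A A c (AA.tens u v)) =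
        append_right K A B (f c) (AA.tens u v)"
      by (simp add: append_right_pure[OF A A c uv] append_right_pure[OF A B fc uv]
          tensor_map_pure[OF mods linear_map_id(1) idf uv(1) AA.tens_closed[OF uv(2) c]]
          tensor_map_pure[OF A B A A linear_map_id(1) f uv(2) c])
  qed
qed

locale hopf_map = A: cocomm_hopf K A + B: cocomm_hopf K B
  for K :: "('k, 'z) ring_scheme" and A :: "('k, 'a) hopf" and B :: "('k, 'b) hopf" +
  fixes f :: "'a \<Rightarrow> 'b"
  assumes f: "f \<in> hopf_hom K A B"
begin

lemmas mA = A.module_H
lemmas mB = B.module_H
lemmas f_linear = hopf_hom_linear[OF f]

interpretation AA: tensor_pair K A A by (rule tensor_pair_intro[OF mA mA])
interpretation AB: tensor_pair K A B by (rule tensor_pair_intro[OF mA mB])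

text \<open>
  The linear map \<open>x \<mapsto> \<Sum> x' \<otimes> f(x'') - x \<otimes> 1\<close>, whose kernel is \<open>HKer(f)\<close>.
\<close>

definition ker_map where
  "ker_map x = tensor_map K A B id f (comult A x) \<ominus>\<^bsub>AB.T\<^esub> AB.tens x \<one>\<^bsub>B\<^esub>"

lemma right_comult_linear: "linear_map K A AB.T (\<lambda>x. tensor_map K A B id f (comult A x))"
  by (rule linear_map_comp[OF A.comult_linear tensor_map_linear[OF mA mB mA mA linear_map_id(1) f_linear]])

lemma one_B: "\<one>\<^bsub>B\<^esub> \<in> carrier B"
  by (rule ring.ring_simprules(6)[OF cocomm_hopf_ring]) (rule B.cocomm_hopf_axioms)

lemma one_A: "\<one>\<^bsub>A\<^esub> \<in> carrier A"
  by (rule ring.ring_simprules(6)[OF cocomm_hopf_ring]) (rule A.cocomm_hopf_axioms)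

lemma tens_one_linear: "linear_map K A AB.T (\<lambda>x. AB.tens x \<one>\<^bsub>B\<^esub>)"
  by (rule bilinear_map_left[OF AB.tens_bilinear one_B])

lemma ker_map_linear: "linear_map K A AB.T ker_map"
  unfolding ker_map_def by (rule linear_map_minus[OF right_comult_linear tens_one_linear AB.T_module])

lemma HKer_iff: "x \<in> HKer K A B f \<longleftrightarrow> x \<in> carrier A \<and> ker_map x = \<zero>\<^bsub>AB.T\<^esub>"
proof -
  have "tensor_map K A B id f (comult A x) = AB.tens x \<one>\<^bsub>B\<^esub> \<longleftrightarrow> ker_map x = \<zero>\<^bsub>AB.T\<^esub>"
    if x: "x \<in> carrier A"
  proof
    assume "tensor_map K A B id f (comult A x) = AB.tens x \<one>\<^bsub>B\<^esub>"
    then show "ker_map x = \<zero>\<^bsub>AB.T\<^esub>"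
      unfolding ker_map_def using AB.T.r_neg[OF linear_map_closed[OF tens_one_linear x]]
      by (simp add: a_minus_def)
  next
    assume "ker_map x = \<zero>\<^bsub>AB.T\<^esub>"
    then show "tensor_map K A B id f (comult A x) = AB.tens x \<one>\<^bsub>B\<^esub>"
      unfolding ker_map_def
      by (rule AB.T.minus_eq_zeroD[OF linear_map_closed[OF right_comult_linear x] linear_map_closed[OF tens_one_linear x]])
  qed
  then show ?thesis by (auto simp: HKer_def)
qed

text \<open>
  Write the iterated coproduct of \<open>x\<close> as \<open>\<Sum> x\<^sub>1 \<otimes> x\<^sub>2 \<otimes> x\<^sub>3\<close>.  By coassociativity,
  \<open>\<Sum> x\<^sub>1 \<otimes> x\<^sub>2 \<otimes> f(x\<^sub>3)\<close> arises from \<open>\<Sum> x\<^sub>1 \<otimes> f(x\<^sub>2)\<close> by applying \<open>\<delta>\<close> to the left factor.  For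
  \<open>x \<in> HKer(f)\<close> the latter is \<open>x \<otimes> 1\<close>, so the former is \<open>\<Sum> x\<^sub>1 \<otimes> x\<^sub>2 \<otimes> 1\<close>, and the two parts
  of \<open>\<Sum> x\<^sub>1 \<otimes> \<phi>(x\<^sub>2)\<close> cancel.
\<close>

lemma ker_map_comult:
  assumes x: "x \<in> HKer K A B f"
  shows "tensor_map K A AB.T id ker_map (comult A x) = \<zero>\<^bsub>tensor_module K A AB.T\<^esub>"
proof -
  interpret AAA: tensor_pair K A AA.T by (rule tensor_pair_intro[OF mA AA.T_module])
  interpret AAA': tensor_pair K AA.T A by (rule tensor_pair_intro[OF AA.T_module mA])
  interpret AP: tensor_pair K A AB.T by (rule tensor_pair_intro[OF mA AB.T_module])
  have xA: "x \<in> carrier A" and xk: "tensor_map K A B id f (comult A x) = AB.tens x \<one>\<^bsub>B\<^esub>"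
    using x by (simp_all add: HKer_def)
  note D = A.comult_closed[OF xA]
  note idf = tensor_map_linear[OF mA mB mA mA linear_map_id(1) f_linear]
  \<comment> \<open>\<open>?G\<close> is \<open>\<delta>\<close> on the left factor, followed by reassociation.\<close>
  let ?G = "tensor_lift K AP.T (\<lambda>a c. append_right K A B c (comult A a))"
  have Gbil: "bilinear_map K A B AP.T (\<lambda>a c. append_right K A B c (comult A a))"
  proof (rule bilinear_mapI)
    fix c assume "c \<in> carrier B"
    then show "linear_map K A AP.T (\<lambda>a. append_right K A B c (comult A a))"
      by (rule linear_map_comp[OF A.comult_linear append_right_linear[OF mA mB]])
  next
    fix a assume "a \<in> carrier A"
    then show "linear_map K B AP.T (\<lambda>c. append_right K A B c (comult A a))"
      by (intro append_right_linear_param mA mB A.comult_closed)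
  qed
  have assoc_bil: "bilinear_map K AA.T A AAA.T (\<lambda>t c. append_right K A A c t)"
    by (rule bilinear_mapI) (rule append_right_linear[OF mA mA] append_right_linear_param[OF mA mA]; assumption)+
  note assoc_lin = AAA'.lift_linear[OF AAA.T_module assoc_bil, folded tensor_assoc_eq]
  note Did = tensor_map_linear[OF AA.T_module mA mA mA A.comult_linear linear_map_id(1)]
  note ididf = tensor_map_linear[OF mA AB.T_module mA AA.T_module linear_map_id(1) idf]
  have "tensor_map K A AB.T id (\<lambda>y. tensor_map K A B id f (comult A y)) (comult A x) =
      tensor_map K A AB.T id (tensor_map K A B id f) (tensor_map K A AA.T id (comult A) (comult A x))"
    using tensor_map_comp[OF mA AB.T_module mA AA.T_module mA mA linear_map_id(1) A.comult_linear
        linear_map_id(1) idf D] by (simp add: id_def)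
  also have "\<dots> = tensor_map K A AB.T id (tensor_map K A B id f)
      (tensor_assoc K A (tensor_map K AA.T A (comult A) id (comult A x)))"
    by (simp only: A.coassoc[OF xA])
  also have "\<dots> = ?G (tensor_map K A B id f (comult A x))"
  proof (rule AA.linear_map_unique[OF linear_map_comp[OF linear_map_comp[OF Did assoc_lin] ididf]
          linear_map_comp[OF idf AB.lift_linear[OF AP.T_module Gbil]] D])
    fix a b assume ab: "a \<in> carrier A" "b \<in> carrier A"
    note Da = A.comult_closed[OF ab(1)]
    have "tensor_assoc K A (tensor_map K AA.T A (comult A) id (AA.tens a b)) = append_right K A A b (comult A a)"
      unfolding tensor_assoc_eq
      by (simp add: tensor_map_pure[OF AA.T_module mA mA mA A.comult_linear linear_map_id(1) ab]
          AAA'.lift_tens[OF AAA.T_module assoc_bil Da ab(2)])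
    moreover have "?G (tensor_map K A B id f (AA.tens a b)) = append_right K A B (f b) (comult A a)"
      by (simp add: tensor_map_pure[OF mA mB mA mA linear_map_id(1) f_linear ab]
          AB.lift_tens[OF AP.T_module Gbil ab(1) linear_map_closed[OF f_linear ab(2)]])
    ultimately show "tensor_map K A AB.T id (tensor_map K A B id f)
        (tensor_assoc K A (tensor_map K AA.T A (comult A) id (AA.tens a b))) =
        ?G (tensor_map K A B id f (AA.tens a b))"
      by (simp add: append_right_natural[OF mA mB f_linear ab(2) Da])
  qed
  also have "\<dots> = append_right K A B \<one>\<^bsub>B\<^esub> (comult A x)"
    unfolding xk by (rule AB.lift_tens[OF AP.T_module Gbil xA one_B])
  also have "\<dots> = tensor_map K A AB.T id (\<lambda>y. AB.tens y \<one>\<^bsub>B\<^esub>) (comult A x)"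
    by (simp add: append_right_def tensor_map_def)
  finally have eq: "tensor_map K A AB.T id (\<lambda>y. tensor_map K A B id f (comult A y)) (comult A x) =
      tensor_map K A AB.T id (\<lambda>y. AB.tens y \<one>\<^bsub>B\<^esub>) (comult A x)" .
  have "tensor_map K A AB.T id ker_map (comult A x) =
      tensor_map K A AB.T id (\<lambda>y. tensor_map K A B id f (comult A y)) (comult A x) \<ominus>\<^bsub>AP.T\<^esub>
      tensor_map K A AB.T id (\<lambda>y. AB.tens y \<one>\<^bsub>B\<^esub>) (comult A x)"
    unfolding ker_map_def
    by (rule tensor_map_minus_right[OF mA AB.T_module mA mA linear_map_id(1) right_comult_linear tens_one_linear D])
  also have "\<dots> = \<zero>\<^bsub>AP.T\<^esub>"
    unfolding eq a_minus_def
    by (rule AP.T.r_neg[OF linear_map_closed[OF tensor_map_linear[OF mA AB.T_module mA mA linear_map_id(1) tens_one_linear] D]])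
  finally show ?thesis .
qed

text \<open>
  The map \<open>\<epsilon> \<otimes> id\<close> detects the right factor \<open>y\<close> of \<open>x \<otimes> y\<close> if \<open>\<epsilon>(x) = 1\<close>; this is how equations in
  \<open>A \<otimes> B\<close> are turned into equations in \<open>B\<close>.
\<close>

lemma counit_contract:
  assumes "x \<in> carrier A" "y \<in> carrier B"
  shows "tensor_lift K B (\<lambda>a b. counit A a \<odot>\<^bsub>B\<^esub> b) (AB.tens x y) = counit A x \<odot>\<^bsub>B\<^esub> y"
  by (rule AB.lift_tens[OF mB functional_bilinear[OF A.counit_linear mB] assms])

lemma one_in_HKer: "\<one>\<^bsub>A\<^esub> \<in> HKer K A B f"
  using tensor_map_pure[OF mA mB mA mA linear_map_id(1) f_linear one_A one_A] one_A
  by (simp add: HKer_def A.comult_one hopf_hom_one[OF f])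

lemma grouplike_in_HKer:
  assumes "x \<in> carrier (Gl K A)"
  shows "x \<in> HKer K A B f \<longleftrightarrow> f x = \<one>\<^bsub>B\<^esub>"
proof -
  have x: "x \<in> carrier A" "comult A x = AA.tens x x" "counit A x = \<one>\<^bsub>K\<^esub>"
    using assms by (simp_all add: Gl_def)
  have fx: "f x \<in> carrier B" by (rule linear_map_closed[OF f_linear x(1)])
  have "x \<in> HKer K A B f \<longleftrightarrow> AB.tens x (f x) = AB.tens x \<one>\<^bsub>B\<^esub>"
    using x tensor_map_pure[OF mA mB mA mA linear_map_id(1) f_linear x(1) x(1)] by (simp add: HKer_def)
  also have "\<dots> \<longleftrightarrow> f x = \<one>\<^bsub>B\<^esub>"
    using counit_contract[OF x(1) fx] counit_contract[OF x(1) one_B] x(3) fx one_B module.smult_one[OF mB]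
    by metis
  finally show ?thesis .
qed

lemma primitive_in_HKer:
  assumes "x \<in> carrier (Prim K A)"
  shows "x \<in> HKer K A B f \<longleftrightarrow> f x = \<zero>\<^bsub>B\<^esub>"
proof -
  have x: "x \<in> carrier A" "comult A x = AA.tens x \<one>\<^bsub>A\<^esub> \<oplus>\<^bsub>AA.T\<^esub> AA.tens \<one>\<^bsub>A\<^esub> x"
    using assms by (simp_all add: Prim_def)
  have fx: "f x \<in> carrier B" by (rule linear_map_closed[OF f_linear x(1)])
  have c1: "counit A \<one>\<^bsub>A\<^esub> = \<one>\<^bsub>K\<^esub>" by (rule ring_hom_memE(4)[OF A.counit_hom])
  have t: "AB.tens x \<one>\<^bsub>B\<^esub> \<in> carrier AB.T" "AB.tens \<one>\<^bsub>A\<^esub> (f x) \<in> carrier AB.T"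
    using x(1) fx one_A one_B by simp_all
  have "tensor_map K A B id f (comult A x) = AB.tens x \<one>\<^bsub>B\<^esub> \<oplus>\<^bsub>AB.T\<^esub> AB.tens \<one>\<^bsub>A\<^esub> (f x)"
    unfolding x(2) using x(1) one_A
    by (simp add: linear_map_add[OF tensor_map_linear[OF mA mB mA mA linear_map_id(1) f_linear]]
        tensor_map_pure[OF mA mB mA mA linear_map_id(1) f_linear] hopf_hom_one[OF f])
  then have "x \<in> HKer K A B f \<longleftrightarrow> AB.tens x \<one>\<^bsub>B\<^esub> \<oplus>\<^bsub>AB.T\<^esub> AB.tens \<one>\<^bsub>A\<^esub> (f x) = AB.tens x \<one>\<^bsub>B\<^esub>"
    using x(1) by (simp add: HKer_def)
  also have "\<dots> \<longleftrightarrow> AB.tens \<one>\<^bsub>A\<^esub> (f x) = \<zero>\<^bsub>AB.T\<^esub>"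
    using t AB.T.add.r_cancel_one by (metis AB.T.a_comm AB.T.r_zero AB.T.add.l_cancel_one)
  also have "\<dots> \<longleftrightarrow> f x = \<zero>\<^bsub>B\<^esub>"
  proof
    assume z: "AB.tens \<one>\<^bsub>A\<^esub> (f x) = \<zero>\<^bsub>AB.T\<^esub>"
    have "\<zero>\<^bsub>AB.T\<^esub> = AB.tens \<one>\<^bsub>A\<^esub> \<zero>\<^bsub>B\<^esub>" using AB.tens_zero_right[OF one_A] by simp
    then have "AB.tens \<one>\<^bsub>A\<^esub> (f x) = AB.tens \<one>\<^bsub>A\<^esub> \<zero>\<^bsub>B\<^esub>" using z by simp
    then have "counit A \<one>\<^bsub>A\<^esub> \<odot>\<^bsub>B\<^esub> f x = counit A \<one>\<^bsub>A\<^esub> \<odot>\<^bsub>B\<^esub> \<zero>\<^bsub>B\<^esub>"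
      using counit_contract[OF one_A fx] counit_contract[OF one_A abelian_groupE(2)[OF module.axioms(2)[OF mB]]] by simp
    then show "f x = \<zero>\<^bsub>B\<^esub>" using fx by (simp add: c1)
  qed (simp add: AB.tens_zero_right one_A)
  finally show ?thesis .
qed

end

section \<open>Subcoalgebras and intersections of Hopf kernels\<close>

text \<open>
  The intersection is the common kernel of the maps \<open>\<phi>\<^sub>j\<close>, each of which annihilates the right factors
  of \<open>\<delta>(x)\<close>; cocommutativity makes \<open>\<delta>(x)\<close> a symmetric tensor.
\<close>

lemma HKer_Inter_subcoalgebra:
  fixes A :: "('k, 'a) hopf" and B :: "('k, 'b) hopf"
  assumes A: "cocomm_hopf K A" and B: "cocomm_hopf K B" and J: "J \<noteq> {}"
    and f: "\<And>j. j \<in> J \<Longrightarrow> f j \<in> hopf_hom K A B"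
    and D: "D = (\<Inter>j\<in>J. HKer K A B (f j))"
  shows "submodule D K A"
    and "x \<in> D \<Longrightarrow> \<exists>s\<in>carrier (tensor_module K (A\<lparr>carrier := D\<rparr>) (A\<lparr>carrier := D\<rparr>)).
      tensor_map K A A id id s = comult A x"
    and "\<one>\<^bsub>A\<^esub> \<in> D"
proof -
  note mA = cocomm_hopf_module[OF A] and mB = cocomm_hopf_module[OF B]
  interpret A: cocomm_hopf K A by (rule A)
  interpret AB: tensor_pair K A B by (rule tensor_pair_intro[OF mA mB])
  have hm: "hopf_map K A B (f j)" if "j \<in> J" for j
    using A B f[OF that] by (simp add: hopf_map_def hopf_map_axioms_def)
  let ?\<phi> = "\<lambda>j. hopf_map.ker_map K A B (f j)"
  have lin: "linear_map K A AB.T (?\<phi> j)" if "j \<in> J" for j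
    by (rule hopf_map.ker_map_linear[OF hm[OF that]])
  have Deq: "D = {x \<in> carrier A. \<forall>j\<in>J. ?\<phi> j x = \<zero>\<^bsub>AB.T\<^esub>}"
    unfolding D using J by (auto simp: hopf_map.HKer_iff[OF hm])
  have mem: "x \<in> D \<longleftrightarrow> x \<in> carrier A \<and> (\<forall>j\<in>J. ?\<phi> j x = \<zero>\<^bsub>AB.T\<^esub>)" for x
    unfolding Deq by simp
  show sub: "submodule D K A"
  proof (rule module.submoduleI[OF mA])
    show "D \<subseteq> carrier A" unfolding Deq by (rule Collect_restrict)
    show "\<zero>\<^bsub>A\<^esub> \<in> D" by (simp add: mem linear_map_zero[OF lin mA AB.T_module])
    fix x assume x: "x \<in> D"
    then show "\<ominus>\<^bsub>A\<^esub> x \<in> D" by (simp add: mem linear_map_neg[OF lin mA AB.T_module])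
    fix y assume "y \<in> D"
    with x show "x \<oplus>\<^bsub>A\<^esub> y \<in> D" by (simp add: mem linear_map_add[OF lin])
  next
    fix c x assume "c \<in> carrier K" "x \<in> D"
    then show "c \<odot>\<^bsub>A\<^esub> x \<in> D" by (simp add: mem linear_map_smult[OF lin])
  qed
  show "\<one>\<^bsub>A\<^esub> \<in> D" unfolding D using hopf_map.one_in_HKer[OF hm] by blast
  show "\<exists>s\<in>carrier (tensor_module K (A\<lparr>carrier := D\<rparr>) (A\<lparr>carrier := D\<rparr>)). tensor_map K A A id id s = comult A x"
    if x: "x \<in> D"
  proof (rule symmetric_tensor_in_kernel[OF A.K.field_axioms mA AB.T_module lin Deq sub])
    have xA: "x \<in> carrier A" using x mem by blast
    show "comult A x \<in> carrier (tensor_module K A A)" by (rule A.comult_closed[OF xA])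
    show "tensor_swap K A (comult A x) = comult A x" by (rule A.cocommutative[OF xA])
    fix j assume j: "j \<in> J"
    then have "x \<in> HKer K A B (f j)" using x D by blast
    then show "tensor_map K A AB.T id (?\<phi> j) (comult A x) = \<zero>\<^bsub>tensor_module K A AB.T\<^esub>"
      by (rule hopf_map.ker_map_comult[OF hm[OF j]])
  qed
qed

lemma hopf_sub_simps:
  "carrier (hopf_sub K H D) = D" "mult (hopf_sub K H D) = mult H" "one (hopf_sub K H D) = one H"
  "zero (hopf_sub K H D) = zero H" "add (hopf_sub K H D) = add H" "smult (hopf_sub K H D) = smult H"
  "counit (hopf_sub K H D) = counit H"
  "comult (hopf_sub K H D) = (\<lambda>x. inv_into (carrier (tensor_module K (H\<lparr>carrier := D\<rparr>) (H\<lparr>carrier := D\<rparr>)))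
     (tensor_map K H H id id) (comult H x))"
  by (simp_all add: hopf_sub_def Let_def)

lemma hopf_sub_tensor:
  "pure_tensor K (hopf_sub K H D) (hopf_sub K H D) = pure_tensor K (H\<lparr>carrier := D\<rparr>) (H\<lparr>carrier := D\<rparr>)"
  "tensor_module K (hopf_sub K H D) (hopf_sub K H D) = tensor_module K (H\<lparr>carrier := D\<rparr>) (H\<lparr>carrier := D\<rparr>)"
proof -
  have r: "bilinear_rels K (hopf_sub K H D) (hopf_sub K H D) =
      bilinear_rels K (H\<lparr>carrier := D\<rparr>) (H\<lparr>carrier := D\<rparr>)"
    unfolding bilinear_rels_def by (simp add: hopf_sub_simps)
  then have k: "tensor_kernel K (hopf_sub K H D) (hopf_sub K H D) =
      tensor_kernel K (H\<lparr>carrier := D\<rparr>) (H\<lparr>carrier := D\<rparr>)"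
    unfolding tensor_kernel_def by (simp add: hopf_sub_simps)
  show "pure_tensor K (hopf_sub K H D) (hopf_sub K H D) = pure_tensor K (H\<lparr>carrier := D\<rparr>) (H\<lparr>carrier := D\<rparr>)"
    unfolding pure_tensor_def k by (simp add: hopf_sub_simps)
  show "tensor_module K (hopf_sub K H D) (hopf_sub K H D) = tensor_module K (H\<lparr>carrier := D\<rparr>) (H\<lparr>carrier := D\<rparr>)"
    unfolding tensor_module_def k by (simp add: hopf_sub_simps)
qed

text \<open>
  The coproduct of \<open>hopf_sub\<close> is a chosen preimage of \<open>\<delta>(x)\<close> under \<open>D \<otimes> D \<rightarrow> H \<otimes> H\<close>, which is meaningful
  only if a preimage exists; this is the second assumption.
\<close>

locale subcoalgebra = cocomm_hopf K H
  for K :: "('k, 'z) ring_scheme" and H :: "('k, 'a) hopf" +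
  fixes D
  assumes sub: "submodule D K H"
    and comult_restricts: "x \<in> D \<Longrightarrow> \<exists>s\<in>carrier (tensor_module K (H\<lparr>carrier := D\<rparr>) (H\<lparr>carrier := D\<rparr>)).
      tensor_map K H H id id s = comult H x"
begin

abbreviation "S \<equiv> H\<lparr>carrier := D\<rparr>"

interpretation HH: tensor_pair K H H by (rule tensor_pair_intro[OF module_H module_H])

lemma module_S: "module K S" by (rule submodule.submodule_is_module[OF sub module_H])

interpretation SS: tensor_pair K S S by (rule tensor_pair_intro[OF module_S module_S])

lemmas inc_linear = submodule_inclusion_linear[OF module_H sub]

lemma D_subset: "D \<subseteq> carrier H" by (rule module.submoduleE(1)[OF module_H sub])

text \<open>
  Since \<open>D \<otimes> D \<rightarrow> H \<otimes> H\<close> is injective, an equation for the coproduct of \<open>D\<close> may be checked in \<open>H \<otimes> H\<close>.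
\<close>

lemma comult_sub_iff:
  assumes x: "x \<in> D" and t: "t \<in> carrier SS.T"
  shows "comult (hopf_sub K H D) x = t \<longleftrightarrow> comult H x = tensor_map K H H id id t"
proof -
  note inj = tensor_inclusion_inj[OF K.field_axioms module_H sub]
  obtain s where s: "s \<in> carrier SS.T" "tensor_map K H H id id s = comult H x"
    using comult_restricts[OF x] by blast
  have "comult (hopf_sub K H D) x = s"
    unfolding hopf_sub_simps s(2)[symmetric] by (rule inv_into_f_f[OF inj s(1)])
  then show ?thesis using s inj_onD[OF inj _ s(1) t] by auto
qed

lemma inc_pure: "\<lbrakk>x \<in> D; y \<in> D\<rbrakk> \<Longrightarrow> tensor_map K H H id id (SS.tens x y) = HH.tens x y"
  using tensor_map_pure[OF module_H module_H module_S module_S inc_linear inc_linear, of x y] by simp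

lemma Gl_sub: "carrier (Gl K (hopf_sub K H D)) = D \<inter> carrier (Gl K H)"
proof -
  have "comult (hopf_sub K H D) x = SS.tens x x \<longleftrightarrow> comult H x = HH.tens x x" if x: "x \<in> D" for x
    using comult_sub_iff[OF x SS.tens_closed] inc_pure[OF x x] x by simp
  then show ?thesis
    using D_subset by (auto simp: Gl_def hopf_sub_simps(1-7) hopf_sub_tensor)
qed

lemma Prim_sub:
  assumes one: "\<one>\<^bsub>H\<^esub> \<in> D"
  shows "carrier (Prim K (hopf_sub K H D)) = D \<inter> carrier (Prim K H)"
proof -
  have "comult (hopf_sub K H D) x = SS.tens x \<one>\<^bsub>H\<^esub> \<oplus>\<^bsub>SS.T\<^esub> SS.tens \<one>\<^bsub>H\<^esub> x \<longleftrightarrow>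
      comult H x = HH.tens x \<one>\<^bsub>H\<^esub> \<oplus>\<^bsub>HH.T\<^esub> HH.tens \<one>\<^bsub>H\<^esub> x" if x: "x \<in> D" for x
  proof -
    have t: "SS.tens x \<one>\<^bsub>H\<^esub> \<in> carrier SS.T" "SS.tens \<one>\<^bsub>H\<^esub> x \<in> carrier SS.T" using x one by simp_all
    show ?thesis
      using comult_sub_iff[OF x SS.T.a_closed[OF t]] inc_pure[OF x one] inc_pure[OF one x]
        linear_map_add[OF tensor_map_linear[OF module_H module_H module_S module_S inc_linear inc_linear] t]
      by simp
  qed
  then show ?thesis
    using D_subset by (auto simp: Prim_def hopf_sub_simps(1-7) hopf_sub_tensor)
qed

end

section \<open>Functors applied degreewise\<close>

lemma is_categoryD:
  assumes "is_category C"
  shows "A \<in> ob C \<Longrightarrow> idt C A \<in> hm C A A"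
    and "\<lbrakk>A \<in> ob C; B \<in> ob C; D \<in> ob C; f \<in> hm C A B; g \<in> hm C B D\<rbrakk> \<Longrightarrow> cmp C A B D g f \<in> hm C A D"
    and "\<lbrakk>A \<in> ob C; B \<in> ob C; f \<in> hm C A B\<rbrakk> \<Longrightarrow> cmp C A A B f (idt C A) = f"
    and "\<lbrakk>A \<in> ob C; B \<in> ob C; f \<in> hm C A B\<rbrakk> \<Longrightarrow> cmp C A B B (idt C B) f = f"
    and "\<lbrakk>A \<in> ob C; B \<in> ob C; D \<in> ob C; E \<in> ob C; f \<in> hm C A B; g \<in> hm C B D; h \<in> hm C D E\<rbrakk> \<Longrightarrow>
       cmp C A D E h (cmp C A B D g f) = cmp C A B E (cmp C B D E h g) f"
  using assms unfolding is_category_def by simp_all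

lemma is_functorD:
  assumes "is_functor C D F Fm"
  shows "is_category C" "is_category D"
    and "A \<in> ob C \<Longrightarrow> F A \<in> ob D"
    and "\<lbrakk>A \<in> ob C; B \<in> ob C; f \<in> hm C A B\<rbrakk> \<Longrightarrow> Fm A B f \<in> hm D (F A) (F B)"
    and "A \<in> ob C \<Longrightarrow> Fm A A (idt C A) = idt D (F A)"
    and "\<lbrakk>A \<in> ob C; B \<in> ob C; E \<in> ob C; f \<in> hm C A B; g \<in> hm C B E\<rbrakk> \<Longrightarrow>
       cmp D (F A) (F B) (F E) (Fm B E g) (Fm A B f) = Fm A E (cmp C A B E g f)"
  using assms unfolding is_functor_def by simp_all

lemma simplicial_objectD:
  assumes "simplicial_object C X"
  shows "lvl X n \<in> ob C"
    and "i \<le> Suc n \<Longrightarrow> face X n i \<in> hm C (lvl X (Suc n)) (lvl X n)"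
    and "j \<le> n \<Longrightarrow> degen X n j \<in> hm C (lvl X n) (lvl X (Suc n))"
  using assms unfolding simplicial_object_def Let_def by simp_all

lemma degreewise_simplicial_object:
  assumes Fun: "is_functor C D F Fm" and X: "simplicial_object C X"
  shows "simplicial_object D (degreewise F Fm X)"
proof -
  note F = is_functorD[OF Fun]
  note u = X[unfolded simplicial_object_def Let_def]
  note ob = u[THEN conjunct1, rule_format] and u1 = u[THEN conjunct2]
  note face = u1[THEN conjunct1, rule_format] and u2 = u1[THEN conjunct2]
  note degen = u2[THEN conjunct1, rule_format] and u3 = u2[THEN conjunct2]
  note dd = u3[THEN conjunct1, rule_format, OF conjI] and u4 = u3[THEN conjunct2]
  note ss = u4[THEN conjunct1, rule_format, OF conjI] and u5 = u4[THEN conjunct2]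
  note ds1 = u5[THEN conjunct1, rule_format, OF conjI] and u6 = u5[THEN conjunct2]
  note ds2 = u6[THEN conjunct1, rule_format, THEN conjunct1] u6[THEN conjunct1, rule_format, THEN conjunct2]
    and u7 = u6[THEN conjunct2]
  note ds3 = u7[rule_format, OF conjI]
  have sel: "lvl (degreewise F Fm X) = (\<lambda>n. F (lvl X n))"
    "face (degreewise F Fm X) = (\<lambda>n i. Fm (lvl X (Suc n)) (lvl X n) (face X n i))"
    "degen (degreewise F Fm X) = (\<lambda>n j. Fm (lvl X n) (lvl X (Suc n)) (degen X n j))"
    by (simp_all add: degreewise_def)
  show ?thesis
    unfolding simplicial_object_def Let_def sel
  proof (intro conjI allI impI; (elim conjE)?)
    fix n i j :: nat
    show "F (lvl X n) \<in> ob D" by (rule F(3)[OF ob])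
    show "Fm (lvl X (Suc n)) (lvl X n) (face X n i) \<in> hm D (F (lvl X (Suc n))) (F (lvl X n))" if "i \<le> Suc n"
      by (rule F(4)[OF ob ob face[OF that]])
    show "Fm (lvl X n) (lvl X (Suc n)) (degen X n j) \<in> hm D (F (lvl X n)) (F (lvl X (Suc n)))" if "j \<le> n"
      by (rule F(4)[OF ob ob degen[OF that]])
  next
    fix n i j :: nat assume ij: "i < j" "j \<le> Suc (Suc n)"
    have le: "i \<le> Suc n" "j - 1 \<le> Suc n" "i \<le> Suc (Suc n)" using ij by linarith+
    show "cmp D (F (lvl X (Suc (Suc n)))) (F (lvl X (Suc n))) (F (lvl X n))
          (Fm (lvl X (Suc n)) (lvl X n) (face X n i)) (Fm (lvl X (Suc (Suc n))) (lvl X (Suc n)) (face X (Suc n) j)) =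
        cmp D (F (lvl X (Suc (Suc n)))) (F (lvl X (Suc n))) (F (lvl X n))
          (Fm (lvl X (Suc n)) (lvl X n) (face X n (j - 1))) (Fm (lvl X (Suc (Suc n))) (lvl X (Suc n)) (face X (Suc n) i))"
      using dd[OF ij] by (simp only: F(6)[OF ob ob ob face face] ij le)
  next
    fix n i j :: nat assume ij: "i \<le> j" "j \<le> n"
    have le: "i \<le> n" "i \<le> Suc n" "Suc j \<le> Suc n" using ij by linarith+
    show "cmp D (F (lvl X n)) (F (lvl X (Suc n))) (F (lvl X (Suc (Suc n))))
          (Fm (lvl X (Suc n)) (lvl X (Suc (Suc n))) (degen X (Suc n) i)) (Fm (lvl X n) (lvl X (Suc n)) (degen X n j)) =
        cmp D (F (lvl X n)) (F (lvl X (Suc n))) (F (lvl X (Suc (Suc n))))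
          (Fm (lvl X (Suc n)) (lvl X (Suc (Suc n))) (degen X (Suc n) (Suc j))) (Fm (lvl X n) (lvl X (Suc n)) (degen X n i))"
      using ss[OF ij] by (simp only: F(6)[OF ob ob ob degen degen] ij le)
  next
    fix n i j :: nat assume ij: "i < j" "j \<le> Suc n"
    have le: "i \<le> Suc n" "i \<le> Suc (Suc n)" "j - 1 \<le> n" using ij by linarith+
    show "cmp D (F (lvl X (Suc n))) (F (lvl X (Suc (Suc n)))) (F (lvl X (Suc n)))
          (Fm (lvl X (Suc (Suc n))) (lvl X (Suc n)) (face X (Suc n) i)) (Fm (lvl X (Suc n)) (lvl X (Suc (Suc n))) (degen X (Suc n) j)) =
        cmp D (F (lvl X (Suc n))) (F (lvl X n)) (F (lvl X (Suc n)))
          (Fm (lvl X n) (lvl X (Suc n)) (degen X n (j - 1))) (Fm (lvl X (Suc n)) (lvl X n) (face X n i))"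
      using ds1[OF ij] by (simp only: F(6)[OF ob ob ob degen face] F(6)[OF ob ob ob face degen] ij le)
  next
    fix n j :: nat assume j: "j \<le> n"
    have le: "j \<le> Suc n" "Suc j \<le> Suc n" using j by linarith+
    show "cmp D (F (lvl X n)) (F (lvl X (Suc n))) (F (lvl X n))
        (Fm (lvl X (Suc n)) (lvl X n) (face X n j)) (Fm (lvl X n) (lvl X (Suc n)) (degen X n j)) = idt D (F (lvl X n))"
      using ds2(1)[OF j] by (simp only: F(6)[OF ob ob ob degen face] F(5)[OF ob] j le)
    show "cmp D (F (lvl X n)) (F (lvl X (Suc n))) (F (lvl X n))
        (Fm (lvl X (Suc n)) (lvl X n) (face X n (Suc j))) (Fm (lvl X n) (lvl X (Suc n)) (degen X n j)) = idt D (F (lvl X n))"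
      using ds2(2)[OF j] by (simp only: F(6)[OF ob ob ob degen face] F(5)[OF ob] j le)
  next
    fix n i j :: nat assume ij: "Suc j < i" "i \<le> Suc (Suc n)"
    have le: "j \<le> n" "j \<le> Suc n" "i - 1 \<le> Suc n" using ij by linarith+
    show "cmp D (F (lvl X (Suc n))) (F (lvl X (Suc (Suc n)))) (F (lvl X (Suc n)))
          (Fm (lvl X (Suc (Suc n))) (lvl X (Suc n)) (face X (Suc n) i)) (Fm (lvl X (Suc n)) (lvl X (Suc (Suc n))) (degen X (Suc n) j)) =
        cmp D (F (lvl X (Suc n))) (F (lvl X n)) (F (lvl X (Suc n)))
          (Fm (lvl X n) (lvl X (Suc n)) (degen X n j)) (Fm (lvl X (Suc n)) (lvl X n) (face X n (i - 1)))"
      using ds3[OF ij] by (simp only: F(6)[OF ob ob ob degen face] F(6)[OF ob ob ob face degen] ij le)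
  qed
qed

lemma simplicial_homD:
  assumes "f \<in> simplicial_hom C X Y"
  shows "f n \<in> hm C (lvl X n) (lvl Y n)"
    and "i \<le> Suc n \<Longrightarrow> cmp C (lvl X (Suc n)) (lvl X n) (lvl Y n) (f n) (face X n i) =
       cmp C (lvl X (Suc n)) (lvl Y (Suc n)) (lvl Y n) (face Y n i) (f (Suc n))"
    and "j \<le> n \<Longrightarrow> cmp C (lvl X n) (lvl X (Suc n)) (lvl Y (Suc n)) (f (Suc n)) (degen X n j) =
       cmp C (lvl X n) (lvl Y n) (lvl Y (Suc n)) (degen Y n j) (f n)"
  using assms unfolding simplicial_hom_def by simp_all

lemma simplicial_homI:
  assumes "\<And>n. f n \<in> hm C (lvl X n) (lvl Y n)"
    and "\<And>n i. i \<le> Suc n \<Longrightarrow> cmp C (lvl X (Suc n)) (lvl X n) (lvl Y n) (f n) (face X n i) =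
       cmp C (lvl X (Suc n)) (lvl Y (Suc n)) (lvl Y n) (face Y n i) (f (Suc n))"
    and "\<And>n j. j \<le> n \<Longrightarrow> cmp C (lvl X n) (lvl X (Suc n)) (lvl Y (Suc n)) (f (Suc n)) (degen X n j) =
       cmp C (lvl X n) (lvl Y n) (lvl Y (Suc n)) (degen Y n j) (f n)"
  shows "f \<in> simplicial_hom C X Y"
  using assms unfolding simplicial_hom_def by simp

text \<open>
  Used with faces and with degeneracies as vertical arrows, to see that simplicial maps compose.
\<close>

lemma square_paste:
  assumes C: "is_category C" and ob: "A \<in> ob C" "B \<in> ob C" "D \<in> ob C" "A' \<in> ob C" "B' \<in> ob C" "D' \<in> ob C"
    and f: "f \<in> hm C A B" "f' \<in> hm C A' B'" and g: "g \<in> hm C B D" "g' \<in> hm C B' D'"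
    and v: "a \<in> hm C A A'" "b \<in> hm C B B'" "d \<in> hm C D D'"
    and eq: "cmp C A A' B' f' a = cmp C A B B' b f" "cmp C B B' D' g' b = cmp C B D D' d g"
  shows "cmp C A A' D' (cmp C A' B' D' g' f') a = cmp C A D D' d (cmp C A B D g f)"
proof -
  note assoc = is_categoryD(5)[OF C]
  have "cmp C A A' D' (cmp C A' B' D' g' f') a = cmp C A B' D' g' (cmp C A A' B' f' a)"
    using assms by (intro assoc[symmetric]) simp_all
  also have "\<dots> = cmp C A B D' (cmp C B B' D' g' b) f"
    unfolding eq(1) using assms by (intro assoc) simp_all
  also have "\<dots> = cmp C A D D' d (cmp C A B D g f)"
    unfolding eq(2) using assms by (intro assoc[symmetric]) simp_all
  finally show ?thesis .
qed

lemma simp_cat_sel: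
  "ob (simp_cat C) = {X. simplicial_object C X}" "hm (simp_cat C) = simplicial_hom C"
  "idt (simp_cat C) = (\<lambda>X n. idt C (lvl X n))"
  "cmp (simp_cat C) = (\<lambda>X Y Z g f n. cmp C (lvl X n) (lvl Y n) (lvl Z n) (g n) (f n))"
  by (simp_all add: simp_cat_def)

lemma is_category_simp_cat:
  assumes C: "is_category C"
  shows "is_category (simp_cat C)"
  unfolding is_category_def simp_cat_sel mem_Collect_eq Ball_def
proof (intro conjI allI impI)
  note c = is_categoryD[OF C] and so = simplicial_objectD
  fix X assume X: "simplicial_object C X"
  note X' = so[OF X]
  show "(\<lambda>n. idt C (lvl X n)) \<in> simplicial_hom C X X"
    by (rule simplicial_homI) (simp_all add: X' c)
  fix Y assume Y: "simplicial_object C Y"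
  note Y' = so[OF Y]
  {
    fix f assume f: "f \<in> simplicial_hom C X Y"
    show "(\<lambda>n. cmp C (lvl X n) (lvl X n) (lvl Y n) (f n) (idt C (lvl X n))) = f"
      "(\<lambda>n. cmp C (lvl X n) (lvl Y n) (lvl Y n) (idt C (lvl Y n)) (f n)) = f"
      by (simp_all add: X' Y' c simplicial_homD(1)[OF f])
  }
  fix Z assume Z: "simplicial_object C Z"
  note Z' = so[OF Z]
  fix f assume f: "f \<in> simplicial_hom C X Y"
  note f' = simplicial_homD[OF f]
  {
    fix g assume g: "g \<in> simplicial_hom C Y Z"
    note g' = simplicial_homD[OF g]
    show "(\<lambda>n. cmp C (lvl X n) (lvl Y n) (lvl Z n) (g n) (f n)) \<in> simplicial_hom C X Z"
    proof (rule simplicial_homI)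
      fix n i :: nat
      show "cmp C (lvl X n) (lvl Y n) (lvl Z n) (g n) (f n) \<in> hm C (lvl X n) (lvl Z n)"
        by (rule c(2)[OF X'(1) Y'(1) Z'(1) f'(1) g'(1)])
      show "cmp C (lvl X (Suc n)) (lvl X n) (lvl Z n) (cmp C (lvl X n) (lvl Y n) (lvl Z n) (g n) (f n)) (face X n i) =
          cmp C (lvl X (Suc n)) (lvl Z (Suc n)) (lvl Z n) (face Z n i)
            (cmp C (lvl X (Suc n)) (lvl Y (Suc n)) (lvl Z (Suc n)) (g (Suc n)) (f (Suc n)))" if "i \<le> Suc n"
        by (rule square_paste[OF C X'(1) Y'(1) Z'(1) X'(1) Y'(1) Z'(1) f'(1) f'(1) g'(1) g'(1)
              X'(2)[OF that] Y'(2)[OF that] Z'(2)[OF that] f'(2)[OF that] g'(2)[OF that]])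
      show "cmp C (lvl X n) (lvl X (Suc n)) (lvl Z (Suc n))
            (cmp C (lvl X (Suc n)) (lvl Y (Suc n)) (lvl Z (Suc n)) (g (Suc n)) (f (Suc n))) (degen X n i) =
          cmp C (lvl X n) (lvl Z n) (lvl Z (Suc n)) (degen Z n i)
            (cmp C (lvl X n) (lvl Y n) (lvl Z n) (g n) (f n))" if "i \<le> n"
        by (rule square_paste[OF C X'(1) Y'(1) Z'(1) X'(1) Y'(1) Z'(1) f'(1) f'(1) g'(1) g'(1)
              X'(3)[OF that] Y'(3)[OF that] Z'(3)[OF that] f'(3)[OF that] g'(3)[OF that]])
    qed
  }
  fix W assume W: "simplicial_object C W"
  note W' = so[OF W]
  fix g h assume g: "g \<in> simplicial_hom C Y Z" and h: "h \<in> simplicial_hom C Z W"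
  show "(\<lambda>n. cmp C (lvl X n) (lvl Z n) (lvl W n) (h n) (cmp C (lvl X n) (lvl Y n) (lvl Z n) (g n) (f n))) =
      (\<lambda>n. cmp C (lvl X n) (lvl Y n) (lvl W n) (cmp C (lvl Y n) (lvl Z n) (lvl W n) (h n) (g n)) (f n))"
    by (rule ext) (rule c(5)[OF X'(1) Y'(1) Z'(1) W'(1) f'(1) simplicial_homD(1)[OF g] simplicial_homD(1)[OF h]])
qed

lemma is_category_full_subcat: "is_category C \<Longrightarrow> is_category (full_subcat C P)"
  unfolding is_category_def full_subcat_def by simp

lemma degreewise_mor_simplicial_hom:
  assumes Fun: "is_functor C D F Fm" and X: "simplicial_object C X" and Y: "simplicial_object C Y"
    and f: "f \<in> simplicial_hom C X Y"
  shows "degreewise_mor Fm X Y f \<in> simplicial_hom D (degreewise F Fm X) (degreewise F Fm Y)"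
proof -
  note F = is_functorD[OF Fun] and X' = simplicial_objectD[OF X] and Y' = simplicial_objectD[OF Y]
    and f' = simplicial_homD[OF f]
  show ?thesis
  proof (rule simplicial_homI; simp only: degreewise_def degreewise_mor_def simp.simps)
    show "Fm (lvl X n) (lvl Y n) (f n) \<in> hm D (F (lvl X n)) (F (lvl Y n))" for n
      by (rule F(4)[OF X'(1) Y'(1) f'(1)])
    show "cmp D (F (lvl X (Suc n))) (F (lvl X n)) (F (lvl Y n)) (Fm (lvl X n) (lvl Y n) (f n))
           (Fm (lvl X (Suc n)) (lvl X n) (face X n i)) =
        cmp D (F (lvl X (Suc n))) (F (lvl Y (Suc n))) (F (lvl Y n)) (Fm (lvl Y (Suc n)) (lvl Y n) (face Y n i))
           (Fm (lvl X (Suc n)) (lvl Y (Suc n)) (f (Suc n)))" if "i \<le> Suc n" for n i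
      using f'(2)[OF that]
      by (simp only: F(6)[OF X'(1) X'(1) Y'(1) X'(2) f'(1)] F(6)[OF X'(1) Y'(1) Y'(1) f'(1) Y'(2)] that)
    show "cmp D (F (lvl X n)) (F (lvl X (Suc n))) (F (lvl Y (Suc n)))
           (Fm (lvl X (Suc n)) (lvl Y (Suc n)) (f (Suc n))) (Fm (lvl X n) (lvl X (Suc n)) (degen X n j)) =
        cmp D (F (lvl X n)) (F (lvl Y n)) (F (lvl Y (Suc n))) (Fm (lvl Y n) (lvl Y (Suc n)) (degen Y n j))
           (Fm (lvl X n) (lvl Y n) (f n))" if "j \<le> n" for n j
      using f'(3)[OF that]
      by (simp only: F(6)[OF X'(1) X'(1) Y'(1) X'(3) f'(1)] F(6)[OF X'(1) Y'(1) Y'(1) f'(1) Y'(3)] that)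
  qed
qed

lemma degreewise_functor:
  assumes Fun: "is_functor C D F Fm"
    and PQ: "\<And>X. simplicial_object C X \<Longrightarrow> P X \<Longrightarrow> Q (degreewise F Fm X)"
  shows "is_functor (full_subcat (simp_cat C) P) (full_subcat (simp_cat D) Q)
    (degreewise F Fm) (degreewise_mor Fm)"
proof -
  note F = is_functorD[OF Fun]
  have lvl_degreewise: "lvl (degreewise F Fm X) n = F (lvl X n)" for X n
    by (simp add: degreewise_def)
  have sel: "ob (full_subcat (simp_cat C) P) = {X. simplicial_object C X \<and> P X}"
    "hm (full_subcat (simp_cat C) P) = simplicial_hom C"
    "idt (full_subcat (simp_cat C) P) = (\<lambda>X n. idt C (lvl X n))"
    "cmp (full_subcat (simp_cat C) P) = (\<lambda>X Y Z g f n. cmp C (lvl X n) (lvl Y n) (lvl Z n) (g n) (f n))"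
    for C :: "('o, 'm) cat" and P
    by (simp_all add: full_subcat_def simp_cat_sel)
  show ?thesis
    unfolding is_functor_def
  proof (intro conjI ballI)
    show "is_category (full_subcat (simp_cat C) P)" "is_category (full_subcat (simp_cat D) Q)"
      by (intro is_category_full_subcat is_category_simp_cat F)+
  qed (auto simp: sel PQ degreewise_simplicial_object[OF Fun]
      degreewise_mor_simplicial_hom[OF Fun, unfolded degreewise_mor_def] lvl_degreewise
      degreewise_mor_def F simplicial_objectD simplicial_homD(1) intro!: ext)
qed

lemma is_category_concrete:
  assumes hom: "\<And>A B f. f \<in> Hm A B \<Longrightarrow> f \<in> carrier A \<rightarrow> carrier B \<and> f \<in> extensional (carrier A)"
    and id: "\<And>A. A \<in> Ob \<Longrightarrow> restrict id (carrier A) \<in> Hm A A"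
    and comp: "\<And>A B D f g. \<lbrakk>A \<in> Ob; B \<in> Ob; D \<in> Ob; f \<in> Hm A B; g \<in> Hm B D\<rbrakk> \<Longrightarrow> compose (carrier A) g f \<in> Hm A D"
  shows "is_category \<lparr>ob = Ob, hm = Hm, idt = (\<lambda>A. restrict id (carrier A)),
    cmp = (\<lambda>A B D g f. compose (carrier A) g f)\<rparr>"
  unfolding is_category_def cat.simps
proof (intro conjI ballI)
  fix A B f assume "f \<in> Hm A B"
  note f = hom[OF this]
  show "compose (carrier A) f (restrict id (carrier A)) = f"
    "compose (carrier A) (restrict id (carrier B)) f = f"
    using f by (auto simp: compose_def extensional_def Pi_iff intro!: ext)
  fix D E g h assume "g \<in> Hm B D" "h \<in> Hm D E"
  show "compose (carrier A) h (compose (carrier A) g f) = compose (carrier A) (compose (carrier B) h g) f"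
    by (rule compose_assoc) (use f in blast)
qed (rule id comp; assumption)+

section \<open>The functors of group-like and primitive elements\<close>

lemma hopf_hom_id:
  assumes A: "cocomm_hopf K A" shows "restrict id (carrier A) \<in> hopf_hom K A A"
proof -
  note mA = cocomm_hopf_module[OF A]
  interpret A: cocomm_hopf K A by fact
  interpret AA: tensor_pair K A A by (rule tensor_pair_intro[OF mA mA])
  let ?i = "restrict id (carrier A)"
  have "tensor_map K A A ?i ?i t = t" if t: "t \<in> carrier AA.T" for t
  proof -
    have "tensor_map K A A ?i ?i t = tensor_map K A A id id t"
      by (rule tensor_map_cong[OF mA mA mA mA linear_map_id(1) linear_map_id(1) t, symmetric]) simp_all
    also have "\<dots> = t"
      by (rule AA.linear_map_unique[OF tensor_map_linear[OF mA mA mA mA linear_map_id(1) linear_map_id(1)] linear_map_id(2) t])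
        (simp add: tensor_map_pure[OF mA mA mA mA linear_map_id(1) linear_map_id(1)])
    finally show ?thesis .
  qed
  then show ?thesis
    using A.comult_closed ring.ring_simprules(1,5,6)[OF cocomm_hopf_ring[OF A]] A.H.smult_closed
    by (auto simp: hopf_hom_def ring_hom_def)
qed

text \<open>
  Compatibility with the coproducts is functoriality of \<open>f \<mapsto> f \<otimes> f\<close>.
\<close>

lemma hopf_hom_compose:
  assumes A: "cocomm_hopf K A" and B: "cocomm_hopf K B" and C: "cocomm_hopf K C"
    and f: "f \<in> hopf_hom K A B" and g: "g \<in> hopf_hom K B C"
  shows "compose (carrier A) g f \<in> hopf_hom K A C"
proof -
  note m = cocomm_hopf_module[OF A] cocomm_hopf_module[OF B] cocomm_hopf_module[OF C]
  interpret A: cocomm_hopf K A by fact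
  note lf = hopf_hom_linear[OF f] and lg = hopf_hom_linear[OF g]
  note fc = linear_map_closed[OF lf]
  have rf: "f \<in> ring_hom A B" "\<And>x. x \<in> carrier A \<Longrightarrow> comult B (f x) = tensor_map K B B f f (comult A x)"
    "\<And>x. x \<in> carrier A \<Longrightarrow> counit B (f x) = counit A x"
    using f by (simp_all add: hopf_hom_def)
  have rg: "g \<in> ring_hom B C" "\<And>x. x \<in> carrier B \<Longrightarrow> comult C (g x) = tensor_map K C C g g (comult B x)"
    "\<And>x. x \<in> carrier B \<Longrightarrow> counit C (g x) = counit B x"
    using g by (simp_all add: hopf_hom_def)
  let ?h = "compose (carrier A) g f"
  have h: "?h x = g (f x)" if "x \<in> carrier A" for x using that by (simp add: compose_def)
  have cm: "comult C (g (f x)) = tensor_map K C C ?h ?h (comult A x)" if x: "x \<in> carrier A" for x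
  proof -
    note D = A.comult_closed[OF x]
    have "comult C (g (f x)) = tensor_map K C C g g (tensor_map K B B f f (comult A x))"
      by (simp add: rg(2)[OF fc[OF x]] rf(2)[OF x])
    also have "\<dots> = tensor_map K C C (\<lambda>x. g (f x)) (\<lambda>x. g (f x)) (comult A x)"
      by (rule tensor_map_comp[OF m(3,3,2,2,1,1) lf lf lg lg D])
    also have "\<dots> = tensor_map K C C ?h ?h (comult A x)"
      by (rule tensor_map_cong[OF m(3,3,1,1) linear_map_comp[OF lf lg] linear_map_comp[OF lf lg] D]) (simp_all add: h)
    finally show ?thesis .
  qed
  have ring: "?h \<in> ring_hom A C"
    using ring.ring_simprules(1,5,6)[OF cocomm_hopf_ring[OF A]] ring_hom_memE[OF rf(1)] ring_hom_memE[OF rg(1)]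
    by (intro ring_hom_memI) (simp_all add: h)
  have "?h \<in> extensional (carrier A)" by (rule compose_extensional)
  then show ?thesis
    using ring cm rf(3) rg(3) fc linear_map_smult[OF linear_map_comp[OF lf lg]] A.H.smult_closed
    by (simp add: hopf_hom_def h)
qed

lemma is_category_hopf_cat:
  fixes K :: "('k, 'z) ring_scheme"
  shows "is_category (hopf_cat K :: (('k, 'a) hopf, 'a \<Rightarrow> 'a) cat)"
  unfolding hopf_cat_def
proof (rule is_category_concrete)
  fix A :: "('k, 'a) hopf" and B :: "('k, 'a) hopf" and f assume "f \<in> hopf_hom K A B"
  then show "f \<in> carrier A \<rightarrow> carrier B \<and> f \<in> extensional (carrier A)"
    using linear_map_closed[OF hopf_hom_linear[of f K A B]] by (simp add: hopf_hom_def)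
qed (simp_all add: hopf_hom_id hopf_hom_compose)

lemma is_category_grp_cat: "is_category grp_cat"
  unfolding grp_cat_def
proof (rule is_category_concrete)
  fix A :: "'a monoid" assume "A \<in> {G. group G}"
  then interpret group A by simp
  show "restrict id (carrier A) \<in> hom A A \<inter> extensional (carrier A)" by (simp add: hom_def)
next
  fix A B D :: "'a monoid" and f g
  assume A: "A \<in> {G. group G}" and f: "f \<in> hom A B \<inter> extensional (carrier A)"
    and g: "g \<in> hom B D \<inter> extensional (carrier B)"
  interpret group A using A by simp
  show "compose (carrier A) g f \<in> hom A D \<inter> extensional (carrier A)"
    using f g by (auto simp: hom_def compose_def Pi_iff extensional_def)
qed (simp add: hom_def)

lemma is_category_lie_cat:
  fixes K :: "('k, 'z) ring_scheme"
  shows "is_category (lie_cat K :: (('k, 'a) lie, 'a \<Rightarrow> 'a) cat)"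
  unfolding lie_cat_def
proof (rule is_category_concrete)
  fix A :: "('k, 'a) lie" assume "A \<in> {L. lie_algebra K L}"
  then interpret A: lie_algebra K A by simp
  show "restrict id (carrier A) \<in> lie_hom K A A"
    by (simp add: lie_hom_def A.bracket_closed)
next
  fix A B D :: "('k, 'a) lie" and f g
  assume A: "A \<in> {L. lie_algebra K L}" and f: "f \<in> lie_hom K A B" and g: "g \<in> lie_hom K B D"
  interpret A: lie_algebra K A using A by simp
  have fc: "x \<in> carrier A \<Longrightarrow> f x \<in> carrier B" for x using f by (auto simp: lie_hom_def)
  have gc: "x \<in> carrier B \<Longrightarrow> g x \<in> carrier D" for x using g by (auto simp: lie_hom_def)
  show "compose (carrier A) g f \<in> lie_hom K A D"
    using f g by (simp add: lie_hom_def compose_def A.bracket_closed fc gc)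
qed (auto simp: lie_hom_def PiE_iff)

lemma Gl_mor_hom:
  assumes A: "cocomm_hopf K A" and B: "cocomm_hopf K B" and f: "f \<in> hopf_hom K A B"
  shows "Gl_mor K A B f \<in> hom (Gl K A) (Gl K B)"
proof -
  note mA = cocomm_hopf_module[OF A] and mB = cocomm_hopf_module[OF B]
  interpret GA: group "Gl K A" by (rule cocomm_hopf.Gl_group[OF A])
  note lf = hopf_hom_linear[OF f]
  have rf: "f \<in> ring_hom A B" "\<And>x. x \<in> carrier A \<Longrightarrow> comult B (f x) = tensor_map K B B f f (comult A x)"
    "\<And>x. x \<in> carrier A \<Longrightarrow> counit B (f x) = counit A x"
    using f by (simp_all add: hopf_hom_def)
  have fG: "f x \<in> carrier (Gl K B)" if "x \<in> carrier (Gl K A)" for x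
    using that linear_map_closed[OF lf] tensor_map_pure[OF mB mB mA mA lf lf] rf(2,3)
    by (simp add: Gl_def)
  show ?thesis
  proof (rule homI)
    fix x assume x: "x \<in> carrier (Gl K A)"
    then show "Gl_mor K A B f x \<in> carrier (Gl K B)" using fG by (simp add: Gl_mor_def)
    fix y assume y: "y \<in> carrier (Gl K A)"
    have "x \<otimes>\<^bsub>Gl K A\<^esub> y \<in> carrier (Gl K A)" using x y by simp
    moreover have "f (x \<otimes>\<^bsub>A\<^esub> y) = f x \<otimes>\<^bsub>B\<^esub> f y"
      using x y ring_hom_memE(2)[OF rf(1)] by (simp add: Gl_def)
    ultimately show "Gl_mor K A B f (x \<otimes>\<^bsub>Gl K A\<^esub> y) = Gl_mor K A B f x \<otimes>\<^bsub>Gl K B\<^esub> Gl_mor K A B f y"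
      using x y by (simp add: Gl_mor_def Gl_def)
  qed
qed

lemma Prim_mor_hom:
  assumes A: "cocomm_hopf K A" and B: "cocomm_hopf K B" and f: "f \<in> hopf_hom K A B"
  shows "Prim_mor K A B f \<in> lie_hom K (Prim K A) (Prim K B)"
proof -
  note mA = cocomm_hopf_module[OF A] and mB = cocomm_hopf_module[OF B]
  interpret A: cocomm_hopf K A by fact
  interpret B: cocomm_hopf K B by fact
  interpret AA: tensor_pair K A A by (rule tensor_pair_intro[OF mA mA])
  note lf = hopf_hom_linear[OF f]
  have rf: "f \<in> ring_hom A B" "\<And>x. x \<in> carrier A \<Longrightarrow> comult B (f x) = tensor_map K B B f f (comult A x)"
    using f by (simp_all add: hopf_hom_def)
  have one: "\<one>\<^bsub>A\<^esub> \<in> carrier A" by (rule ring.ring_simprules(6)[OF cocomm_hopf_ring[OF A]])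
  have PA: "x \<in> carrier A" if "x \<in> carrier (Prim K A)" for x using that by (simp add: Prim_def)
  have fP: "f x \<in> carrier (Prim K B)" if x: "x \<in> carrier (Prim K A)" for x
  proof -
    have xA: "x \<in> carrier A" and D: "comult A x = AA.tens x \<one>\<^bsub>A\<^esub> \<oplus>\<^bsub>AA.T\<^esub> AA.tens \<one>\<^bsub>A\<^esub> x"
      using x by (simp_all add: Prim_def)
    have "comult B (f x) = pure_tensor K B B (f x) \<one>\<^bsub>B\<^esub> \<oplus>\<^bsub>tensor_module K B B\<^esub> pure_tensor K B B \<one>\<^bsub>B\<^esub> (f x)"
      unfolding rf(2)[OF xA] D using xA one
      by (simp add: linear_map_add[OF tensor_map_linear[OF mB mB mA mA lf lf]]
          tensor_map_pure[OF mB mB mA mA lf lf] hopf_hom_one[OF f])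
    then show ?thesis using linear_map_closed[OF lf xA] by (simp add: Prim_def)
  qed
  have ops: "x \<oplus>\<^bsub>Prim K A\<^esub> y = x \<oplus>\<^bsub>A\<^esub> y" "c \<odot>\<^bsub>Prim K A\<^esub> x = c \<odot>\<^bsub>A\<^esub> x"
    "bracket (Prim K A) x y = A.comm x y" for x y c by (simp_all add: Prim_def)
  have opsB: "x \<oplus>\<^bsub>Prim K B\<^esub> y = x \<oplus>\<^bsub>B\<^esub> y" "c \<odot>\<^bsub>Prim K B\<^esub> x = c \<odot>\<^bsub>B\<^esub> x"
    "bracket (Prim K B) x y = B.comm x y" for x y c by (simp_all add: Prim_def)
  have m1: "\<ominus>\<^bsub>K\<^esub> \<one>\<^bsub>K\<^esub> \<in> carrier K" by simp
  have mult: "x \<otimes>\<^bsub>A\<^esub> y \<in> carrier A" "f (x \<otimes>\<^bsub>A\<^esub> y) = f x \<otimes>\<^bsub>B\<^esub> f y"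
    if "x \<in> carrier A" "y \<in> carrier A" for x y
    using that ring_hom_memE(2)[OF rf(1)] by simp_all
  have br: "f (A.comm x y) = B.comm (f x) (f y)" if xy: "x \<in> carrier A" "y \<in> carrier A" for x y
    using xy m1 mult A.H.smult_closed[OF m1]
    by (simp add: linear_map_add[OF lf] linear_map_smult[OF lf])
  have cl: "x \<oplus>\<^bsub>A\<^esub> y \<in> carrier (Prim K A)" "A.comm x y \<in> carrier (Prim K A)"
    if "x \<in> carrier (Prim K A)" "y \<in> carrier (Prim K A)" for x y
    by (rule module.submoduleE(5)[OF mA A.Prim_submodule that] A.Prim_comm_closed[OF that])+
  have cl2: "c \<odot>\<^bsub>A\<^esub> x \<in> carrier (Prim K A)" if "c \<in> carrier K" "x \<in> carrier (Prim K A)" for c x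
    by (rule module.submoduleE(4)[OF mA A.Prim_submodule that])
  show ?thesis
    unfolding lie_hom_def Prim_mor_def ops opsB
    using fP cl cl2 br PA linear_map_add[OF lf] linear_map_smult[OF lf]
    by (auto simp del: A.H.smult_l_minus)
qed

lemma Gl_functor:
  fixes K :: "('k, 'z) ring_scheme"
  shows "is_functor (hopf_cat K :: (('k, 'a) hopf, 'a \<Rightarrow> 'a) cat) grp_cat (Gl K) (Gl_mor K)"
  unfolding is_functor_def
proof (intro conjI ballI)
  show "is_category (hopf_cat K :: (('k, 'a) hopf, 'a \<Rightarrow> 'a) cat)" "is_category grp_cat"
    by (rule is_category_hopf_cat is_category_grp_cat)+
  fix A :: "('k, 'a) hopf" assume "A \<in> ob (hopf_cat K)"
  then have A: "cocomm_hopf K A" by (simp add: hopf_cat_def)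
  have sub: "carrier (Gl K A) \<subseteq> carrier A" by (auto simp: Gl_def)
  show "Gl K A \<in> ob grp_cat" by (simp add: grp_cat_def cocomm_hopf.Gl_group[OF A])
  show "Gl_mor K A A (idt (hopf_cat K) A) = idt grp_cat (Gl K A)"
    using sub by (auto simp: hopf_cat_def grp_cat_def Gl_mor_def restrict_def intro!: ext)
  fix B :: "('k, 'a) hopf" assume "B \<in> ob (hopf_cat K)"
  then have B: "cocomm_hopf K B" by (simp add: hopf_cat_def)
  {
    fix f assume "f \<in> hm (hopf_cat K) A B"
    then have f: "f \<in> hopf_hom K A B" by (simp add: hopf_cat_def)
    show "Gl_mor K A B f \<in> hm grp_cat (Gl K A) (Gl K B)"
      by (simp add: grp_cat_def Gl_mor_hom[OF A B f]) (simp add: Gl_mor_def)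
  }
  fix D :: "('k, 'a) hopf" and f g assume "f \<in> hm (hopf_cat K) A B"
  then have f: "f \<in> hopf_hom K A B" by (simp add: hopf_cat_def)
  have "f x \<in> carrier (Gl K B)" if "x \<in> carrier (Gl K A)" for x
    using hom_in_carrier[OF Gl_mor_hom[OF A B f] that] that by (simp add: Gl_mor_def)
  then show "Gl_mor K A D (cmp (hopf_cat K) A B D g f) =
      cmp grp_cat (Gl K A) (Gl K B) (Gl K D) (Gl_mor K B D g) (Gl_mor K A B f)"
    using sub by (auto simp: hopf_cat_def grp_cat_def Gl_mor_def compose_def restrict_def intro!: ext)
qed

lemma Prim_functor:
  fixes K :: "('k, 'z) ring_scheme"
  shows "is_functor (hopf_cat K :: (('k, 'a) hopf, 'a \<Rightarrow> 'a) cat) (lie_cat K) (Prim K) (Prim_mor K)"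
  unfolding is_functor_def
proof (intro conjI ballI)
  show "is_category (hopf_cat K :: (('k, 'a) hopf, 'a \<Rightarrow> 'a) cat)" "is_category (lie_cat K)"
    by (rule is_category_hopf_cat is_category_lie_cat)+
  fix A :: "('k, 'a) hopf" assume "A \<in> ob (hopf_cat K)"
  then have A: "cocomm_hopf K A" by (simp add: hopf_cat_def)
  have sub: "carrier (Prim K A) \<subseteq> carrier A" by (auto simp: Prim_def)
  show "Prim K A \<in> ob (lie_cat K)" by (simp add: lie_cat_def cocomm_hopf.Prim_lie_algebra[OF A])
  show "Prim_mor K A A (idt (hopf_cat K) A) = idt (lie_cat K) (Prim K A)"
    using sub by (auto simp: hopf_cat_def lie_cat_def Prim_mor_def restrict_def intro!: ext)
  fix B :: "('k, 'a) hopf" assume "B \<in> ob (hopf_cat K)"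
  then have B: "cocomm_hopf K B" by (simp add: hopf_cat_def)
  {
    fix f assume "f \<in> hm (hopf_cat K) A B"
    then have f: "f \<in> hopf_hom K A B" by (simp add: hopf_cat_def)
    show "Prim_mor K A B f \<in> hm (lie_cat K) (Prim K A) (Prim K B)"
      by (simp add: lie_cat_def Prim_mor_hom[OF A B f])
  }
  fix D :: "('k, 'a) hopf" and f g assume "f \<in> hm (hopf_cat K) A B"
  then have f: "f \<in> hopf_hom K A B" by (simp add: hopf_cat_def)
  have "f x \<in> carrier (Prim K B)" if "x \<in> carrier (Prim K A)" for x
  proof -
    have "Prim_mor K A B f \<in> carrier (Prim K A) \<rightarrow>\<^sub>E carrier (Prim K B)"
      using Prim_mor_hom[OF A B f] by (simp add: lie_hom_def)
    from PiE_mem[OF this that] show ?thesis using that by (simp add: Prim_mor_def)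
  qed
  then show "Prim_mor K A D (cmp (hopf_cat K) A B D g f) =
      cmp (lie_cat K) (Prim K A) (Prim K B) (Prim K D) (Prim_mor K B D g) (Prim_mor K A B f)"
    using sub by (auto simp: hopf_cat_def lie_cat_def Prim_mor_def compose_def restrict_def intro!: ext)
qed

section \<open>Moore complexes\<close>

text \<open>
  An isomorphism from the ground field sends \<open>c = c \<cdot> 1\<close> to \<open>c1\<close> and preserves the counit, so \<open>c\<close> is
  recovered as \<open>\<epsilon>(x)\<close>.
\<close>

lemma zero_hopf_sub_elements:
  assumes z: "zero_hopf K (hopf_sub K H D)" and K: "cring K" and x: "x \<in> D"
  shows "x = counit H x \<odot>\<^bsub>H\<^esub> \<one>\<^bsub>H\<^esub>"
proof -
  interpret K: cring K by fact
  obtain h where h: "h \<in> hopf_hom K (ground_hopf K) (hopf_sub K H D)" "bij_betw h (carrier K) D"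
    using z by (auto simp: zero_hopf_def hopf_sub_simps)
  then obtain c where c: "c \<in> carrier K" "x = h c" using x by (auto simp: bij_betw_def)
  have g: "carrier (ground_hopf K) = carrier K" "counit (ground_hopf K) c = c" "one (ground_hopf K) = one K"
    "smult (ground_hopf K) = mult K"
    by (simp_all add: ground_hopf_def)
  have "counit H x = c" using h(1) c by (simp add: hopf_hom_def hopf_sub_simps g)
  moreover have "h (c \<otimes>\<^bsub>K\<^esub> \<one>\<^bsub>K\<^esub>) = c \<odot>\<^bsub>H\<^esub> h \<one>\<^bsub>K\<^esub>"
    using linear_map_smult[OF hopf_hom_linear[OF h(1)] c(1), of "\<one>\<^bsub>K\<^esub>"] by (simp add: g hopf_sub_simps)
  moreover have "h \<one>\<^bsub>K\<^esub> = \<one>\<^bsub>H\<^esub>" using hopf_hom_one[OF h(1)] by (simp add: g hopf_sub_simps)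
  ultimately show ?thesis using c by simp
qed

locale simplicial_hopf =
  fixes K :: "('k, 'z) ring_scheme" and H :: "(('k, 'a) hopf, 'a \<Rightarrow> 'a) simp"
  assumes simplicial: "simplicial_object (hopf_cat K) H"
begin

lemma level: "cocomm_hopf K (lvl H n)"
  using simplicial_objectD(1)[OF simplicial] by (simp add: hopf_cat_def)

lemma face_hom: "i \<le> Suc n \<Longrightarrow> face H n i \<in> hopf_hom K (lvl H (Suc n)) (lvl H n)"
  using simplicial_objectD(2)[OF simplicial] by (simp add: hopf_cat_def)

lemma face_hopf_map: "i \<le> Suc n \<Longrightarrow> hopf_map K (lvl H (Suc n)) (lvl H n) (face H n i)"
  using level face_hom by (simp add: hopf_map_def hopf_map_axioms_def)

abbreviation "G \<equiv> degreewise (Gl K) (Gl_mor K) H"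
abbreviation "L \<equiv> degreewise (Prim K) (Prim_mor K) H"
abbreviation "N n \<equiv> \<Inter>i\<in>{..n}. HKer K (lvl H (Suc n)) (lvl H n) (face H n i)"

lemma moore_subcoalgebra: "subcoalgebra K (lvl H (Suc n)) (N n)"
  and one_in_moore: "\<one>\<^bsub>lvl H (Suc n)\<^esub> \<in> N n"
proof -
  note * = HKer_Inter_subcoalgebra[OF level[of "Suc n"] level[of n] _ _ refl,
      where J = "{..n}" and f = "face H n"]
  show "subcoalgebra K (lvl H (Suc n)) (N n)"
    by (intro subcoalgebra.intro subcoalgebra_axioms.intro level *(1) *(2)) (simp_all add: face_hom)
  show "\<one>\<^bsub>lvl H (Suc n)\<^esub> \<in> N n" by (rule *(3)) (simp_all add: face_hom)
qed

lemma carrier_Gl_moore: "carrier (Gl K (moore_hopf K H (Suc n))) = N n \<inter> carrier (Gl K (lvl H (Suc n)))"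
  using subcoalgebra.Gl_sub[OF moore_subcoalgebra] by simp

lemma carrier_Prim_moore: "carrier (Prim K (moore_hopf K H (Suc n))) = N n \<inter> carrier (Prim K (lvl H (Suc n)))"
  using subcoalgebra.Prim_sub[OF moore_subcoalgebra one_in_moore] by simp

text \<open>
  The kernels of \<open>Gl(d\<^sub>i)\<close> are the group-likes in \<open>HKer(d\<^sub>i)\<close>, and \<open>\<Inter> HKer(d\<^sub>i)\<close> is a subcoalgebra, so its
  group-likes are the group-likes of \<open>H\<^sub>n\<close> that it contains.
\<close>

lemma moore_grp_Gl: "moore_grp G n = Gl K (moore_hopf K H n)"
proof (cases n)
  case (Suc m)
  let ?A = "lvl H (Suc m)" and ?B = "lvl H m"
  have ker: "kernel (Gl K ?A) (Gl K ?B) (Gl_mor K ?A ?B (face H m i)) =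
      HKer K ?A ?B (face H m i) \<inter> carrier (Gl K ?A)" if "i \<in> {..m}" for i
  proof -
    have "i \<le> Suc m" using that by simp
    note hopf_map.grouplike_in_HKer[OF face_hopf_map[OF this]]
    moreover have "\<one>\<^bsub>Gl K ?B\<^esub> = \<one>\<^bsub>?B\<^esub>" by (simp add: Gl_def)
    ultimately show ?thesis by (auto simp: kernel_def Gl_mor_def)
  qed
  have "carrier (moore_grp G n) = (\<Inter>i\<in>{..m}. HKer K ?A ?B (face H m i) \<inter> carrier (Gl K ?A))"
    using ker by (simp add: Suc degreewise_def)
  also have "\<dots> = carrier (Gl K (moore_hopf K H n))"
    unfolding Suc carrier_Gl_moore by auto
  finally have c: "carrier (moore_grp G n) = carrier (Gl K (moore_hopf K H n))" .
  show ?thesis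
    by (rule monoid.equality[OF c]) (simp_all add: Suc degreewise_def Gl_def hopf_sub_simps)
qed (simp add: degreewise_def)

lemma moore_lie_Prim: "moore_lie L n = Prim K (moore_hopf K H n)"
proof (cases n)
  case (Suc m)
  let ?A = "lvl H (Suc m)" and ?B = "lvl H m"
  have ker: "a_kernel (Prim K ?A) (Prim K ?B) (Prim_mor K ?A ?B (face H m i)) =
      HKer K ?A ?B (face H m i) \<inter> carrier (Prim K ?A)" if "i \<in> {..m}" for i
  proof -
    have "i \<le> Suc m" using that by simp
    note hopf_map.primitive_in_HKer[OF face_hopf_map[OF this]]
    moreover have "\<zero>\<^bsub>Prim K ?B\<^esub> = \<zero>\<^bsub>?B\<^esub>" by (simp add: Prim_def)
    ultimately show ?thesis by (auto simp: a_kernel_def' Prim_mor_def)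
  qed
  have "carrier (moore_lie L n) = (\<Inter>i\<in>{..m}. HKer K ?A ?B (face H m i) \<inter> carrier (Prim K ?A))"
    using ker by (simp add: Suc degreewise_def)
  also have "\<dots> = carrier (Prim K (moore_hopf K H n))"
    unfolding Suc carrier_Prim_moore by auto
  finally have c: "carrier (moore_lie L n) = carrier (Prim K (moore_hopf K H n))" .
  show ?thesis
    by (rule lie.equality[OF c]) (simp_all add: Suc degreewise_def Prim_def hopf_sub_simps)
qed (simp add: degreewise_def)

lemma bd_grp_Gl: "bd_grp G n = Gl_mor K (moore_hopf K H (Suc n)) (moore_hopf K H n) (bd_hopf K H n)"
proof -
  let ?S = "moore_hopf K H (Suc n)"
  have "carrier (Gl K ?S) \<subseteq> carrier (Gl K (lvl H (Suc n)))" "carrier (Gl K ?S) \<subseteq> carrier ?S"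
    unfolding carrier_Gl_moore by (auto simp: hopf_sub_simps)
  then show ?thesis
    unfolding bd_grp_def bd_hopf_def Gl_mor_def moore_grp_Gl
    by (auto simp: degreewise_def Gl_mor_def restrict_def intro!: ext)
qed

lemma bd_lie_Prim: "bd_lie L n = Prim_mor K (moore_hopf K H (Suc n)) (moore_hopf K H n) (bd_hopf K H n)"
proof -
  let ?S = "moore_hopf K H (Suc n)"
  have "carrier (Prim K ?S) \<subseteq> carrier (Prim K (lvl H (Suc n)))" "carrier (Prim K ?S) \<subseteq> carrier ?S"
    unfolding carrier_Prim_moore by (auto simp: hopf_sub_simps)
  then show ?thesis
    unfolding bd_lie_def bd_hopf_def Prim_mor_def moore_lie_Prim
    by (auto simp: degreewise_def Prim_mor_def restrict_def intro!: ext)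
qed

lemma length_Gl:
  assumes len: "hopf_length K n H" shows "grp_length n G"
  unfolding grp_length_def moore_grp_Gl
proof (intro allI impI)
  fix i assume "n < i"
  then obtain m where i: "i = Suc m" by (cases i) auto
  interpret A: cocomm_hopf K "lvl H (Suc m)" by (rule level)
  have z: "zero_hopf K (hopf_sub K (lvl H (Suc m)) (N m))"
    using len \<open>n < i\<close> unfolding hopf_length_def i by (metis moore_hopf.simps(2))
  have one: "\<one>\<^bsub>Gl K (moore_hopf K H i)\<^esub> = \<one>\<^bsub>lvl H (Suc m)\<^esub>" by (simp add: i Gl_def hopf_sub_simps)
  have "x = \<one>\<^bsub>lvl H (Suc m)\<^esub>" if x: "x \<in> N m" "x \<in> carrier (Gl K (lvl H (Suc m)))" for x
  proof -
    have "counit (lvl H (Suc m)) x = \<one>\<^bsub>K\<^esub>" using x(2) by (simp add: Gl_def)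
    then show ?thesis using zero_hopf_sub_elements[OF z A.K.is_cring x(1)] by simp
  qed
  moreover have "\<one>\<^bsub>lvl H (Suc m)\<^esub> \<in> carrier (Gl K (lvl H (Suc m)))"
    using monoid.one_closed[OF group.is_monoid[OF A.Gl_group]] by (simp add: Gl_def)
  ultimately show "carrier (Gl K (moore_hopf K H i)) = {\<one>\<^bsub>Gl K (moore_hopf K H i)\<^esub>}"
    unfolding one using one_in_moore[of m] unfolding i carrier_Gl_moore by blast
qed

lemma length_Prim:
  assumes len: "hopf_length K n H" shows "lie_length n L"
  unfolding lie_length_def moore_lie_Prim
proof (intro allI impI)
  fix i assume "n < i"
  then obtain m where i: "i = Suc m" by (cases i) auto
  interpret A: cocomm_hopf K "lvl H (Suc m)" by (rule level)
  have z: "zero_hopf K (hopf_sub K (lvl H (Suc m)) (N m))"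
    using len \<open>n < i\<close> unfolding hopf_length_def i by (metis moore_hopf.simps(2))
  have zero: "\<zero>\<^bsub>Prim K (moore_hopf K H i)\<^esub> = \<zero>\<^bsub>lvl H (Suc m)\<^esub>" by (simp add: i Prim_def hopf_sub_simps)
  have "x = \<zero>\<^bsub>lvl H (Suc m)\<^esub>" if x: "x \<in> N m" "x \<in> carrier (Prim K (lvl H (Suc m)))" for x
    using zero_hopf_sub_elements[OF z A.K.is_cring x(1)] A.counit_prim[OF x(2)] by simp
  moreover have "\<zero>\<^bsub>lvl H (Suc m)\<^esub> \<in> carrier (Prim K (lvl H (Suc m)))"
    by (rule submodule_zero[OF A.Prim_submodule])
  moreover have "\<zero>\<^bsub>lvl H (Suc m)\<^esub> \<in> N m"
    by (rule submodule_zero[OF subcoalgebra.sub[OF moore_subcoalgebra]])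
  ultimately show "carrier (Prim K (moore_hopf K H i)) = {\<zero>\<^bsub>Prim K (moore_hopf K H i)\<^esub>}"
    unfolding zero unfolding i carrier_Prim_moore by blast
qed

end

theorem proposition3p10:
  fixes K :: "('k, 'z) ring_scheme"
  assumes "field K"
  shows
    "(\<forall>H :: (('k, 'a) hopf, 'a \<Rightarrow> 'a) simp. simplicial_object (hopf_cat K) H \<longrightarrow>
        (let G = degreewise (Gl K) (Gl_mor K) H; L = degreewise (Prim K) (Prim_mor K) H in
          simplicial_object grp_cat G \<and>
          simplicial_object (lie_cat K) L \<and>
          (\<forall>n. moore_grp G n = Gl K (moore_hopf K H n)) \<and>
          (\<forall>n. bd_grp G n =
             Gl_mor K (moore_hopf K H (Suc n)) (moore_hopf K H n) (bd_hopf K H n)) \<and>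
          (\<forall>n. moore_lie L n = Prim K (moore_hopf K H n)) \<and>
          (\<forall>n. bd_lie L n =
             Prim_mor K (moore_hopf K H (Suc n)) (moore_hopf K H n) (bd_hopf K H n)) \<and>
          (\<forall>n. hopf_length K n H \<longrightarrow> grp_length n G \<and> lie_length n L))) \<and>
     (\<forall>n. is_functor
        (full_subcat (simp_cat (hopf_cat K :: (('k, 'a) hopf, 'a \<Rightarrow> 'a) cat)) (hopf_length K n))
        (full_subcat (simp_cat (grp_cat :: ('a monoid, 'a \<Rightarrow> 'a) cat)) (grp_length n))
        (degreewise (Gl K) (Gl_mor K)) (degreewise_mor (Gl_mor K)) \<and>
      is_functor
        (full_subcat (simp_cat (hopf_cat K :: (('k, 'a) hopf, 'a \<Rightarrow> 'a) cat)) (hopf_length K n))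
        (full_subcat (simp_cat (lie_cat K :: (('k, 'a) lie, 'a \<Rightarrow> 'a) cat)) (lie_length n))
        (degreewise (Prim K) (Prim_mor K)) (degreewise_mor (Prim_mor K)))"
proof (intro conjI allI impI)
  fix H :: "(('k, 'a) hopf, 'a \<Rightarrow> 'a) simp"
  assume H: "simplicial_object (hopf_cat K) H"
  then interpret simplicial_hopf K H by (rule simplicial_hopf.intro)
  show "let G = degreewise (Gl K) (Gl_mor K) H; L = degreewise (Prim K) (Prim_mor K) H in
          simplicial_object grp_cat G \<and>
          simplicial_object (lie_cat K) L \<and>
          (\<forall>n. moore_grp G n = Gl K (moore_hopf K H n)) \<and>
          (\<forall>n. bd_grp G n =
             Gl_mor K (moore_hopf K H (Suc n)) (moore_hopf K H n) (bd_hopf K H n)) \<and>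
          (\<forall>n. moore_lie L n = Prim K (moore_hopf K H n)) \<and>
          (\<forall>n. bd_lie L n =
             Prim_mor K (moore_hopf K H (Suc n)) (moore_hopf K H n) (bd_hopf K H n)) \<and>
          (\<forall>n. hopf_length K n H \<longrightarrow> grp_length n G \<and> lie_length n L)"
    unfolding Let_def
    by (intro conjI allI impI degreewise_simplicial_object[OF Gl_functor H]
        degreewise_simplicial_object[OF Prim_functor H] moore_grp_Gl moore_lie_Prim
        bd_grp_Gl bd_lie_Prim length_Gl length_Prim)
next
  fix n
  show "is_functor
        (full_subcat (simp_cat (hopf_cat K :: (('k, 'a) hopf, 'a \<Rightarrow> 'a) cat)) (hopf_length K n))
        (full_subcat (simp_cat (grp_cat :: ('a monoid, 'a \<Rightarrow> 'a) cat)) (grp_length n))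
        (degreewise (Gl K) (Gl_mor K)) (degreewise_mor (Gl_mor K))"
    by (rule degreewise_functor[OF Gl_functor])
      (rule simplicial_hopf.length_Gl[OF simplicial_hopf.intro])
  show "is_functor
        (full_subcat (simp_cat (hopf_cat K :: (('k, 'a) hopf, 'a \<Rightarrow> 'a) cat)) (hopf_length K n))
        (full_subcat (simp_cat (lie_cat K :: (('k, 'a) lie, 'a \<Rightarrow> 'a) cat)) (lie_length n))
        (degreewise (Prim K) (Prim_mor K)) (degreewise_mor (Prim_mor K))"
    by (rule degreewise_functor[OF Prim_functor])
      (rule simplicial_hopf.length_Prim[OF simplicial_hopf.intro])
qed

end
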